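(* Let $u_0,u_1\in\mathcal S(\mathbb R)$ be real-valued with $\int_{\mathbb R}u_1\,dx=0$ and such that Assumptions (i)–(iii) listed in the context hold, and let $\mathcal I$ be a fixed compact subset of $(1,\infty)$. Write $\{\lambda_j\}_{j=1}^{n_b}:=\mathsf Z\cap D_{\mathrm{reg}}$ and $\{\mu_j\}_{j=1}^{n_s}:=\mathsf Z\cap\mathbb R$, with residue constants $c_{\lambda_j},c_{\mu_j}$. Then the function $$u_{\mathrm{sol}}(x,t):=-i\sqrt3\,\frac{\partial}{\partial x}\lim_{k\to\infty}k\Big(\big((1,1,1)M_{\mathrm{sol}}(x,t,k)\big)_3-1\Big),$$ where $M_{\mathrm{sol}}$ is the unique solution of the Riemann–Hilbert problem stated in the context, is given for $\zeta=x/t\in\mathcal I$ by $$u_{\mathrm{sol}}(x,t)=u_s\bigg(x,t;\Big(\lambda_j,\frac{c_{\lambda_j}}{\hat\Delta_{11}(\zeta,\lambda_j)\hat\Delta_{33}^{-1}(\zeta,\lambda_j)}\Big)_{j=1}^{n_b},\Big(\mu_j,\frac{c_{\mu_j}}{\hat\Delta_{11}(\zeta,\mu_j)\hat\Delta_{22}^{-1}(\zeta,\mu_j)}\Big)_{j=1}^{n_s}\bigg),$$ where $u_s$ is the multi-soliton function defined in the context (the $x$-derivatives in the definition of $u_s$ being evaluated before the constants $c_{\lambda_j}$ and $c_{\mu_j}$ are replaced by the functions $\frac{c_{\lambda_j}}{\hat\Delta_{11}(\zeta,\lambda_j)\hat\Delta_{33}^{-1}(\zeta,\lambda_j)}$ and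 $\frac{c_{\mu_j}}{\hat\Delta_{11}(\zeta,\mu_j)\hat\Delta_{22}^{-1}(\zeta,\mu_j)}$, respectively; that is, the $x$-derivatives in the definition of $u_s$ do not act on $\hat\Delta_{11},\hat\Delta_{22},\hat\Delta_{33}$).
   Context: **Scattering data.** Let $\omega=e^{2\pi i/3}$, $\mathbb D=\{|k|<1\}$, $\kappa_j=e^{\pi i(j-1)/3}$ ($j=1,\dots,6$), $\mathcal Q=\{\kappa_j\}_{j=1}^6$. For $k\in\mathbb C\setminus\{0\}$ and $j=1,2,3$ put $$l_j(k)=i\frac{\omega^jk+(\omega^jk)^{-1}}{2\sqrt3},\qquad z_j(k)=i\frac{(\omega^jk)^2+(\omega^jk)^{-2}}{4\sqrt3}.$$ Let $\hat\Gamma_1=[0,i]\cup\{-iy:y\ge1\}\cup\partial\mathbb D$ and $\hat\Gamma_4=[0,-i]\cup\{iy:y\ge1\}\cup\partial\mathbb D$. Let $D_1=\{|k|<1,\arg k\in(\frac\pi2,\frac{5\pi}6)\}\cup\{|k|>1,\arg k\in(-\frac\pi2,-\frac\pi6)\}$, $D_2=\{|k|<1,\arg k\in(\frac{5\pi}6,\frac{7\pi}6)\}\cup\{|k|>1,\arg k\in(-\frac\pi6,\frac\pi6)\}$, $D_4=\{|k|<1,\arg k\in(-\frac\pi2,-\frac\pi6)\}\cup\{|k|>1,\arg k\in(\frac\pi2,\frac{5\pi}6)\}$, $D_5=\{|k|<1,\arg k\in(-\frac\pi6,\frac\pi6)\}\cup\{|k|>1,\arg k\in(\frac{5\pi}6,\frac{7\pi}6)\}$.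 Given real-valued $u_0,u_1\in\mathcal S(\mathbb R)$ with $\int_{\mathbb R}u_1dx=0$, let $v_0(x)=\int_{-\infty}^xu_1(x')dx'$, $$P(k)=\begin{pmatrix}1&1&1\\ l_1&l_2&l_3\\ l_1^2&l_2^2&l_3^2\end{pmatrix},\quad \mathsf U(x,k)=P(k)^{-1}\begin{pmatrix}0&0&0\\0&0&0\\-\frac{u_{0x}}4-\frac{iv_0}{4\sqrt3}&-\frac{u_0}2&0\end{pmatrix}P(k),\quad \mathcal L=\mathrm{diag}(l_1,l_2,l_3).$$ Let $X,X^A,Y,Y^A$ be the unique solutions of the Volterra equations (understood columnwise, for those $k\in\mathbb C\setminus(\mathcal Q\cup\{0\})$ for which they make sense) $$X=I-\int_x^\infty e^{(x-x')\mathcal L}(\mathsf UX)(x',k)e^{-(x-x')\mathcal L}dx',\quad X^A=I+\int_x^\infty e^{-(x-x')\mathcal L}(\mathsf U^TX^A)(x',k)e^{(x-x')\mathcal L}dx',$$ $$Y=I+\int_{-\infty}^xe^{(x-x')\mathcal L}(\mathsf UY)(x',k)e^{-(x-x')\mathcal L}dx',\quad Y^A=I-\int_{-\infty}^xe^{-(x-x')\mathcal L}(\mathsf U^TY^A)(x',k)e^{(x-x')\mathcal L}dx'.$$ Define (entrywise) $s(k)=I-\int_{\mathbb R}e^{-x\mathcal L}(\mathsf UX)(x,k)e^{x\mathcal L}dx$ and $s^A(k)=I+\int_{\mathbb R}e^{x\mathcal L}(\mathsf U^TX^A)(x,k)e^{-x\mathcal L}dx$. The functions $s_{11}$ and $s^A_{11}$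 are analytic in the interiors of $\bar D_1\cup\bar D_2$ and $\bar D_4\cup\bar D_5$, respectively. Put $$r_1(k)=\frac{s_{12}(k)}{s_{11}(k)},\ k\in\hat\Gamma_1\setminus(\mathcal Q\cup\{0\}),\qquad r_2(k)=\frac{s^A_{12}(k)}{s^A_{11}(k)},\ k\in\hat\Gamma_4\setminus(\mathcal Q\cup\{0\}).$$ Let $D_{\mathrm{reg}}=D_2\cap(\{|k|>1,\mathrm{Im}\,k>0\}\cup\{|k|<1,\mathrm{Im}\,k<0\})$; note $D_2\cap\mathbb R=(-1,0)\cup(1,\infty)$. Let $\mathsf Z$ be the set of zeros of $s_{11}$ in $D_2$. Write $[A]_j$ for the $j$th column of $A$ and a dot for $d/dk$. With $$w=\begin{pmatrix} Y^A_{21}X^A_{32}-Y^A_{31}X^A_{22}\\ Y^A_{31}X^A_{12}-Y^A_{11}X^A_{32}\\ Y^A_{11}X^A_{22}-Y^A_{21}X^A_{12}\end{pmatrix},$$ the residue constant $c_{k_0}\in\mathbb C$ is the unique constant such that, for all $x\in\mathbb R$, $\frac{w(x,k_0)}{\dot s_{11}(k_0)}=c_{k_0}e^{(l_1(k_0)-l_3(k_0))x}[X(x,k_0)]_1$ if $k_0\in\mathsf Z\setminus\mathbb R$, and $\frac{[Y(x,k_0)]_2}{\dot s^A_{22}(k_0)}=c_{k_0}e^{(l_1(k_0)-l_2(k_0))x}[X(x,k_0)]_1$ if $k_0\in\mathsf Z\cap\mathbb R$. **Assumptions.** (i) $\mathsf Z\subset D_{\mathrm{reg}}\cup(-1,0)\cup(1,\infty)$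 is finite, $s_{11}$ has a simple zero at each point of $\mathsf Z$ and no other zeros in $(\bar D_2\cup\partial\mathbb D)\setminus(\mathcal Q\cup\{0\})$; $s^A_{22}(k_0)\ne0$ for $k_0\in\mathsf Z\setminus\mathbb R$; $i(\omega^2k_0^2-\omega)c_{k_0}\ge0$ for $k_0\in\mathsf Z\cap\mathbb R$. (ii) For $k_\star=1$ and $k_\star=-1$, the limits as $k\to k_\star$ of $(k-k_\star)s_{11}$, $(k-k_\star)s_{13}$, $s_{31}$, $s_{33}$, $(k-k_\star)s^A_{11}$, $(k-k_\star)s^A_{31}$, $s^A_{13}$, $s^A_{33}$ are all nonzero. (iii) $r_1(k)=0$ for all $k\in[0,i]$ (the segment from $0$ to $i$). **Phases and $\hat\Delta_{jj}$.** For $\zeta>1$ let $k_1=k_1(\zeta)=\tfrac14\big(\zeta-\sqrt{8+\zeta^2}+i\sqrt2\sqrt{4-\zeta^2+\zeta\sqrt{8+\zeta^2}}\big)$, so $|k_1|=1$, $\arg k_1\in(\frac\pi2,\frac{2\pi}3)$. Let $\theta_{ij}(x,t,k)=(l_i(k)-l_j(k))x+(z_i(k)-z_j(k))t$. Let $\delta(\zeta,k)=\exp\{\frac{-1}{2\pi i}\int_i^{k_1}\frac{\ln(1+r_1(s)r_2(s))}{s-k}ds\}$, the path following the unit circle counterclockwise from $i$ to $k_1$ (on it $1+r_1r_2$ is real and $\ge1$) with the principal logarithm; for $k\in\mathbb C\setminus\partial\mathbb D$: $\hat\Delta_{33}(\zeta,k)=\frac{\delta(\zeta,\omega k)}{\delta(\zeta,\omega^2k)}\frac{\delta(\zeta,\frac1{\omega^2k})}{\delta(\zeta,\frac1{\omega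 k})}$, $\hat\Delta_{11}(\zeta,k)=\hat\Delta_{33}(\zeta,\omega k)$, $\hat\Delta_{22}(\zeta,k)=\hat\Delta_{33}(\zeta,\omega^2k)$. **RH problem for $M_{\mathrm{sol}}$.** For $k_0\in\mathsf Z\setminus\mathbb R$ let $d_{k_0}=\frac{\bar k_0^2-1}{\omega^2(\omega^2-\bar k_0^2)}\bar c_{k_0}$. Let $\hat{\mathsf Z}$ be the set of all points $\omega^jk_0,\omega^j\bar k_0,\omega^jk_0^{-1},\omega^j\bar k_0^{-1}$ with $k_0\in\mathsf Z$, $j=0,1,2$. Let $\mathcal A=\begin{pmatrix}0&0&1\\1&0&0\\0&1&0\end{pmatrix}$, $\mathcal B=\begin{pmatrix}0&1&0\\1&0&0\\0&0&1\end{pmatrix}$. Find $M_{\mathrm{sol}}(x,t,k)\in\mathbb C^{3\times3}$ such that: (a) $M_{\mathrm{sol}}(x,t,\cdot)$ is analytic on $\mathbb C\setminus\hat{\mathsf Z}$; (b) $M_{\mathrm{sol}}(x,t,k)=\mathcal AM_{\mathrm{sol}}(x,t,\omega k)\mathcal A^{-1}=\mathcal BM_{\mathrm{sol}}(x,t,k^{-1})\mathcal B$; (c) $M_{\mathrm{sol}}=I+O(k^{-1})$ as $k\to\infty$; (d) at each $k_0\in\mathsf Z\setminus\mathbb R$ the first two columns are analytic, the third has at most a simple pole, and $\mathrm{Res}_{k=k_0}[M_{\mathrm{sol}}]_3=\frac{c_{k_0}e^{-\theta_{31}(x,t,k_0)}}{\hat\Delta_{11}(\zeta,k_0)\hat\Delta_{33}^{-1}(\zeta,k_0)}[M_{\mathrm{sol}}(x,t,k_0)]_1$;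 at each $\bar k_0$ with $k_0\in\mathsf Z\setminus\mathbb R$ the first and third columns are analytic, the second has at most a simple pole, and $\mathrm{Res}_{k=\bar k_0}[M_{\mathrm{sol}}]_2=\frac{d_{k_0}e^{\theta_{32}(x,t,\bar k_0)}}{\hat\Delta_{33}(\zeta,\bar k_0)\hat\Delta_{22}^{-1}(\zeta,\bar k_0)}[M_{\mathrm{sol}}(x,t,\bar k_0)]_3$; at each $k_0\in\mathsf Z\cap\mathbb R$ the first and third columns are analytic, the second has at most a simple pole, and $\mathrm{Res}_{k=k_0}[M_{\mathrm{sol}}]_2=\frac{c_{k_0}e^{-\theta_{21}(x,t,k_0)}}{\hat\Delta_{11}(\zeta,k_0)\hat\Delta_{22}^{-1}(\zeta,k_0)}[M_{\mathrm{sol}}(x,t,k_0)]_1$. Here $\zeta=x/t$. The solution exists, is unique and has unit determinant. **Role of $u_{\mathrm{sol}}$.** Under the stated assumptions, $u_{\mathrm{sol}}$ is the leading (order $1$) term, and the next term is $O(t^{-1/2})$, in the asymptotics as $t\to\infty$, uniformly for $\zeta=x/t\in\mathcal I$, of the global solution $u(x,t)$ of $u_{tt}=u_{xx}+(u^2)_{xx}+u_{xxxx}$ with $u(x,0)=u_0(x)$, $u_t(x,0)=u_1(x)$. **The multi-soliton function $u_s$.** Given $\lambda_1,\dots,\lambda_{n_b}\in D_{\mathrm{reg}}$ with constants $c_{\lambda_j}\in\mathbb C$ and $\mu_1,\dots,\mu_{n_s}\in(-1,0)\cup(1,\infty)$ with constants $c_{\mu_j}\in\mathbb C$ satisfying $i(\omega^2\mu_j^2-\omega)c_{\mu_j}\ge0$,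 put $\tilde c_{\lambda_j}=\frac{i(\lambda_j^2-1)}{2\sqrt3\lambda_j^2}c_{\lambda_j}$, $\tilde c_{\mu_j}=\frac{i(\mu_j^2-\omega^2)}{2\sqrt3\mu_j^2}\omega^2c_{\mu_j}$, and define $(L_a,Z_a,L'_a,Z'_a,C_a)$ for $1\le a\le 2n_b+n_s$ by $(l_1(\lambda_j),z_1(\lambda_j),l_3(\lambda_j),z_3(\lambda_j),\tilde c_{\lambda_j})$ for $a=j\le n_b$; $(l_3(\bar\lambda_j),z_3(\bar\lambda_j),l_2(\bar\lambda_j),z_2(\bar\lambda_j),\overline{\tilde c_{\lambda_j}})$ for $a=n_b+j$, $1\le j\le n_b$; $(l_1(\mu_j),z_1(\mu_j),l_2(\mu_j),z_2(\mu_j),\tilde c_{\mu_j})$ for $a=2n_b+j$, $1\le j\le n_s$. Let $B=B(x,t)$ be the $(2n_b+n_s)\times(2n_b+n_s)$ matrix with entries $B_{ab}=\frac{C_b\,e^{x(L_a-L'_b)+t(Z_a-Z'_b)}}{L_a-L'_b}$, and set $$u_s\big(x,t;(\lambda_j,c_{\lambda_j})_{j=1}^{n_b},(\mu_j,c_{\mu_j})_{j=1}^{n_s}\big)=6\,\frac{\partial^2}{\partial x^2}\ln\det(I-B).$$ *)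

theory Defs
  imports
    "HOL-Complex_Analysis.Complex_Analysis"
    "Jordan_Normal_Form.Determinant"
begin

(* Fixed 3x3 matrices are of type complex^3^3 (HOL-Analysis); the determinant of variable size in the
   multi-soliton formula is that of Jordan_Normal_Form. *)
no_notation Matrix.vec_index (infixl \<open>$\<close> 100)
no_notation fps_nth (infixl \<open>$\<close> 75)
hide_const (open) Matrix.mat Matrix.vec Determinant.det Matrix.row Matrix.col

subsection \<open>Spectral functions\<close>

definition \<omega> :: complex where
  "\<omega> = exp (2 * of_real pi * \<i> / 3)"

definition Qset :: "complex set" where
  "Qset = {exp (of_real pi * \<i> * (of_nat j - 1) / 3) | j::nat. j \<in> {1..6}}"

(* omega^j k for a column index j.  In the index type 3 the numeral 3 is the element 0, hence the
   explicit exponents. *)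
definition rot :: "3 \<Rightarrow> complex \<Rightarrow> complex" where
  "rot j k = \<omega> ^ (if j = 1 then 1 else if j = 2 then 2 else 3) * k"

definition lfun :: "3 \<Rightarrow> complex \<Rightarrow> complex" where
  "lfun j k = \<i> * (rot j k + inverse (rot j k)) / (2 * of_real (sqrt 3))"

definition zfun :: "3 \<Rightarrow> complex \<Rightarrow> complex" where
  "zfun j k = \<i> * ((rot j k)\<^sup>2 + inverse ((rot j k)\<^sup>2)) / (4 * of_real (sqrt 3))"

definition theta_phase :: "3 \<Rightarrow> 3 \<Rightarrow> real \<Rightarrow> real \<Rightarrow> complex \<Rightarrow> complex" where
  "theta_phase i j x t k = (lfun i k - lfun j k) * of_real x + (zfun i k - zfun j k) * of_real t"

definition sector :: "real \<Rightarrow> real \<Rightarrow> complex set" where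
  "sector a b = {of_real r * cis \<phi> | r \<phi>. 0 < r \<and> a < \<phi> \<and> \<phi> < b}"

definition D2 :: "complex set" where
  "D2 = {k \<in> sector (5 * pi / 6) (7 * pi / 6). norm k < 1} \<union>
        {k \<in> sector (- pi / 6) (pi / 6). norm k > 1}"

definition Dreg :: "complex set" where
  "Dreg = D2 \<inter> ({k. norm k > 1 \<and> Im k > 0} \<union> {k. norm k < 1 \<and> Im k < 0})"

subsection \<open>Direct scattering\<close>

definition schwartz :: "(real \<Rightarrow> real) \<Rightarrow> bool" where
  "schwartz f \<longleftrightarrow> (\<forall>n x. (deriv ^^ n) f field_differentiable at x) \<and>
     (\<forall>m n. \<exists>C. \<forall>x. \<bar>x ^ m * (deriv ^^ n) f x\<bar> \<le> C)"

definition v0 :: "(real \<Rightarrow> real) \<Rightarrow> real \<Rightarrow> real" where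
  "v0 u1 x = (LBINT y:{..x}. u1 y)"

definition Pmat :: "complex \<Rightarrow> complex^3^3" where
  "Pmat k = vector [vector [1, 1, 1],
                    vector [lfun 1 k, lfun 2 k, lfun 3 k],
                    vector [(lfun 1 k)\<^sup>2, (lfun 2 k)\<^sup>2, (lfun 3 k)\<^sup>2]]"

definition Umat :: "(real \<Rightarrow> real) \<Rightarrow> (real \<Rightarrow> real) \<Rightarrow> real \<Rightarrow> complex \<Rightarrow> complex^3^3" where
  "Umat u0 u1 x k = matrix_inv (Pmat k) **
     vector [vector [0, 0, 0],
             vector [0, 0, 0],
             vector [- of_real (deriv u0 x) / 4 - \<i> * of_real (v0 u1 x) / (4 * of_real (sqrt 3)),
                     - of_real (u0 x) / 2,
                     0]] ** Pmat k"

definition UTmat :: "(real \<Rightarrow> real) \<Rightarrow> (real \<Rightarrow> real) \<Rightarrow> real \<Rightarrow> complex \<Rightarrow> complex^3^3" where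
  "UTmat u0 u1 x k = Finite_Cartesian_Product.transpose (Umat u0 u1 x k)"

(* The Volterra equations for the j-th columns.  Conjugation by exp (y * diag (lfun 1, lfun 2, lfun 3))
   multiplies the (i,j) entry by exp (y * (lfun i - lfun j)).  Integrability of the integrand is part of being a
   solution; it forces the asymptotics at the respective end of the real line and thereby uniqueness
   at those k for which the exponentials are bounded. *)
definition is_X_col ::
  "(real \<Rightarrow> real) \<Rightarrow> (real \<Rightarrow> real) \<Rightarrow> complex \<Rightarrow> 3 \<Rightarrow> (real \<Rightarrow> complex^3) \<Rightarrow> bool" where
  "is_X_col u0 u1 k j f \<longleftrightarrow> (\<forall>x i.
     set_integrable lborel {x..} (\<lambda>y. exp (of_real (x - y) * (lfun i k - lfun j k)) * (Umat u0 u1 y k *v f y) $ i) \<and>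
     f x $ i = (if i = j then 1 else 0) -
       (LBINT y:{x..}. exp (of_real (x - y) * (lfun i k - lfun j k)) * (Umat u0 u1 y k *v f y) $ i))"

definition is_XA_col ::
  "(real \<Rightarrow> real) \<Rightarrow> (real \<Rightarrow> real) \<Rightarrow> complex \<Rightarrow> 3 \<Rightarrow> (real \<Rightarrow> complex^3) \<Rightarrow> bool" where
  "is_XA_col u0 u1 k j f \<longleftrightarrow> (\<forall>x i.
     set_integrable lborel {x..} (\<lambda>y. exp (- of_real (x - y) * (lfun i k - lfun j k)) * (UTmat u0 u1 y k *v f y) $ i) \<and>
     f x $ i = (if i = j then 1 else 0) +
       (LBINT y:{x..}. exp (- of_real (x - y) * (lfun i k - lfun j k)) * (UTmat u0 u1 y k *v f y) $ i))"

definition is_Y_col ::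
  "(real \<Rightarrow> real) \<Rightarrow> (real \<Rightarrow> real) \<Rightarrow> complex \<Rightarrow> 3 \<Rightarrow> (real \<Rightarrow> complex^3) \<Rightarrow> bool" where
  "is_Y_col u0 u1 k j f \<longleftrightarrow> (\<forall>x i.
     set_integrable lborel {..x} (\<lambda>y. exp (of_real (x - y) * (lfun i k - lfun j k)) * (Umat u0 u1 y k *v f y) $ i) \<and>
     f x $ i = (if i = j then 1 else 0) +
       (LBINT y:{..x}. exp (of_real (x - y) * (lfun i k - lfun j k)) * (Umat u0 u1 y k *v f y) $ i))"

definition is_YA_col ::
  "(real \<Rightarrow> real) \<Rightarrow> (real \<Rightarrow> real) \<Rightarrow> complex \<Rightarrow> 3 \<Rightarrow> (real \<Rightarrow> complex^3) \<Rightarrow> bool" where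
  "is_YA_col u0 u1 k j f \<longleftrightarrow> (\<forall>x i.
     set_integrable lborel {..x} (\<lambda>y. exp (- of_real (x - y) * (lfun i k - lfun j k)) * (UTmat u0 u1 y k *v f y) $ i) \<and>
     f x $ i = (if i = j then 1 else 0) -
       (LBINT y:{..x}. exp (- of_real (x - y) * (lfun i k - lfun j k)) * (UTmat u0 u1 y k *v f y) $ i))"

definition jostX :: "(real \<Rightarrow> real) \<Rightarrow> (real \<Rightarrow> real) \<Rightarrow> real \<Rightarrow> complex \<Rightarrow> complex^3^3" where
  "jostX u0 u1 x k = (\<chi> i j. (THE f. is_X_col u0 u1 k j f) x $ i)"

definition jostXA :: "(real \<Rightarrow> real) \<Rightarrow> (real \<Rightarrow> real) \<Rightarrow> real \<Rightarrow> complex \<Rightarrow> complex^3^3" where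
  "jostXA u0 u1 x k = (\<chi> i j. (THE f. is_XA_col u0 u1 k j f) x $ i)"

definition jostY :: "(real \<Rightarrow> real) \<Rightarrow> (real \<Rightarrow> real) \<Rightarrow> real \<Rightarrow> complex \<Rightarrow> complex^3^3" where
  "jostY u0 u1 x k = (\<chi> i j. (THE f. is_Y_col u0 u1 k j f) x $ i)"

definition jostYA :: "(real \<Rightarrow> real) \<Rightarrow> (real \<Rightarrow> real) \<Rightarrow> real \<Rightarrow> complex \<Rightarrow> complex^3^3" where
  "jostYA u0 u1 x k = (\<chi> i j. (THE f. is_YA_col u0 u1 k j f) x $ i)"

definition smat :: "(real \<Rightarrow> real) \<Rightarrow> (real \<Rightarrow> real) \<Rightarrow> 3 \<Rightarrow> 3 \<Rightarrow> complex \<Rightarrow> complex" where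
  "smat u0 u1 i j k = (if i = j then 1 else 0) -
     (LBINT x. exp (- of_real x * (lfun i k - lfun j k)) * (Umat u0 u1 x k ** jostX u0 u1 x k) $ i $ j)"

definition smatA :: "(real \<Rightarrow> real) \<Rightarrow> (real \<Rightarrow> real) \<Rightarrow> 3 \<Rightarrow> 3 \<Rightarrow> complex \<Rightarrow> complex" where
  "smatA u0 u1 i j k = (if i = j then 1 else 0) +
     (LBINT x. exp (of_real x * (lfun i k - lfun j k)) * (UTmat u0 u1 x k ** jostXA u0 u1 x k) $ i $ j)"

(* The k at which the (i,j) entry of smat (resp. smatA) makes sense: the exponentials in the Volterra
   equation for the j-th column and in the integral over the real line are bounded.  E.g. s_dom 1 2
   consists of the unit circle, the segment from 0 to i and the ray from -i to -i*infinity, and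
   s_dom 1 1 of the unit circle and two closed sectors that include the closure of D2 (all without 0
   and Qset). *)
definition s_dom :: "3 \<Rightarrow> 3 \<Rightarrow> complex set" where
  "s_dom i j = {k. k \<noteq> 0 \<and> k \<notin> Qset \<and> Re (lfun i k) = Re (lfun j k) \<and> (\<forall>m. Re (lfun j k) \<le> Re (lfun m k))}"

definition sA_dom :: "3 \<Rightarrow> 3 \<Rightarrow> complex set" where
  "sA_dom i j = {k. k \<noteq> 0 \<and> k \<notin> Qset \<and> Re (lfun i k) = Re (lfun j k) \<and> (\<forall>m. Re (lfun m k) \<le> Re (lfun j k))}"

definition r1 :: "(real \<Rightarrow> real) \<Rightarrow> (real \<Rightarrow> real) \<Rightarrow> complex \<Rightarrow> complex" where
  "r1 u0 u1 k = smat u0 u1 1 2 k / smat u0 u1 1 1 k"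

definition r2 :: "(real \<Rightarrow> real) \<Rightarrow> (real \<Rightarrow> real) \<Rightarrow> complex \<Rightarrow> complex" where
  "r2 u0 u1 k = smatA u0 u1 1 2 k / smatA u0 u1 1 1 k"

definition Zset :: "(real \<Rightarrow> real) \<Rightarrow> (real \<Rightarrow> real) \<Rightarrow> complex set" where
  "Zset u0 u1 = {k \<in> D2. smat u0 u1 1 1 k = 0}"

definition wvec :: "(real \<Rightarrow> real) \<Rightarrow> (real \<Rightarrow> real) \<Rightarrow> real \<Rightarrow> complex \<Rightarrow> complex^3" where
  "wvec u0 u1 x k = (let ya = jostYA u0 u1 x k; xa = jostXA u0 u1 x k in
     vector [ya $ 2 $ 1 * xa $ 3 $ 2 - ya $ 3 $ 1 * xa $ 2 $ 2,
             ya $ 3 $ 1 * xa $ 1 $ 2 - ya $ 1 $ 1 * xa $ 3 $ 2,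
             ya $ 1 $ 1 * xa $ 2 $ 2 - ya $ 2 $ 1 * xa $ 1 $ 2])"

definition res_const :: "(real \<Rightarrow> real) \<Rightarrow> (real \<Rightarrow> real) \<Rightarrow> complex \<Rightarrow> complex" where
  "res_const u0 u1 k0 = (if k0 \<notin> \<real>
     then (THE c. \<forall>x i. wvec u0 u1 x k0 $ i / deriv (smat u0 u1 1 1) k0 =
             c * exp ((lfun 1 k0 - lfun 3 k0) * of_real x) * jostX u0 u1 x k0 $ i $ 1)
     else (THE c. \<forall>x i. jostY u0 u1 x k0 $ i $ 2 / deriv (smatA u0 u1 2 2) k0 =
             c * exp ((lfun 1 k0 - lfun 2 k0) * of_real x) * jostX u0 u1 x k0 $ i $ 1))"

subsection \<open>Assumptions on the scattering data\<close>

definition assm_solitons :: "(real \<Rightarrow> real) \<Rightarrow> (real \<Rightarrow> real) \<Rightarrow> bool" where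
  "assm_solitons u0 u1 \<longleftrightarrow>
     Zset u0 u1 \<subseteq> Dreg \<union> complex_of_real ` ({-1<..<0} \<union> {1<..}) \<and>
     finite (Zset u0 u1) \<and>
     (\<forall>k0 \<in> Zset u0 u1. zorder (smat u0 u1 1 1) k0 = 1) \<and>
     (\<forall>k \<in> (closure D2 \<union> sphere 0 1) - (Qset \<union> {0}) - Zset u0 u1. smat u0 u1 1 1 k \<noteq> 0) \<and>
     (\<forall>k0 \<in> Zset u0 u1 - \<real>. smatA u0 u1 2 2 k0 \<noteq> 0) \<and>
     (\<forall>k0 \<in> Zset u0 u1 \<inter> \<real>. \<i> * (\<omega>\<^sup>2 * k0\<^sup>2 - \<omega>) * res_const u0 u1 k0 \<in> \<real>\<^sub>\<ge>\<^sub>0)"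

definition nonzero_limit :: "(complex \<Rightarrow> complex) \<Rightarrow> complex \<Rightarrow> complex set \<Rightarrow> bool" where
  "nonzero_limit f a S \<longleftrightarrow> (\<exists>L. L \<noteq> 0 \<and> (f \<longlongrightarrow> L) (at a within S))"

definition assm_generic :: "(real \<Rightarrow> real) \<Rightarrow> (real \<Rightarrow> real) \<Rightarrow> bool" where
  "assm_generic u0 u1 \<longleftrightarrow> (\<forall>a \<in> {1, -1}.
     nonzero_limit (\<lambda>k. (k - a) * smat u0 u1 1 1 k) a (s_dom 1 1) \<and>
     nonzero_limit (\<lambda>k. (k - a) * smat u0 u1 1 3 k) a (s_dom 1 3) \<and>
     nonzero_limit (smat u0 u1 3 1) a (s_dom 3 1) \<and>
     nonzero_limit (smat u0 u1 3 3) a (s_dom 3 3) \<and>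
     nonzero_limit (\<lambda>k. (k - a) * smatA u0 u1 1 1 k) a (sA_dom 1 1) \<and>
     nonzero_limit (\<lambda>k. (k - a) * smatA u0 u1 3 1 k) a (sA_dom 3 1) \<and>
     nonzero_limit (smatA u0 u1 1 3) a (sA_dom 1 3) \<and>
     nonzero_limit (smatA u0 u1 3 3) a (sA_dom 3 3))"

(* r1 is only defined away from 0. *)
definition assm_r1 :: "(real \<Rightarrow> real) \<Rightarrow> (real \<Rightarrow> real) \<Rightarrow> bool" where
  "assm_r1 u0 u1 \<longleftrightarrow> (\<forall>k \<in> closed_segment 0 \<i> - {0}. r1 u0 u1 k = 0)"

subsection \<open>The functions delta and hat Delta\<close>

definition k1_point :: "real \<Rightarrow> complex" where
  "k1_point \<zeta> = (of_real (\<zeta> - sqrt (8 + \<zeta>\<^sup>2)) +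
     \<i> * of_real (sqrt 2 * sqrt (4 - \<zeta>\<^sup>2 + \<zeta> * sqrt (8 + \<zeta>\<^sup>2)))) / 4"

definition delta_fun :: "(real \<Rightarrow> real) \<Rightarrow> (real \<Rightarrow> real) \<Rightarrow> real \<Rightarrow> complex \<Rightarrow> complex" where
  "delta_fun u0 u1 \<zeta> k = exp (- 1 / (2 * of_real pi * \<i>) *
     contour_integral (part_circlepath 0 1 (pi / 2) (Arg (k1_point \<zeta>)))
       (\<lambda>p. Ln (1 + r1 u0 u1 p * r2 u0 u1 p) / (p - k)))"

definition Delta_hat33 :: "(real \<Rightarrow> real) \<Rightarrow> (real \<Rightarrow> real) \<Rightarrow> real \<Rightarrow> complex \<Rightarrow> complex" where
  "Delta_hat33 u0 u1 \<zeta> k = delta_fun u0 u1 \<zeta> (\<omega> * k) / delta_fun u0 u1 \<zeta> (\<omega>\<^sup>2 * k) *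
     (delta_fun u0 u1 \<zeta> (1 / (\<omega>\<^sup>2 * k)) / delta_fun u0 u1 \<zeta> (1 / (\<omega> * k)))"

definition Delta_hat11 :: "(real \<Rightarrow> real) \<Rightarrow> (real \<Rightarrow> real) \<Rightarrow> real \<Rightarrow> complex \<Rightarrow> complex" where
  "Delta_hat11 u0 u1 \<zeta> k = Delta_hat33 u0 u1 \<zeta> (\<omega> * k)"

definition Delta_hat22 :: "(real \<Rightarrow> real) \<Rightarrow> (real \<Rightarrow> real) \<Rightarrow> real \<Rightarrow> complex \<Rightarrow> complex" where
  "Delta_hat22 u0 u1 \<zeta> k = Delta_hat33 u0 u1 \<zeta> (\<omega>\<^sup>2 * k)"

subsection \<open>The Riemann-Hilbert problem\<close>

definition res_const_conj :: "(real \<Rightarrow> real) \<Rightarrow> (real \<Rightarrow> real) \<Rightarrow> complex \<Rightarrow> complex" where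
  "res_const_conj u0 u1 k0 =
     ((cnj k0)\<^sup>2 - 1) / (\<omega>\<^sup>2 * (\<omega>\<^sup>2 - (cnj k0)\<^sup>2)) * cnj (res_const u0 u1 k0)"

definition Zhat :: "(real \<Rightarrow> real) \<Rightarrow> (real \<Rightarrow> real) \<Rightarrow> complex set" where
  "Zhat u0 u1 = (\<Union>k0 \<in> Zset u0 u1. \<Union>j \<in> {0, 1, 2::nat}.
     {\<omega> ^ j * k0, \<omega> ^ j * cnj k0, \<omega> ^ j * inverse k0, \<omega> ^ j * inverse (cnj k0)})"

definition Acal :: "complex^3^3" where
  "Acal = vector [vector [0, 0, 1], vector [1, 0, 0], vector [0, 1, 0]]"

definition Bcal :: "complex^3^3" where
  "Bcal = vector [vector [0, 1, 0], vector [1, 0, 0], vector [0, 0, 1]]"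

definition col_analytic :: "(complex \<Rightarrow> complex^3^3) \<Rightarrow> 3 \<Rightarrow> complex \<Rightarrow> bool" where
  "col_analytic M j a \<longleftrightarrow> (\<forall>i. (\<lambda>k. M k $ i $ j) analytic_on {a})"

definition at_most_simple_pole :: "(complex \<Rightarrow> complex) \<Rightarrow> complex \<Rightarrow> bool" where
  "at_most_simple_pole f a \<longleftrightarrow>
     (\<exists>c g. g analytic_on {a} \<and> (\<forall>\<^sub>F k in at a. f k = c / (k - a) + g k))"

(* Column m of M has at most a simple pole at a, the other columns are analytic there, and
   Res [M]_m = c [M(a)]_n with n another column. *)
definition residue_condition :: "(complex \<Rightarrow> complex^3^3) \<Rightarrow> complex \<Rightarrow> 3 \<Rightarrow> 3 \<Rightarrow> complex \<Rightarrow> bool" where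
  "residue_condition M a m n c \<longleftrightarrow>
     (\<forall>j. j \<noteq> m \<longrightarrow> col_analytic M j a) \<and>
     (\<forall>i. at_most_simple_pole (\<lambda>k. M k $ i $ m) a \<and>
          residue (\<lambda>k. M k $ i $ m) a = c * M a $ i $ n)"

(* zeta is kept as a parameter of its own besides x and t: it enters the residue conditions through the
   hat Delta's only.  Solutions are total functions, whose singular columns have irrelevant values at
   the points of Zhat. *)
definition solves_RHP_sol ::
  "(real \<Rightarrow> real) \<Rightarrow> (real \<Rightarrow> real) \<Rightarrow> real \<Rightarrow> real \<Rightarrow> real \<Rightarrow> (complex \<Rightarrow> complex^3^3) \<Rightarrow> bool" where
  "solves_RHP_sol u0 u1 \<zeta> x t M \<longleftrightarrow>
     (\<forall>i j. (\<lambda>k. M k $ i $ j) analytic_on (- Zhat u0 u1)) \<and>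
     (\<forall>k \<in> - Zhat u0 u1. M k = Acal ** M (\<omega> * k) ** matrix_inv Acal) \<and>
     (\<forall>k \<in> - Zhat u0 u1 - {0}. M k = Bcal ** M (inverse k) ** Bcal) \<and>
     (\<forall>i j. (\<lambda>k. M k $ i $ j - (Finite_Cartesian_Product.mat 1 :: complex^3^3) $ i $ j)
              \<in> O[at_infinity](\<lambda>k. inverse k)) \<and>
     (\<forall>k0 \<in> Zset u0 u1 - \<real>.
        residue_condition M k0 3 1
          (res_const u0 u1 k0 * exp (- theta_phase 3 1 x t k0) /
             (Delta_hat11 u0 u1 \<zeta> k0 * inverse (Delta_hat33 u0 u1 \<zeta> k0))) \<and>
        residue_condition M (cnj k0) 2 3
          (res_const_conj u0 u1 k0 * exp (theta_phase 3 2 x t (cnj k0)) /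
             (Delta_hat33 u0 u1 \<zeta> (cnj k0) * inverse (Delta_hat22 u0 u1 \<zeta> (cnj k0))))) \<and>
     (\<forall>k0 \<in> Zset u0 u1 \<inter> \<real>.
        residue_condition M k0 2 1
          (res_const u0 u1 k0 * exp (- theta_phase 2 1 x t k0) /
             (Delta_hat11 u0 u1 \<zeta> k0 * inverse (Delta_hat22 u0 u1 \<zeta> k0))))"

(* Msol \<zeta> x t k; the x-derivative is taken at fixed \<zeta> = x/t, i.e. like the derivatives in u_s it
   does not act on the hat Delta's. *)
definition u_sol :: "(real \<Rightarrow> real \<Rightarrow> real \<Rightarrow> complex \<Rightarrow> complex^3^3) \<Rightarrow> real \<Rightarrow> real \<Rightarrow> complex" where
  "u_sol Msol x t = - \<i> * of_real (sqrt 3) *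
     vector_derivative
       (\<lambda>y. Lim at_infinity (\<lambda>k. k * ((vector [1, 1, 1] v* Msol (x / t) y t k) $ 3 - 1))) (at x)"

subsection \<open>The multi-soliton function\<close>

definition ctilde_breather :: "complex \<times> complex \<Rightarrow> complex" where
  "ctilde_breather = (\<lambda>(a, c). \<i> * (a\<^sup>2 - 1) / (2 * of_real (sqrt 3) * a\<^sup>2) * c)"

definition ctilde_soliton :: "complex \<times> complex \<Rightarrow> complex" where
  "ctilde_soliton = (\<lambda>(a, c). \<i> * (a\<^sup>2 - \<omega>\<^sup>2) / (2 * of_real (sqrt 3) * a\<^sup>2) * \<omega>\<^sup>2 * c)"

(* The list of tuples (L, Z, L', Z', C), in the order a = 1, ..., 2 n_b + n_s. *)
definition soliton_data ::
  "(complex \<times> complex) list \<Rightarrow> (complex \<times> complex) list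
     \<Rightarrow> (complex \<times> complex \<times> complex \<times> complex \<times> complex) list" where
  "soliton_data lams mus =
     map (\<lambda>p. let a = fst p in (lfun 1 a, zfun 1 a, lfun 3 a, zfun 3 a, ctilde_breather p)) lams @
     map (\<lambda>p. let a = cnj (fst p) in (lfun 3 a, zfun 3 a, lfun 2 a, zfun 2 a, cnj (ctilde_breather p))) lams @
     map (\<lambda>p. let a = fst p in (lfun 1 a, zfun 1 a, lfun 2 a, zfun 2 a, ctilde_soliton p)) mus"

definition soliton_matrix ::
  "(complex \<times> complex) list \<Rightarrow> (complex \<times> complex) list \<Rightarrow> real \<Rightarrow> real \<Rightarrow> complex Matrix.mat" where
  "soliton_matrix lams mus x t = (let d = soliton_data lams mus; n = length d in
     Matrix.mat n n (\<lambda>(a, b).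
       case (d ! a, d ! b) of ((La, Za, _, _, _), (_, _, Lb', Zb', Cb)) \<Rightarrow>
         Cb * exp (of_real x * (La - Lb') + of_real t * (Za - Zb')) / (La - Lb')))"

definition log_det :: "(complex \<times> complex) list \<Rightarrow> (complex \<times> complex) list \<Rightarrow> real \<Rightarrow> real \<Rightarrow> complex" where
  "log_det lams mus x t = (let B = soliton_matrix lams mus x t in
     Ln (Determinant.det (1\<^sub>m (dim_row B) - B)))"

definition u_s :: "real \<Rightarrow> real \<Rightarrow> (complex \<times> complex) list \<Rightarrow> (complex \<times> complex) list \<Rightarrow> complex" where
  "u_s x t lams mus = 6 *
     vector_derivative (\<lambda>y. vector_derivative (\<lambda>y'. log_det lams mus y' t) (at y)) (at x)"

end

theory Submission
  imports Defs "HOL-Probability.Sinc_Integral"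
begin

text \<open>
  Write \<open>n = (1,1,1) M\<close> for the row of column sums of a solution.  The \<open>Acal\<close>-symmetry gives
  \<open>n\<^sub>1(k) = f(\<omega> k)\<close> and \<open>n\<^sub>2(k) = f(\<omega>\<^sup>2 k)\<close> with \<open>f = n\<^sub>3\<close>, and the \<open>Bcal\<close>-symmetry gives \<open>f(k) = f(1/k)\<close>.
  So \<open>f\<close> is a function of \<open>l\<^sub>3(k)\<close>, which is a coordinate on the quotient by inversion, and \<open>n\<^sub>j\<close> is
  the same function of \<open>l\<^sub>j(k)\<close>.  It equals 1 at infinity, and by the residue conditions its only
  singularities in the \<open>l\<close>-plane are simple poles at the numbers \<open>L'\<^sub>b\<close>, with residue \<open>R\<^sub>b\<close> times its own
  value \<open>v\<^sub>b\<close> at \<open>L\<^sub>b\<close>, where \<open>R\<^sub>b = C\<^sub>b exp(x (L\<^sub>b - L'\<^sub>b) + t (Z\<^sub>b - Z'\<^sub>b))\<close>.  Liouville's theorem turns this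
  into the linear system \<open>v\<^sub>a = 1 + \<Sum>\<^sub>b R\<^sub>b v\<^sub>b / (L\<^sub>a - L'\<^sub>b)\<close> (\<open>row_sum_system\<close>), and the limit in the definition
  of \<open>u_sol\<close> is a constant times \<open>\<Sum>\<^sub>b R\<^sub>b v\<^sub>b\<close>.

  Rescaling \<open>v\<^sub>a\<close> by \<open>e\<^sub>a = exp(x L\<^sub>a + t Z\<^sub>a)\<close> turns the system into \<open>(I - B) \<psi> = e\<close>, and the \<open>x\<close>-derivative
  of \<open>B\<close> is the rank one matrix \<open>e w\<^sup>T\<close> with \<open>w\<^sub>b = C\<^sub>b exp(- x L'\<^sub>b - t Z'\<^sub>b)\<close>.  Jacobi's formula and Cramer's rule give
  \<open>det(I - B)' = - det(I - B) \<Sum>\<^sub>b R\<^sub>b v\<^sub>b\<close> (\<open>tau_log_derivative\<close>).  A second derivative yields the claim.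

  Two facts are not algebra.  The formula for \<open>u_s\<close> uses the principal logarithm, so \<open>det(I - B)\<close>
  must stay off the negative real axis; in fact it is positive (\<open>det_C_pos\<close>).  Complex conjugation
  exchanges the two halves of the data of a breather and fixes the data of a soliton, which makes the
  determinant real; a kernel vector of \<open>I - B\<close> would contradict the definiteness of two Gram matrices
  of exponentials; and scaling the constants \<open>C\<close> down to 0 deforms the determinant to 1.

  This conjugation symmetry survives the division by the functions \<open>Delta_hat\<close> only if these are
  compatible with conjugation (\<open>Delta_ratio_cnj\<close>, \<open>Delta_ratio_pos\<close>).  They are, because the density
  \<open>ln(1 + r\<^sub>1 r\<^sub>2)\<close> in \<open>\<delta>\<close> is real on the arc (\<open>reflection_product_nonneg\<close>).  That is a unitarity relation
  for the scattering matrix.  On the unit circle the \<open>l\<^sub>j\<close> are imaginary, and the Lax equation preserves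
  an \<open>x\<close>-dependent Hermitian form; this form maps the Jost solution \<open>X\<close> to its dual \<open>X\<^sup>A\<close>, so \<open>s\<^sup>A\<close> is
  the complex conjugate of \<open>s\<close> up to a diagonal conjugation (\<open>smatA_eq\<close>).  It needs existence and uniqueness for
  the Volterra equations, because the Jost solutions are defined by unique description.
\<close>

section \<open>Volterra equations on a half line\<close>

lemma set_integrable_lborel_subset:
  fixes F :: "real \<Rightarrow> 'a::{banach,second_countable_topology}"
  assumes "set_integrable lborel A F" "B \<subseteq> A" "B \<in> sets borel"
  shows "set_integrable lborel B F"
  using assms by (intro set_integrable_subset[of lborel A F B]) auto

lemma tail_integral_greaterThan:
  fixes F :: "real \<Rightarrow> 'a::euclidean_space"
  assumes "set_integrable lborel {x..} F"
  shows "(LBINT y:{x<..}. F y) = (LBINT y:{x..}. F y)"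
proof (rule set_integral_cong_set)
  have "set_integrable lborel {x<..} F" by (rule set_integrable_lborel_subset[OF assms]) auto
  then show "set_borel_measurable lborel {x<..} F" "set_borel_measurable lborel {x..} F"
    using assms by (auto simp: set_integrable_def set_borel_measurable_def)
  have "AE y in lborel. y \<noteq> x" by (rule AE_lborel_singleton)
  then show "AE y in lborel. (y \<in> {x..}) = (y \<in> {x<..})" by eventually_elim auto
qed

lemma tail_integral_split:
  fixes F :: "real \<Rightarrow> 'a::euclidean_space"
  assumes "set_integrable lborel {a..} F" "a \<le> x"
  shows "(LBINT y:{x..}. F y) = (LBINT y:{a..}. F y) - integral {a..x} F"
proof -
  have 1: "set_integrable lborel {a..x} F" "set_integrable lborel {x<..} F" "set_integrable lborel {x..} F"
    using assms by (auto intro!: set_integrable_lborel_subset[OF assms(1)])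
  have "{a..} = {a..x} \<union> {x<..}" using assms by auto
  then have "(LBINT y:{a..}. F y) = (LBINT y:{a..x}. F y) + (LBINT y:{x<..}. F y)"
    using set_integral_Un[OF _ 1(1,2)] by (simp add: set_integral_Un[OF _ 1(1,2)] disjoint_iff)
  moreover have "(LBINT y:{x<..}. F y) = (LBINT y:{x..}. F y)"
    by (rule tail_integral_greaterThan[OF 1(3)])
  moreover have "(LBINT y:{a..x}. F y) = integral {a..x} F"
    by (rule set_borel_integral_eq_integral(2)[OF 1(1)])
  ultimately show ?thesis by (simp add: algebra_simps)
qed

lemma continuous_on_tail_integral:
  fixes F :: "real \<Rightarrow> 'a::euclidean_space"
  assumes "\<And>a. set_integrable lborel {a..} F"
  shows "continuous_on UNIV (\<lambda>x. LBINT y:{x..}. F y)"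
proof -
  have "continuous (at x) (\<lambda>x. LBINT y:{x..}. F y)" for x
  proof -
    have "F integrable_on {x-1..x+1}"
      by (rule set_borel_integral_eq_integral(1), rule set_integrable_lborel_subset[OF assms[of "x-1"]]) auto
    then have "continuous_on {x-1..x+1} (\<lambda>z. (LBINT y:{x-1..}. F y) - integral {x-1..z} F)"
      by (intro continuous_intros indefinite_integral_continuous_1)
    then have "continuous_on {x-1..x+1} (\<lambda>z. LBINT y:{z..}. F y)"
      by (rule continuous_on_eq) (rule tail_integral_split[OF assms, symmetric], simp)
    then have "continuous_on {x-1<..<x+1} (\<lambda>z. LBINT y:{z..}. F y)"
      by (rule continuous_on_subset) auto
    then show ?thesis by (subst (asm) continuous_on_eq_continuous_at) auto
  qed
  then show ?thesis by (simp add: continuous_at_imp_continuous_on)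
qed

lemma has_vector_derivative_tail_integral:
  fixes F :: "real \<Rightarrow> 'a::euclidean_space"
  assumes "\<And>a. set_integrable lborel {a..} F" "continuous_on UNIV F"
  shows "((\<lambda>x. LBINT y:{x..}. F y) has_vector_derivative - F x) (at x)"
proof -
  have "((\<lambda>z. integral {x-1..z} F) has_vector_derivative F x) (at x within {x-1..x+1})"
    by (rule integral_has_vector_derivative) (auto intro: continuous_on_subset[OF assms(2)])
  then have "((\<lambda>z. integral {x-1..z} F) has_vector_derivative F x) (at x within {x-1<..<x+1})"
    by (rule has_vector_derivative_within_subset) auto
  then have "((\<lambda>z. integral {x-1..z} F) has_vector_derivative F x) (at x)"
    by (subst (asm) has_vector_derivative_within_open) auto
  then have "((\<lambda>z. (LBINT y:{x-1..}. F y) - integral {x-1..z} F) has_vector_derivative - F x) (at x)"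
    by (auto intro!: derivative_eq_intros)
  then show ?thesis
    by (rule has_vector_derivative_transform_within_open[of _ _ _ "{x-1<..<x+1}"])
       (auto intro!: tail_integral_split[OF assms(1), symmetric])
qed

lemma tail_integral_tendsto_0:
  fixes F :: "real \<Rightarrow> 'a::euclidean_space"
  assumes "\<And>a. set_integrable lborel {a..} F"
  shows "((\<lambda>x. LBINT y:{x..}. F y) \<longlongrightarrow> 0) at_top"
proof -
  have "((\<lambda>x. LBINT y:{0..x}. F y) \<longlongrightarrow> (LBINT y:{0..}. F y)) at_top"
    by (rule tendsto_set_lebesgue_integral_at_top) (use assms in auto)
  then have "((\<lambda>x. (LBINT y:{0..}. F y) - (LBINT y:{0..x}. F y)) \<longlongrightarrow> (LBINT y:{0..}. F y) - (LBINT y:{0..}. F y)) at_top"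
    by (intro tendsto_intros)
  moreover have "\<forall>\<^sub>F x in at_top. (LBINT y:{0..}. F y) - (LBINT y:{0..x}. F y) = (LBINT y:{x..}. F y)"
    using eventually_ge_at_top[of 0]
  proof eventually_elim
    case (elim x)
    have "set_integrable lborel {0..x} F"
      by (rule set_integrable_lborel_subset[OF assms[of 0]]) auto
    then show ?case using tail_integral_split[OF assms[of 0] elim] set_borel_integral_eq_integral(2) by metis
  qed
  ultimately show ?thesis by (simp add: filterlim_cong)
qed

lemma tail_integral_FTC:
  fixes c :: "real \<Rightarrow> 'a::euclidean_space"
  assumes der: "\<And>x. (c has_vector_derivative c' x) (at x)" and cont: "continuous_on UNIV c'"
    and int: "\<And>a. set_integrable lborel {a..} c'" and lim: "(c \<longlongrightarrow> L) at_top"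
  shows "(LBINT y:{x..}. c' y) = L - c x"
proof -
  let ?D = "\<lambda>x. c x + (LBINT y:{x..}. c' y)"
  have "(?D has_vector_derivative 0) (at x within UNIV)" for x
    using has_vector_derivative_add[OF der has_vector_derivative_tail_integral[OF int cont], of x] by simp
  then have D: "?D x = ?D y" for x y
    using has_vector_derivative_zero_constant[of UNIV ?D] by (metis UNIV_I convex_UNIV)
  have "(?D \<longlongrightarrow> L + 0) at_top"
    by (intro tendsto_intros lim tail_integral_tendsto_0 int)
  moreover have "?D = (\<lambda>y. ?D x)" using D by auto
  ultimately have "((\<lambda>y::real. ?D x) \<longlongrightarrow> L + 0) at_top" by simp
  then have "?D x = L" by (simp add: tendsto_const_iff)
  then show ?thesis by (simp add: algebra_simps)
qed

text \<open>
  The equation is \<open>b(x) = e - \<integral>\<^sub>x\<^sup>\<infinity> A(y) b(y) dy\<close>, that is \<open>b' = A b\<close> with value \<open>e\<close> at infinity.  A scalar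
  majorant \<open>m\<close> of the coefficient is enough for all estimates; \<open>cont\<close> says that \<open>A\<close> is strongly continuous.
\<close>
locale linear_volterra =
  fixes A :: "real \<Rightarrow> 'a \<Rightarrow> 'a::euclidean_space" and m :: "real \<Rightarrow> real"
  assumes lin: "linear (A y)"
    and bound: "norm (A y v) \<le> m y * norm v"
    and m_cont: "continuous_on UNIV m" and m_nonneg: "0 \<le> m y" and m_int: "integrable lborel m"
    and cont: "continuous_on UNIV b \<Longrightarrow> continuous_on UNIV (\<lambda>y. A y (b y))"
begin

definition sol :: "'a \<Rightarrow> (real \<Rightarrow> 'a) \<Rightarrow> bool" where
  "sol e b \<longleftrightarrow> (\<forall>x. set_integrable lborel {x..} (\<lambda>y. A y (b y)) \<and> b x = e - (LBINT y:{x..}. A y (b y)))"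

lemma solD:
  assumes "sol e b"
  shows "set_integrable lborel {x..} (\<lambda>y. A y (b y))" "b x = e - (LBINT y:{x..}. A y (b y))"
  using assms unfolding sol_def by blast+

lemma sol_eq:
  assumes "sol e b"
  shows "(\<lambda>x. e - (LBINT y:{x..}. A y (b y))) = b"
  by (rule ext) (rule solD(2)[OF assms, symmetric])

lemma sol_continuous:
  assumes "sol e b" shows "continuous_on UNIV b"
proof -
  have "continuous_on UNIV (\<lambda>x. e - (LBINT y:{x..}. A y (b y)))"
    by (intro continuous_intros continuous_on_tail_integral solD(1)[OF assms])
  then show ?thesis unfolding sol_eq[OF assms] .
qed

lemma sol_has_derivative:
  assumes "sol e b" shows "(b has_vector_derivative A x (b x)) (at x)"
proof -
  have "((\<lambda>x. e - (LBINT y:{x..}. A y (b y))) has_vector_derivative 0 - (- A x (b x))) (at x)"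
    by (rule has_vector_derivative_diff[OF has_vector_derivative_const
        has_vector_derivative_tail_integral[OF solD(1)[OF assms] cont[OF sol_continuous[OF assms]]]])
  then show ?thesis unfolding sol_eq[OF assms] by simp
qed

lemma sol_tendsto:
  assumes "sol e b" shows "(b \<longlongrightarrow> e) at_top"
proof -
  have "((\<lambda>x. e - (LBINT y:{x..}. A y (b y))) \<longlongrightarrow> e - 0) at_top"
    by (intro tendsto_intros tail_integral_tendsto_0 solD(1)[OF assms])
  then show ?thesis unfolding sol_eq[OF assms] by simp
qed

lemma m_tail: "set_integrable lborel {x..} m"
  unfolding set_integrable_def by (rule integrable_mult_indicator[OF _ m_int]) simp

lemma integrable_bounded:
  assumes "continuous_on UNIV b" "\<And>y. norm (b y) \<le> C"
  shows "integrable lborel (\<lambda>y. A y (b y))"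
proof (rule Bochner_Integration.integrable_bound)
  show "integrable lborel (\<lambda>y. m y * C)" using m_int by simp
  show "(\<lambda>y. A y (b y)) \<in> borel_measurable lborel"
    using borel_measurable_continuous_onI[OF cont[OF assms(1)]] by simp
  have "norm (A y (b y)) \<le> norm (m y * C)" for y
  proof -
    have "norm (A y (b y)) \<le> m y * norm (b y)" by (rule bound)
    also have "\<dots> \<le> m y * C" using assms(2) m_nonneg by (intro mult_left_mono)
    finally show ?thesis by simp
  qed
  then show "AE y in lborel. norm (A y (b y)) \<le> norm (m y * C)" by auto
qed

lemma set_integrable_bounded:
  assumes "continuous_on UNIV b" "\<And>y. norm (b y) \<le> C"
  shows "set_integrable lborel {x..} (\<lambda>y. A y (b y))"
  unfolding set_integrable_def by (rule integrable_mult_indicator[OF _ integrable_bounded[OF assms]]) simp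

text \<open>
  Passing from the differential equation back to the integral equation, which is how the dual solution
  is recognised as a Jost solution.
\<close>
lemma solI_derivative:
  assumes der: "\<And>x. (b has_vector_derivative A x (b x)) (at x)"
    and bdd: "\<And>y. norm (b y) \<le> C" and lim: "(b \<longlongrightarrow> e) at_top"
  shows "sol e b"
proof -
  have c: "continuous_on UNIV b"
    using der by (meson continuous_at_imp_continuous_on has_vector_derivative_continuous)
  show ?thesis unfolding sol_def
    using set_integrable_bounded[OF c bdd] tail_integral_FTC[OF der cont[OF c] set_integrable_bounded[OF c bdd] lim]
    by simp
qed

text \<open>
  The tail mass of the majorant.  In the weighted norm \<open>sup norm(d(y)) exp(-2 G(y))\<close> the Volterra operator
  is a contraction with constant 1/2 on the whole line, no matter how large the coefficient is.
\<close>
definition G :: "real \<Rightarrow> real" where "G x = (LBINT y:{x..}. m y)"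

lemma G_nonneg: "0 \<le> G x"
  unfolding G_def set_lebesgue_integral_def using m_nonneg by (auto intro!: Bochner_Integration.integral_nonneg)

lemma G_le: "G x \<le> integral\<^sup>L lborel m"
  unfolding G_def set_lebesgue_integral_def
  by (rule integral_mono) (use m_tail m_int m_nonneg in \<open>auto simp: set_integrable_def indicator_def\<close>)

lemma G_deriv: "(G has_vector_derivative - m x) (at x)"
  using has_vector_derivative_tail_integral[OF m_tail m_cont] unfolding G_def by simp

lemma G_cont: "continuous_on UNIV G"
  using G_deriv by (meson continuous_at_imp_continuous_on has_vector_derivative_continuous)

lemma weight_integrable: "set_integrable lborel {x..} (\<lambda>y. m y * exp (2 * G y))"
  unfolding set_integrable_def
proof (rule Bochner_Integration.integrable_bound)
  show "integrable lborel (\<lambda>y. m y * exp (2 * integral\<^sup>L lborel m))" using m_int by simp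
  have "continuous_on UNIV (\<lambda>y. m y * exp (2 * G y))" by (intro continuous_intros m_cont G_cont)
  then have "(\<lambda>y. m y * exp (2 * G y)) \<in> borel_measurable borel" by (rule borel_measurable_continuous_onI)
  then show "(\<lambda>y. indicator {x..} y *\<^sub>R (m y * exp (2 * G y))) \<in> borel_measurable lborel" by simp
  have "m y * exp (2 * G y) \<le> m y * exp (2 * integral\<^sup>L lborel m)" for y
    using m_nonneg G_le by (intro mult_left_mono) auto
  then show "AE y in lborel. norm (indicator {x..} y *\<^sub>R (m y * exp (2 * G y))) \<le> norm (m y * exp (2 * integral\<^sup>L lborel m))"
    using m_nonneg by (auto simp: indicator_def abs_mult)
qed

lemma weight_integral: "(LBINT y:{x..}. m y * exp (2 * G y)) = (exp (2 * G x) - 1) / 2"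
proof -
  have "(LBINT y:{x..}. m y * exp (2 * G y)) = (- 1 / 2) - (- exp (2 * G x) / 2)"
  proof (rule tail_integral_FTC)
    show "((\<lambda>x. - exp (2 * G x) / 2) has_vector_derivative m x * exp (2 * G x)) (at x)" for x
      using G_deriv[of x] unfolding has_real_derivative_iff_has_vector_derivative[symmetric]
      by (auto intro!: derivative_eq_intros)
    show "continuous_on UNIV (\<lambda>y. m y * exp (2 * G y))" by (intro continuous_intros m_cont G_cont)
    show "set_integrable lborel {a..} (\<lambda>y. m y * exp (2 * G y))" for a by (rule weight_integrable)
    have "(G \<longlongrightarrow> 0) at_top" unfolding G_def by (rule tail_integral_tendsto_0[OF m_tail])
    then have "((\<lambda>x. - exp (2 * G x) / 2) \<longlongrightarrow> - exp (2 * 0) / 2) at_top"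
      by (intro tendsto_intros) auto
    then show "((\<lambda>x. - exp (2 * G x) / 2) \<longlongrightarrow> - 1 / 2) at_top" by simp
  qed
  then show ?thesis by (simp add: field_simps)
qed

text \<open>
  The contraction estimate: since \<open>(exp(2 G))' = - 2 m exp(2 G)\<close>, integrating the weight against \<open>m\<close>
  reproduces it with a factor 1/2.
\<close>
lemma weighted_bound:
  assumes "set_integrable lborel {x..} (\<lambda>y. A y (d y))"
    and "\<And>y. y \<ge> x \<Longrightarrow> norm (d y) \<le> D * exp (2 * G y)" and "D \<ge> 0"
  shows "norm (LBINT y:{x..}. A y (d y)) \<le> D / 2 * exp (2 * G x)"
proof -
  have i: "set_integrable lborel {x..} (\<lambda>y. D * (m y * exp (2 * G y)))"
    using weight_integrable by auto
  have "norm (LBINT y:{x..}. A y (d y)) \<le> (LBINT y:{x..}. norm (A y (d y)))"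
    by (rule set_integral_norm_bound[OF assms(1)])
  also have "\<dots> \<le> (LBINT y:{x..}. D * (m y * exp (2 * G y)))"
  proof (rule set_integral_mono)
    show "set_integrable lborel {x..} (\<lambda>y. norm (A y (d y)))" by (rule set_integrable_norm[OF assms(1)])
    show "norm (A y (d y)) \<le> D * (m y * exp (2 * G y))" if "y \<in> {x..}" for y
    proof -
      have "norm (A y (d y)) \<le> m y * norm (d y)" by (rule bound)
      also have "\<dots> \<le> m y * (D * exp (2 * G y))" using assms(2) that m_nonneg by (intro mult_left_mono) auto
      finally show ?thesis by (simp add: mult_ac)
    qed
  qed (rule i)
  also have "\<dots> = D * ((exp (2 * G x) - 1) / 2)" by (simp add: weight_integral)
  also have "\<dots> \<le> D / 2 * exp (2 * G x)" using assms(3) by (simp add: field_simps)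
  finally show ?thesis .
qed

text \<open>
  A solution need not be bounded a priori, but its integrability makes the difference of two solutions
  bounded on each half line \<open>[a, \<infinity>)\<close>, and there the contraction estimate applies.
\<close>
lemma sol_unique:
  assumes "sol e b" "sol e c" shows "b = c"
proof
  fix a
  define d where "d y = b y - c y" for y
  have Ad: "A y (d y) = A y (b y) - A y (c y)" for y unfolding d_def by (simp add: linear_diff[OF lin])
  have di: "set_integrable lborel {x..} (\<lambda>y. A y (d y))" for x
    unfolding Ad by (intro set_integral_diff solD[OF assms(1)] solD[OF assms(2)])
  have d: "d x = - (LBINT y:{x..}. A y (d y))" for x
  proof -
    have "(LBINT y:{x..}. A y (d y)) = (LBINT y:{x..}. A y (b y)) - (LBINT y:{x..}. A y (c y))"
      unfolding Ad by (intro set_integral_diff solD[OF assms(1)] solD[OF assms(2)])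
    then show ?thesis using solD(2)[OF assms(1), of x] solD(2)[OF assms(2), of x] by (simp add: d_def)
  qed
  \<comment> \<open>the weighted norms of the difference on \<open>[a, \<infinity>)\<close>; their supremum will turn out to be at most half of itself\<close>
  define S where "S = (\<lambda>x. norm (d x) * exp (- 2 * G x)) ` {a..}"
  have bdd: "bdd_above S" unfolding S_def
  proof (rule bdd_aboveI2)
    fix x assume x: "x \<in> {a..}"
    have "norm (d x) \<le> (LBINT y:{x..}. norm (A y (d y)))"
      using d[of x] set_integral_norm_bound[OF di[of x]] by simp
    also have "\<dots> \<le> (LBINT y:{a..}. norm (A y (d y)))"
      unfolding set_lebesgue_integral_def
      by (rule integral_mono)
         (use x set_integrable_norm[OF di[of a]] set_integrable_norm[OF di[of x]] in
           \<open>auto simp: set_integrable_def indicator_def\<close>)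
    finally have "norm (d x) \<le> (LBINT y:{a..}. norm (A y (d y)))" .
    moreover have "exp (- 2 * G x) \<le> 1" using G_nonneg by simp
    ultimately show "norm (d x) * exp (- 2 * G x) \<le> (LBINT y:{a..}. norm (A y (d y)))"
      using mult_left_le[of "exp (- 2 * G x)" "norm (d x)"] by simp
  qed
  have ne: "S \<noteq> {}" unfolding S_def by auto
  define D where "D = Sup S"
  have D: "norm (d y) \<le> D * exp (2 * G y)" if "y \<ge> a" for y
  proof -
    have "norm (d y) * exp (- 2 * G y) \<le> D" unfolding D_def
      by (rule cSup_upper[OF _ bdd]) (use that in \<open>auto simp: S_def\<close>)
    then show ?thesis by (simp add: exp_minus field_simps)
  qed
  have "0 \<le> D * exp (2 * G a)" using order_trans[OF norm_ge_zero D[of a]] by simp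
  then have D0: "D \<ge> 0" by (simp add: zero_le_mult_iff)
  have "D \<le> D / 2" unfolding D_def
  proof (rule cSup_least[OF ne], fold D_def)
    fix s assume "s \<in> S"
    then obtain x where x: "x \<ge> a" "s = norm (d x) * exp (- 2 * G x)" unfolding S_def by auto
    have "norm (d x) \<le> D / 2 * exp (2 * G x)"
      using weighted_bound[OF di D D0, of x] d[of x] x by simp
    then have "norm (d x) * exp (- 2 * G x) \<le> D / 2 * exp (2 * G x) * exp (- 2 * G x)"
      by (intro mult_right_mono) auto
    also have "\<dots> = D / 2" by (simp add: exp_minus)
    finally show "s \<le> D / 2" unfolding x(2) .
  qed
  then have "D = 0" using D0 by simp
  then show "b a = c a" using D[of a] by (simp add: d_def)
qed

text \<open>
  Banach's fixed point theorem for bounded continuous functions, after the substitution \<open>b = exp(2 G) g\<close>.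
  The bound on the whole line is what makes the scattering integrals converge.
\<close>
lemma sol_exists: "\<exists>b C. sol e b \<and> (\<forall>x. norm (b x) \<le> C)"
proof -
  define W where "W = integral\<^sup>L lborel m"
  define lift where "lift g y = exp (2 * G y) *\<^sub>R apply_bcontfun g y" for g :: "real \<Rightarrow>\<^sub>C 'a" and y
  have lc: "continuous_on UNIV (lift g)" for g unfolding lift_def by (intro continuous_intros G_cont continuous_on_apply_bcontfun)
  have lb1: "norm (lift g y) \<le> norm g * exp (2 * G y)" for g y unfolding lift_def
    using norm_bounded[of g y] by (simp add: mult.commute mult_left_mono)
  have lb: "norm (lift g y) \<le> norm g * exp (2 * W)" for g y
  proof -
    have "norm g * exp (2 * G y) \<le> norm g * exp (2 * W)"
      using G_le[of y] unfolding W_def by (intro mult_left_mono) auto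
    then show ?thesis using lb1[of g y] by simp
  qed
  have li: "set_integrable lborel {x..} (\<lambda>y. A y (lift g y))" for g x
    by (rule set_integrable_bounded[OF lc lb])
  define T where "T g x = exp (- 2 * G x) *\<^sub>R (e - (LBINT y:{x..}. A y (lift g y)))" for g x
  have Tc: "continuous_on UNIV (T g)" for g
    unfolding T_def by (intro continuous_intros G_cont continuous_on_tail_integral li)
  have Tb: "norm (T g x) \<le> norm e + norm g / 2" for g x
  proof -
    have "norm (e - (LBINT y:{x..}. A y (lift g y))) \<le> norm e + norm g / 2 * exp (2 * G x)"
      by (rule order_trans[OF norm_triangle_ineq4 add_left_mono[OF weighted_bound[OF li lb1 norm_ge_zero]]])
    then have "norm (T g x) \<le> exp (- 2 * G x) * (norm e + norm g / 2 * exp (2 * G x))"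
      unfolding T_def by simp
    also have "\<dots> = exp (- 2 * G x) * norm e + norm g / 2"
      by (simp add: distrib_left exp_minus field_simps)
    also have "\<dots> \<le> norm e + norm g / 2" using G_nonneg[of x] by (simp add: mult_left_le_one_le)
    finally show ?thesis .
  qed
  have Tbc: "T g \<in> bcontfun" for g
    using Tc Tb by (intro bcontfun_normI)
  define TT where "TT g = Bcontfun (T g)" for g
  have TTa: "apply_bcontfun (TT g) = T g" for g unfolding TT_def by (simp add: Bcontfun_inverse Tbc)
  have "\<exists>!g. TT g = g"
  proof (rule banach_fix_type[of "1/2"])
    show "\<forall>x y. dist (TT x) (TT y) \<le> 1 / 2 * dist x y"
    proof safe
      fix g h
      show "dist (TT g) (TT h) \<le> 1 / 2 * dist g h"
      proof (rule dist_bound)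
        fix x
        have Ad: "A y (lift (h - g) y) = A y (lift h y) - A y (lift g y)" for y
          unfolding lift_def by (simp add: scaleR_diff_right linear_diff[OF lin])
        have "(LBINT y:{x..}. A y (lift (h - g) y)) = (LBINT y:{x..}. A y (lift h y)) - (LBINT y:{x..}. A y (lift g y))"
          unfolding Ad by (intro set_integral_diff li)
        then have "T g x - T h x = exp (- 2 * G x) *\<^sub>R (LBINT y:{x..}. A y (lift (h - g) y))"
          unfolding T_def by (simp add: scaleR_diff_right[symmetric])
        then have "norm (T g x - T h x) \<le> exp (- 2 * G x) * (norm (h - g) / 2 * exp (2 * G x))"
          using weighted_bound[OF li lb1 norm_ge_zero, of x "h - g"] by simp
        also have "\<dots> = 1 / 2 * dist g h" by (simp add: exp_minus field_simps dist_norm norm_minus_commute)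
        finally show "dist (apply_bcontfun (TT g) x) (apply_bcontfun (TT h) x) \<le> 1 / 2 * dist g h"
          by (simp add: TTa dist_norm)
      qed
    qed
  qed auto
  then obtain g where g: "TT g = g" by auto
  have "lift g x = e - (LBINT y:{x..}. A y (lift g y))" for x
  proof -
    have "apply_bcontfun g x = T g x" using g TTa by metis
    then show ?thesis unfolding lift_def[of g x] T_def by (simp add: exp_minus)
  qed
  then have "sol e (lift g)" unfolding sol_def using li by blast
  then show ?thesis using lb by blast
qed

end

section \<open>Duality of the Lax equation with imaginary spectrum\<close>

lemma integral_tendsto_at_bot:
  fixes F :: "real \<Rightarrow> 'a::euclidean_space"
  assumes "integrable lborel F"
  shows "((\<lambda>x. LBINT y:{x..}. F y) \<longlongrightarrow> (LBINT y. F y)) at_bot"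
  unfolding filterlim_at_bot_mirror set_lebesgue_integral_def
proof (rule integral_dominated_convergence_at_top)
  show "integrable lborel (\<lambda>y. norm (F y))" using assms by simp
  show "AE y in lborel. ((\<lambda>z. indicator {- z..} y *\<^sub>R F y) \<longlongrightarrow> F y) at_top"
  proof (rule AE_I2)
    fix y :: real
    have "\<forall>\<^sub>F z in at_top. indicator {- z..} y *\<^sub>R F y = F y"
      using eventually_ge_at_top[of "-y"] by eventually_elim auto
    then show "((\<lambda>z. indicator {- z..} y *\<^sub>R F y) \<longlongrightarrow> F y) at_top"
      by (rule tendsto_eventually)
  qed
  show "\<forall>\<^sub>F z in at_top. AE y in lborel. norm (indicator {- z..} y *\<^sub>R F y) \<le> norm (F y)"
    by (auto simp: indicator_def)
qed (use assms in auto)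

lemma norm_vec_le_sum: "norm (v :: complex^'n) \<le> (\<Sum>i\<in>UNIV. norm (v $ i))"
  unfolding norm_vec_def by (rule L2_set_le_sum) simp

lemma integrable_vec_iff:
  fixes F :: "'b \<Rightarrow> complex^'n"
  shows "integrable M F \<longleftrightarrow> (\<forall>i. integrable M (\<lambda>y. F y $ i))"
proof
  assume "integrable M F"
  then show "\<forall>i. integrable M (\<lambda>y. F y $ i)"
    by (intro allI integrable_bounded_linear[OF bounded_linear_vec_nth])
next
  assume *: "\<forall>i. integrable M (\<lambda>y. F y $ i)"
  have bl: "bounded_linear (axis i :: complex \<Rightarrow> complex^'n)" for i
  proof (rule bounded_linear_intro[where K=1])
    fix c :: complex
    show "norm (axis i c :: complex^'n) \<le> norm c * 1"
      using norm_vec_le_sum[of "axis i c"] by (simp add: axis_def if_distrib cong: if_cong)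
  qed (auto simp: Finite_Cartesian_Product.vec_eq_iff axis_def)
  have "F = (\<lambda>y. \<Sum>i\<in>UNIV. axis i (F y $ i))"
    by (auto simp: Finite_Cartesian_Product.vec_eq_iff axis_def)
  moreover have "integrable M (\<lambda>y. \<Sum>i\<in>UNIV. axis i (F y $ i) :: complex^'n)"
    using * by (intro Bochner_Integration.integrable_sum integrable_bounded_linear[OF bl]) auto
  ultimately show "integrable M F" by metis
qed

lemma integral_vec_nth:
  fixes F :: "'b \<Rightarrow> complex^'n"
  assumes "integrable M F"
  shows "(integral\<^sup>L M F) $ i = (LINT y|M. F y $ i)"
  by (rule integral_bounded_linear[OF bounded_linear_vec_nth assms, symmetric])

lemma set_integrable_vec_iff:
  fixes F :: "'b \<Rightarrow> complex^'n"
  shows "set_integrable M S F \<longleftrightarrow> (\<forall>i. set_integrable M S (\<lambda>y. F y $ i))"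
  unfolding set_integrable_def by (subst integrable_vec_iff) simp

lemma set_integral_vec_nth:
  fixes F :: "'b \<Rightarrow> complex^'n"
  assumes "set_integrable M S F"
  shows "(set_lebesgue_integral M S F) $ i = (LINT y:S|M. F y $ i)"
  using assms unfolding set_lebesgue_integral_def set_integrable_def by (simp add: integral_vec_nth)

text \<open>
  The Lax matrix at a spectral parameter on the unit circle.  Its entries are \<open>q\<^sub>m(x) / h\<^sub>i\<close>.  The numbers
  \<open>h\<^sub>i\<close> stand for the products of the differences \<open>l\<^sub>i - l\<^sub>m\<close>; for them \<open>\<Sum> 1 / h\<^sub>i = 0\<close>, as the second divided
  difference of a constant vanishes.
\<close>
locale imaginary_lax =
  fixes l h :: "3 \<Rightarrow> complex" and u u' v :: "real \<Rightarrow> real" and K :: real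
  assumes l_imag: "cnj (l i) = - l i" and h_real: "cnj (h i) = h i" and h_nz: "h i \<noteq> 0"
    and h_sum: "(\<Sum>i\<in>UNIV. 1 / h i) = 0"
    and u_deriv: "\<And>x. (u has_real_derivative u' x) (at x)"
    and u'_cont: "continuous_on UNIV u'" and v_cont: "continuous_on UNIV v"
    and u_int: "integrable lborel u" and u'_int: "integrable lborel u'" and v_int: "integrable lborel v"
    and u_top: "(u \<longlongrightarrow> 0) at_top" and u_bot: "(u \<longlongrightarrow> 0) at_bot"
    and u_bdd: "\<And>x. \<bar>u x\<bar> \<le> K"
begin

definition q :: "3 \<Rightarrow> real \<Rightarrow> complex" where
  "q m y = - of_real (u' y) / 4 - \<i> * of_real (v y) / (4 * of_real (sqrt 3)) - of_real (u y) / 2 * l m"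

definition W :: "real \<Rightarrow> real" where
  "W y = (\<Sum>i\<in>UNIV. norm (1 / h i)) * (\<Sum>m\<in>UNIV. norm (q m y))"

lemma u_cont: "continuous_on UNIV u"
  using u_deriv by (meson DERIV_isCont continuous_at_imp_continuous_on)

lemma q_cont: "continuous_on UNIV (q m)"
  unfolding q_def by (intro continuous_intros u_cont u'_cont v_cont) auto

lemma q_int: "integrable lborel (q m)"
  unfolding q_def using u_int u'_int v_int by auto

text \<open>
  Coefficients of the Volterra equations for the \<open>j\<close>-th columns of \<open>X\<close> and \<open>X\<^sup>A\<close> in the interaction picture:
  with \<open>b\<^sub>i = exp(- x (l\<^sub>i - l\<^sub>j)) X\<^sub>i\<^sub>j\<close> the kernel no longer depends on \<open>x\<close>.  The dual
  coefficient is the negative transpose.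
\<close>
definition AX :: "3 \<Rightarrow> real \<Rightarrow> complex^3 \<Rightarrow> complex^3" where
  "AX j y b = (\<chi> i. exp (- of_real y * (l i - l j)) *
      (\<Sum>m\<in>UNIV. 1 / h i * q m y * (exp (of_real y * (l m - l j)) * b $ m)))"

definition AXA :: "3 \<Rightarrow> real \<Rightarrow> complex^3 \<Rightarrow> complex^3" where
  "AXA j y b = (\<chi> i. - exp (of_real y * (l i - l j)) *
      (\<Sum>m\<in>UNIV. 1 / h m * q i y * (exp (- of_real y * (l m - l j)) * b $ m)))"

lemma norm_exp_imag: "norm (exp (of_real y * (l i - l j))) = 1" "norm (exp (- of_real y * (l i - l j))) = 1"
proof -
  have "Re (l i) = 0" for i using l_imag[of i] by (simp add: complex_eq_iff)
  then show "norm (exp (of_real y * (l i - l j))) = 1" "norm (exp (- of_real y * (l i - l j))) = 1" by auto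
qed

lemma W_cont: "continuous_on UNIV W" and W_nonneg: "0 \<le> W y" and W_int: "integrable lborel W"
proof -
  show "continuous_on UNIV W" unfolding W_def by (intro continuous_intros q_cont)
  show "0 \<le> W y" unfolding W_def by (intro mult_nonneg_nonneg sum_nonneg) auto
  show "integrable lborel W" unfolding W_def using q_int by auto
qed

lemma volterra_X: "linear_volterra (AX j) W"
proof (rule linear_volterra.intro)
  show "linear (AX j y)" for y
    by (rule linearI) (auto simp: AX_def Finite_Cartesian_Product.vec_eq_iff algebra_simps sum.distrib sum_distrib_left scaleR_sum_right)
  show "norm (AX j y b) \<le> W y * norm b" for y b
  proof -
    have "norm (AX j y b $ i) \<le> norm (1 / h i) * ((\<Sum>m\<in>UNIV. norm (q m y)) * norm b)" for i
    proof -
      have "norm (AX j y b $ i) = norm (\<Sum>m\<in>UNIV. 1 / h i * q m y * (exp (of_real y * (l m - l j)) * b $ m))"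
        unfolding AX_def using norm_exp_imag(2)[of y i j] by (simp add: norm_mult)
      also have "\<dots> \<le> (\<Sum>m\<in>UNIV. norm (1 / h i * q m y * (exp (of_real y * (l m - l j)) * b $ m)))"
        by (rule norm_sum)
      also have "\<dots> \<le> (\<Sum>m\<in>UNIV. norm (1 / h i) * norm (q m y) * norm b)"
        unfolding norm_mult norm_exp_imag by (intro sum_mono mult_left_mono) (auto simp: Finite_Cartesian_Product.norm_nth_le)
      finally show ?thesis by (simp add: sum_distrib_left sum_distrib_right mult_ac)
    qed
    then have "(\<Sum>i\<in>UNIV. norm (AX j y b $ i)) \<le> (\<Sum>i\<in>UNIV. norm (1 / h i) * ((\<Sum>m\<in>UNIV. norm (q m y)) * norm b))"
      by (rule sum_mono)
    from order_trans[OF norm_vec_le_sum this] show ?thesis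
      unfolding W_def by (simp only: sum_distrib_right mult.assoc)
  qed
  show "continuous_on UNIV (\<lambda>y. AX j y (b y))" if "continuous_on UNIV b" for b
    unfolding AX_def by (intro continuous_intros that q_cont continuous_on_component)
qed (auto intro: W_cont W_nonneg W_int)

lemma volterra_XA: "linear_volterra (AXA j) W"
proof (rule linear_volterra.intro)
  show "linear (AXA j y)" for y
    by (rule linearI) (auto simp: AXA_def Finite_Cartesian_Product.vec_eq_iff algebra_simps sum.distrib sum_distrib_left scaleR_sum_right)
  show "norm (AXA j y b) \<le> W y * norm b" for y b
  proof -
    have "norm (AXA j y b $ i) \<le> norm (q i y) * ((\<Sum>m\<in>UNIV. norm (1 / h m)) * norm b)" for i
    proof -
      have "norm (AXA j y b $ i) = norm (\<Sum>m\<in>UNIV. 1 / h m * q i y * (exp (- of_real y * (l m - l j)) * b $ m))"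
        unfolding AXA_def using norm_exp_imag(1)[of y i j] by (simp add: norm_mult)
      also have "\<dots> \<le> (\<Sum>m\<in>UNIV. norm (1 / h m * q i y * (exp (- of_real y * (l m - l j)) * b $ m)))"
        by (rule norm_sum)
      also have "\<dots> \<le> (\<Sum>m\<in>UNIV. norm (1 / h m) * norm (q i y) * norm b)"
        unfolding norm_mult norm_exp_imag by (intro sum_mono mult_left_mono) (auto simp: Finite_Cartesian_Product.norm_nth_le)
      finally show ?thesis by (simp add: sum_distrib_left sum_distrib_right mult_ac)
    qed
    then have "(\<Sum>i\<in>UNIV. norm (AXA j y b $ i)) \<le> (\<Sum>i\<in>UNIV. norm (q i y) * ((\<Sum>m\<in>UNIV. norm (1 / h m)) * norm b))"
      by (rule sum_mono)
    moreover have "W y = (\<Sum>m\<in>UNIV. norm (q m y)) * (\<Sum>i\<in>UNIV. norm (1 / h i))"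
      unfolding W_def by (rule mult.commute)
    ultimately show ?thesis using norm_vec_le_sum[of "AXA j y b"]
      by (simp only: sum_distrib_right mult.assoc order_trans)
  qed
  show "continuous_on UNIV (\<lambda>y. AXA j y (b y))" if "continuous_on UNIV b" for b
    unfolding AXA_def by (intro continuous_intros that q_cont continuous_on_component)
qed (auto intro: W_cont W_nonneg W_int)

text \<open>
  The Hermitian form \<open>H(x) = diag(h) + u(x)/2 1 1\<^sup>T\<close> applied to a solution, in the interaction picture and
  complex conjugated.  The rank one term is the boundary term in the formal self-adjointness of the third
  order operator: without it, \<open>U\<^sup>* diag(h) + diag(h) U\<close> does not vanish, but in the
  interaction picture it is an exact derivative.
\<close>
definition conj_dual :: "3 \<Rightarrow> (real \<Rightarrow> complex^3) \<Rightarrow> real \<Rightarrow> complex^3" where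
  "conj_dual j b x = (\<chi> i. cnj (h i * b x $ i + of_real (u x / 2) * exp (- of_real x * (l i - l j)) *
      (\<Sum>m\<in>UNIV. exp (of_real x * (l m - l j)) * b x $ m)) / h j)"

lemma cnj_exp_imag:
  "cnj (exp (of_real y * (l i - l j))) = exp (- of_real y * (l i - l j))"
  "cnj (exp (- of_real y * (l i - l j))) = exp (of_real y * (l i - l j))"
  by (simp_all add: exp_cnj l_imag algebra_simps)

lemma cnj_q: "cnj (q m y) = - of_real (u' y) / 4 + \<i> * of_real (v y) / (4 * of_real (sqrt 3)) + of_real (u y) / 2 * l m"
  unfolding q_def by (simp add: l_imag)

text \<open>
  \<open>H\<close> intertwines the Lax equation with its adjoint: \<open>H' + H (l + U) = - (l + U)\<^sup>* H\<close>.  The sum \<open>S\<close> of all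
  components sees no potential, because \<open>\<Sum> 1 / h\<^sub>i = 0\<close>; this makes the terms with \<open>u\<close> cancel.
\<close>
lemma conj_dual_deriv:
  assumes b: "\<And>x. (b has_vector_derivative AX j x (b x)) (at x)"
  shows "(conj_dual j b has_vector_derivative AXA j x (conj_dual j b x)) (at x)"
proof -
  define \<alpha> where "\<alpha> i = l i - l j" for i
  define S where "S x = (\<Sum>m\<in>UNIV. exp (of_real x * \<alpha> m) * b x $ m)" for x
  define d where "d i x = h i * b x $ i + of_real (u x / 2) * exp (- of_real x * \<alpha> i) * S x" for i x
  have cd: "conj_dual j b x = (\<chi> i. cnj (d i x) / h j)" for x
    unfolding conj_dual_def d_def S_def \<alpha>_def ..
  have bi: "((\<lambda>x. b x $ i) has_vector_derivative AX j x (b x) $ i) (at x)" for i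
    using bounded_linear.has_vector_derivative[OF bounded_linear_vec_nth b] .
  have ex: "((\<lambda>x. exp (of_real x * \<alpha> m)) has_vector_derivative \<alpha> m * exp (of_real x * \<alpha> m)) (at x)" for m
    by (rule has_vector_derivative_real_field) (auto intro!: derivative_eq_intros)
  have ex': "((\<lambda>x. exp (- of_real x * \<alpha> m)) has_vector_derivative - \<alpha> m * exp (- of_real x * \<alpha> m)) (at x)" for m
    by (rule has_vector_derivative_real_field) (auto intro!: derivative_eq_intros)
  have uu: "((\<lambda>x. complex_of_real (u x / 2)) has_vector_derivative of_real (u' x / 2)) (at x)"
    by (intro has_vector_derivative_of_real DERIV_cdivide u_deriv)
  have AXi: "exp (of_real x * \<alpha> i) * AX j x (b x) $ i = 1 / h i * (\<Sum>m\<in>UNIV. q m x * (exp (of_real x * \<alpha> m) * b x $ m))" for i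
    unfolding AX_def \<alpha>_def by (simp add: exp_minus sum_distrib_left mult_ac)
  have "(S has_vector_derivative (\<Sum>m\<in>UNIV. exp (of_real x * \<alpha> m) * AX j x (b x) $ m + \<alpha> m * exp (of_real x * \<alpha> m) * b x $ m)) (at x)"
    unfolding S_def by (intro has_vector_derivative_sum has_vector_derivative_mult ex bi)
  moreover have "(\<Sum>m\<in>UNIV. exp (of_real x * \<alpha> m) * AX j x (b x) $ m) = 0"
    unfolding AXi sum_distrib_right[symmetric] h_sum by simp
  ultimately have S': "(S has_vector_derivative (\<Sum>m\<in>UNIV. \<alpha> m * exp (of_real x * \<alpha> m) * b x $ m)) (at x)"
    by (simp add: sum.distrib)
  have d': "(d i has_vector_derivative - exp (- of_real x * \<alpha> i) * cnj (q i x) * S x) (at x)" for i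
  proof -
    have "(d i has_vector_derivative (h i * AX j x (b x) $ i + (of_real (u x / 2) * exp (- of_real x * \<alpha> i) * (\<Sum>m\<in>UNIV. \<alpha> m * exp (of_real x * \<alpha> m) * b x $ m)
       + (of_real (u x / 2) * (- \<alpha> i * exp (- of_real x * \<alpha> i)) + of_real (u' x / 2) * exp (- of_real x * \<alpha> i)) * S x))) (at x)"
      unfolding d_def by (intro has_vector_derivative_add has_vector_derivative_mult has_vector_derivative_mult_right S' ex' bi uu)
    moreover have "h i * AX j x (b x) $ i = exp (- of_real x * \<alpha> i) * (\<Sum>m\<in>UNIV. q m x * (exp (of_real x * \<alpha> m) * b x $ m))"
      using AXi[of i] h_nz[of i] by (simp add: exp_minus field_simps)
    moreover have "(\<Sum>m\<in>UNIV. q m x * (exp (of_real x * \<alpha> m) * b x $ m)) = (- of_real (u' x) / 4 - \<i> * of_real (v x) / (4 * of_real (sqrt 3)) - of_real (u x) / 2 * l j) * S x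
       - of_real (u x / 2) * (\<Sum>m\<in>UNIV. \<alpha> m * exp (of_real x * \<alpha> m) * b x $ m)"
      unfolding S_def sum_distrib_left sum_subtractf[symmetric]
      by (intro sum.cong) (auto simp: q_def \<alpha>_def algebra_simps)
    ultimately have "(d i has_vector_derivative (exp (- of_real x * \<alpha> i) * ((- of_real (u' x) / 4 - \<i> * of_real (v x) / (4 * of_real (sqrt 3)) - of_real (u x) / 2 * l j) * S x
       - of_real (u x / 2) * (\<Sum>m\<in>UNIV. \<alpha> m * exp (of_real x * \<alpha> m) * b x $ m)) + (of_real (u x / 2) * exp (- of_real x * \<alpha> i) * (\<Sum>m\<in>UNIV. \<alpha> m * exp (of_real x * \<alpha> m) * b x $ m)
       + (of_real (u x / 2) * (- \<alpha> i * exp (- of_real x * \<alpha> i)) + of_real (u' x / 2) * exp (- of_real x * \<alpha> i)) * S x))) (at x)"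
      by simp
    moreover have "(exp (- of_real x * \<alpha> i) * ((- of_real (u' x) / 4 - \<i> * of_real (v x) / (4 * of_real (sqrt 3)) - of_real (u x) / 2 * l j) * S x
       - of_real (u x / 2) * T) + (of_real (u x / 2) * exp (- of_real x * \<alpha> i) * T
       + (of_real (u x / 2) * (- \<alpha> i * exp (- of_real x * \<alpha> i)) + of_real (u' x / 2) * exp (- of_real x * \<alpha> i)) * S x))
       = - exp (- of_real x * \<alpha> i) * cnj (q i x) * S x" for T
      unfolding cnj_q \<alpha>_def by (simp add: field_simps)
    ultimately show ?thesis by simp
  qed
  \<comment> \<open>the rank one part of the form drops out against \<open>1 / h\<close>\<close>
  have pd: "(\<Sum>m\<in>UNIV. 1 / h m * (exp (of_real x * \<alpha> m) * d m x)) = S x"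
  proof -
    have "1 / h m * (exp (of_real x * \<alpha> m) * d m x) = exp (of_real x * \<alpha> m) * b x $ m + of_real (u x / 2) * S x * (1 / h m)" for m
      unfolding d_def using h_nz[of m] by (simp add: exp_minus field_simps)
    then have "(\<Sum>m\<in>UNIV. 1 / h m * (exp (of_real x * \<alpha> m) * d m x)) = S x + of_real (u x / 2) * S x * (\<Sum>m\<in>UNIV. 1 / h m)"
      by (simp only: sum.distrib sum_distrib_left[symmetric] S_def)
    then show ?thesis unfolding h_sum by simp
  qed
  have comp: "((\<lambda>x. cnj (d i x) / h j) has_vector_derivative AXA j x (conj_dual j b x) $ i) (at x)" for i
  proof -
    have "((\<lambda>x. cnj (d i x) * (1 / h j)) has_vector_derivative cnj (- exp (- of_real x * \<alpha> i) * cnj (q i x) * S x) * (1 / h j)) (at x)"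
      by (intro has_vector_derivative_mult_left bounded_linear.has_vector_derivative[OF bounded_linear_cnj] d')
    moreover have "cnj (- exp (- of_real x * \<alpha> i) * cnj (q i x) * S x) * (1 / h j) = AXA j x (conj_dual j b x) $ i"
    proof -
      have "cnj (S x) = (\<Sum>m\<in>UNIV. 1 / h m * (exp (- of_real x * \<alpha> m) * cnj (d m x)))"
        unfolding pd[symmetric] \<alpha>_def by (simp add: h_real cnj_exp_imag del: of_real_minus mult_minus_left)
      then show ?thesis unfolding cd AXA_def complex_cnj_mult complex_cnj_minus \<alpha>_def cnj_exp_imag
        by (simp add: sum_distrib_left sum_distrib_right mult_ac)
    qed
    ultimately show ?thesis by simp
  qed
  show ?thesis unfolding has_vector_derivative_def
  proof (subst has_derivative_componentwise_within, intro ballI)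
    fix B :: "complex^3" assume "B \<in> Basis"
    then obtain i c where B: "B = axis i c" unfolding Basis_vec_def by auto
    have "((\<lambda>y. conj_dual j b y $ i) has_vector_derivative AXA j x (conj_dual j b x) $ i) (at x)"
      using comp[of i] unfolding cd by simp
    then have "((\<lambda>y. (conj_dual j b y $ i) \<bullet> c) has_vector_derivative (AXA j x (conj_dual j b x) $ i) \<bullet> c) (at x)"
      by (rule bounded_linear.has_vector_derivative[OF bounded_linear_inner_left])
    then show "((\<lambda>y. conj_dual j b y \<bullet> B) has_derivative (\<lambda>xa. (xa *\<^sub>R AXA j x (conj_dual j b x)) \<bullet> B)) (at x)"
      unfolding B inner_axis has_vector_derivative_def by simp
  qed
qed

lemma conj_dual_limit:
  assumes b: "(b \<longlongrightarrow> e) F" and u0: "(u \<longlongrightarrow> 0) F" and bdd: "\<And>x. norm (b x) \<le> C"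
  shows "(conj_dual j b \<longlongrightarrow> (\<chi> i. h i * cnj (e $ i) / h j)) F"
proof -
  have "((\<lambda>x. cnj (h i * b x $ i + of_real (u x / 2) * exp (- of_real x * (l i - l j)) *
      (\<Sum>m\<in>UNIV. exp (of_real x * (l m - l j)) * b x $ m)) / h j) \<longlongrightarrow> cnj (h i * e $ i + 0) / h j) F" for i
  proof (intro tendsto_intros tendsto_vec_nth b h_nz)
    show "((\<lambda>x. of_real (u x / 2) * exp (- of_real x * (l i - l j)) *
      (\<Sum>m\<in>UNIV. exp (of_real x * (l m - l j)) * b x $ m)) \<longlongrightarrow> 0) F"
    proof (rule Lim_null_comparison)
      show "((\<lambda>x. \<bar>u x / 2\<bar> * (3 * C)) \<longlongrightarrow> 0) F"
        by (rule tendsto_eq_intros refl u0 | simp)+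
      show "\<forall>\<^sub>F x in F. norm (of_real (u x / 2) * exp (- of_real x * (l i - l j)) *
      (\<Sum>m\<in>UNIV. exp (of_real x * (l m - l j)) * b x $ m)) \<le> \<bar>u x / 2\<bar> * (3 * C)"
      proof (rule always_eventually, rule allI)
        fix x
        have "norm (\<Sum>m\<in>UNIV. exp (of_real x * (l m - l j)) * b x $ m) \<le> (\<Sum>m\<in>(UNIV::3 set). C)"
          using order_trans[OF Finite_Cartesian_Product.norm_nth_le bdd]
          by (intro sum_norm_le) (simp only: norm_mult norm_exp_imag mult_1_left)
        then show "norm (of_real (u x / 2) * exp (- of_real x * (l i - l j)) *
          (\<Sum>m\<in>UNIV. exp (of_real x * (l m - l j)) * b x $ m)) \<le> \<bar>u x / 2\<bar> * (3 * C)"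
          unfolding norm_mult norm_exp_imag by (intro mult_mono) auto
      qed
    qed
  qed
  then show ?thesis unfolding conj_dual_def by (intro vec_tendstoI) (simp add: h_real)
qed

lemma conj_dual_bounded:
  assumes bdd: "\<And>x. norm (b x) \<le> C"
  shows "\<exists>C'. \<forall>x. norm (conj_dual j b x) \<le> C'"
proof -
  have "norm (conj_dual j b x) \<le> (\<Sum>i\<in>UNIV. (norm (h i) * C + K / 2 * (3 * C)) / norm (h j))" for x
  proof (rule order_trans[OF norm_vec_le_sum sum_mono])
    fix i :: 3
    have C: "norm (b x $ m) \<le> C" for m using order_trans[OF Finite_Cartesian_Product.norm_nth_le bdd] .
    have "norm (\<Sum>m\<in>UNIV. exp (of_real x * (l m - l j)) * b x $ m) \<le> (\<Sum>m\<in>(UNIV::3 set). C)"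
      using C by (intro sum_norm_le) (simp only: norm_mult norm_exp_imag mult_1_left)
    then have 1: "norm (of_real (u x / 2) * exp (- of_real x * (l i - l j)) *
          (\<Sum>m\<in>UNIV. exp (of_real x * (l m - l j)) * b x $ m)) \<le> K / 2 * (3 * C)"
      unfolding norm_mult norm_exp_imag using u_bdd[of x] order_trans[OF abs_ge_zero u_bdd[of x]] by (intro mult_mono) auto
    have 2: "norm (h i * b x $ i) \<le> norm (h i) * C" unfolding norm_mult using C by (intro mult_left_mono) auto
    show "norm (conj_dual j b x $ i) \<le> (norm (h i) * C + K / 2 * (3 * C)) / norm (h j)"
      unfolding conj_dual_def
      by (simp only: vec_lambda_beta norm_divide complex_mod_cnj)
         (rule divide_right_mono[OF order_trans[OF norm_triangle_ineq add_mono[OF 2 1]] norm_ge_zero])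
  qed
  then show ?thesis by blast
qed

lemma dual_solution:
  assumes b: "linear_volterra.sol (AX j) (axis j 1) b"
  shows "linear_volterra.sol (AXA j) (axis j 1) (conj_dual j b)"
proof -
  interpret X: linear_volterra "AX j" W by (rule volterra_X)
  interpret XA: linear_volterra "AXA j" W by (rule volterra_XA)
  obtain C where C: "\<And>x. norm (b x) \<le> C" using X.sol_exists X.sol_unique[OF b] by metis
  obtain C' where C': "\<And>x. norm (conj_dual j b x) \<le> C'" using conj_dual_bounded[of b C j, OF C] by blast
  have "(conj_dual j b \<longlongrightarrow> (\<chi> i. h i * cnj (axis j 1 $ i) / h j)) at_top"
    by (rule conj_dual_limit[OF X.sol_tendsto[OF b] u_top C])
  moreover have "(\<chi> i. h i * cnj (axis j 1 $ i) / h j) = axis j 1"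
    using h_nz by (simp add: Finite_Cartesian_Product.vec_eq_iff axis_def)
  ultimately show ?thesis
    using XA.solI_derivative[OF conj_dual_deriv[OF X.sol_has_derivative[OF b]] C'] by simp
qed

text \<open>
  Both scattering columns are the limits at minus infinity of the respective solutions, and \<open>u\<close> vanishes
  there, so \<open>H\<close> reduces to \<open>diag(h)\<close>.
\<close>
lemma scattering_duality:
  assumes b: "linear_volterra.sol (AX j) (axis j 1) b"
  shows "axis j 1 $ i - (LBINT x. AXA j x (conj_dual j b x) $ i) =
     h i * cnj (axis j 1 $ i - (LBINT x. AX j x (b x) $ i)) / h j"
proof -
  interpret X: linear_volterra "AX j" W by (rule volterra_X)
  interpret XA: linear_volterra "AXA j" W by (rule volterra_XA)
  obtain C where C: "\<And>x. norm (b x) \<le> C" using X.sol_exists X.sol_unique[OF b] by metis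
  obtain C' where C': "\<And>x. norm (conj_dual j b x) \<le> C'" using conj_dual_bounded[of b C j, OF C] by blast
  note c = dual_solution[OF b]
  have ib: "integrable lborel (\<lambda>x. AX j x (b x))" by (rule X.integrable_bounded[OF X.sol_continuous[OF b] C])
  have ic: "integrable lborel (\<lambda>x. AXA j x (conj_dual j b x))" by (rule XA.integrable_bounded[OF XA.sol_continuous[OF c] C'])
  have "((\<lambda>x. axis j 1 - (LBINT y:{x..}. AX j y (b y))) \<longlongrightarrow> axis j 1 - (LBINT y. AX j y (b y))) at_bot"
    by (intro tendsto_intros integral_tendsto_at_bot ib)
  then have lb: "(b \<longlongrightarrow> axis j 1 - (LBINT y. AX j y (b y))) at_bot"
    unfolding X.sol_eq[OF b] .
  have "((\<lambda>x. axis j 1 - (LBINT y:{x..}. AXA j y (conj_dual j b y))) \<longlongrightarrow> axis j 1 - (LBINT y. AXA j y (conj_dual j b y))) at_bot"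
    by (intro tendsto_intros integral_tendsto_at_bot ic)
  then have lc: "(conj_dual j b \<longlongrightarrow> axis j 1 - (LBINT y. AXA j y (conj_dual j b y))) at_bot"
    unfolding XA.sol_eq[OF c] .
  have "axis j 1 - (LBINT y. AXA j y (conj_dual j b y)) = (\<chi> i. h i * cnj ((axis j 1 - (LBINT y. AX j y (b y))) $ i) / h j)"
    by (rule tendsto_unique[OF _ lc conj_dual_limit[OF lb u_bot C]]) simp
  then have "(axis j 1 - (LBINT y. AXA j y (conj_dual j b y))) $ i = h i * cnj ((axis j 1 - (LBINT y. AX j y (b y))) $ i) / h j"
    by simp
  then show ?thesis by (simp add: integral_vec_nth[OF ib] integral_vec_nth[OF ic])
qed

end

section \<open>The potential and the Lax matrix\<close>

lemma distinct_index3 [simp]: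
  "(1::3) \<noteq> 2" "(1::3) \<noteq> 3" "(2::3) \<noteq> 1" "(2::3) \<noteq> 3" "(3::3) \<noteq> 1" "(3::3) \<noteq> 2"
  by auto

lemma rot_simps: "rot 1 k = \<omega> * k" "rot 2 k = \<omega>\<^sup>2 * k" "rot 3 k = \<omega> ^ 3 * k"
  by (auto simp: rot_def)

lemma schwartzD:
  assumes "schwartz f"
  shows "(f has_real_derivative deriv f x) (at x)"
    and "continuous_on UNIV f" and "continuous_on UNIV (deriv f)"
    and "\<exists>C. \<forall>x. \<bar>f x\<bar> \<le> C / (1 + x\<^sup>2)\<^sup>2" and "\<exists>C. \<forall>x. \<bar>deriv f x\<bar> \<le> C / (1 + x\<^sup>2)\<^sup>2"
proof -
  have d: "(deriv ^^ n) f field_differentiable at x" for n x using assms unfolding schwartz_def by blast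
  show "(f has_real_derivative deriv f x) (at x)"
    using d[of 0 x] by (simp add: DERIV_deriv_iff_field_differentiable)
  have c: "continuous_on UNIV ((deriv ^^ n) f)" for n
    using d by (meson continuous_at_imp_continuous_on field_differentiable_imp_continuous_at)
  show "continuous_on UNIV f" "continuous_on UNIV (deriv f)" using c[of 0] c[of 1] by auto
  have b: "\<exists>C. \<forall>x. \<bar>(deriv ^^ n) f x\<bar> \<le> C / (1 + x\<^sup>2)\<^sup>2" for n
  proof -
    have "\<exists>C. \<forall>x. \<bar>x ^ m * (deriv ^^ n) f x\<bar> \<le> C" for m using assms unfolding schwartz_def by blast
    then obtain C where C: "\<And>m x. \<bar>x ^ m * (deriv ^^ n) f x\<bar> \<le> C m" by metis
    have "\<bar>(deriv ^^ n) f x\<bar> \<le> (C 0 + 2 * C 2 + C 4) / (1 + x\<^sup>2)\<^sup>2" for x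
    proof -
      have "(1 + x\<^sup>2)\<^sup>2 * \<bar>(deriv ^^ n) f x\<bar> = \<bar>x ^ 0 * (deriv ^^ n) f x\<bar> + 2 * \<bar>x ^ 2 * (deriv ^^ n) f x\<bar> + \<bar>x ^ 4 * (deriv ^^ n) f x\<bar>"
        by (simp add: abs_mult power_even_abs) (simp add: algebra_simps power2_eq_square power4_eq_xxxx)
      also have "\<dots> \<le> C 0 + 2 * C 2 + C 4" using C[of x 0] C[of x 2] C[of x 4] by linarith
      finally have "(1 + x\<^sup>2)\<^sup>2 * \<bar>(deriv ^^ n) f x\<bar> \<le> C 0 + 2 * C 2 + C 4" .
      moreover have "0 < (1 + x\<^sup>2)\<^sup>2" by (intro zero_less_power) (simp add: add_pos_nonneg)
      ultimately show ?thesis by (subst pos_le_divide_eq) (simp_all add: mult.commute)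
    qed
    then show ?thesis by blast
  qed
  show "\<exists>C. \<forall>x. \<bar>f x\<bar> \<le> C / (1 + x\<^sup>2)\<^sup>2" "\<exists>C. \<forall>x. \<bar>deriv f x\<bar> \<le> C / (1 + x\<^sup>2)\<^sup>2"
    using b[of 0] b[of 1] by auto
qed

lemma inverse_square_weight_integrable: "integrable lborel (\<lambda>x::real. C / (1 + x\<^sup>2))"
proof -
  have "integrable lborel (\<lambda>x::real. inverse (1 + x\<^sup>2))"
    using integrable_inverse_1_plus_square by (simp add: set_integrable_def)
  then show ?thesis using integrable_mult_right[of C lborel "\<lambda>x::real. inverse (1 + x\<^sup>2)"] by (simp add: divide_inverse)
qed

lemma decay_integrable:
  fixes f :: "real \<Rightarrow> real"
  assumes "continuous_on UNIV f" "\<And>x. \<bar>f x\<bar> \<le> C / (1 + x\<^sup>2)"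
  shows "integrable lborel f"
proof (rule Bochner_Integration.integrable_bound[OF inverse_square_weight_integrable[of C]])
  show "f \<in> borel_measurable lborel" using borel_measurable_continuous_onI[OF assms(1)] by simp
  show "AE x in lborel. norm (f x) \<le> norm (C / (1 + x\<^sup>2))"
    using order_trans[OF assms(2) abs_ge_self] by (intro AE_I2) simp
qed

lemma decay_weaken:
  fixes C x :: real
  assumes "C \<ge> 0"
  shows "C / (1 + x\<^sup>2)\<^sup>2 \<le> C / (1 + x\<^sup>2)" "C / (1 + x\<^sup>2) \<le> C"
proof -
  have 1: "1 \<le> 1 + x\<^sup>2" by simp
  have "1 + x\<^sup>2 \<le> (1 + x\<^sup>2)\<^sup>2" using 1 by (simp add: power2_eq_square mult_le_cancel_left1)
  then show "C / (1 + x\<^sup>2)\<^sup>2 \<le> C / (1 + x\<^sup>2)" using assms 1 by (intro divide_left_mono mult_pos_pos zero_less_power) (auto simp: add_pos_nonneg)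
  show "C / (1 + x\<^sup>2) \<le> C" using assms 1 by (simp add: divide_le_eq mult_le_cancel_left1 add_pos_nonneg)
qed

lemma schwartz_decay:
  assumes "schwartz f"
  shows "\<exists>C\<ge>0. \<forall>x. \<bar>f x\<bar> \<le> C / (1 + x\<^sup>2)\<^sup>2 \<and> \<bar>deriv f x\<bar> \<le> C / (1 + x\<^sup>2)\<^sup>2"
proof -
  obtain C1 C2 where C: "\<And>x. \<bar>f x\<bar> \<le> C1 / (1 + x\<^sup>2)\<^sup>2" "\<And>x. \<bar>deriv f x\<bar> \<le> C2 / (1 + x\<^sup>2)\<^sup>2"
    using schwartzD(4,5)[OF assms] by blast
  have "C1 / (1 + x\<^sup>2)\<^sup>2 \<le> max 0 (max C1 C2) / (1 + x\<^sup>2)\<^sup>2" "C2 / (1 + x\<^sup>2)\<^sup>2 \<le> max 0 (max C1 C2) / (1 + x\<^sup>2)\<^sup>2" for x :: real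
    by (intro divide_right_mono; simp)+
  then show ?thesis using C by (intro exI[of _ "max 0 (max C1 C2)"]) (meson max.cobounded1 order_trans)
qed

lemma schwartz_integrable:
  assumes "schwartz f"
  shows "integrable lborel f" "integrable lborel (deriv f)"
proof -
  obtain C where C: "C \<ge> 0" "\<And>x. \<bar>f x\<bar> \<le> C / (1 + x\<^sup>2)\<^sup>2" "\<And>x. \<bar>deriv f x\<bar> \<le> C / (1 + x\<^sup>2)\<^sup>2"
    using schwartz_decay[OF assms] by blast
  show "integrable lborel f"
    by (rule decay_integrable[OF schwartzD(2)[OF assms] order_trans[OF C(2) decay_weaken(1)[OF C(1)]]])
  show "integrable lborel (deriv f)"
    by (rule decay_integrable[OF schwartzD(3)[OF assms] order_trans[OF C(3) decay_weaken(1)[OF C(1)]]])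
qed

lemma decay_tendsto_0:
  fixes f :: "real \<Rightarrow> real"
  assumes "\<And>x. \<bar>f x\<bar> \<le> C / (1 + x\<^sup>2)"
  shows "(f \<longlongrightarrow> 0) at_top" "(f \<longlongrightarrow> 0) at_bot"
proof -
  have t: "filterlim (\<lambda>x::real. 1 + x\<^sup>2) at_top at_top" "filterlim (\<lambda>x::real. 1 + x\<^sup>2) at_top at_bot"
    by (rule filterlim_tendsto_add_at_top[OF tendsto_const filterlim_pow_at_top[OF _ filterlim_ident]]
          filterlim_tendsto_add_at_top[OF tendsto_const filterlim_pow_at_bot_even[OF _ filterlim_ident]], simp_all)+
  have z: "((\<lambda>x::real. C / (1 + x\<^sup>2)) \<longlongrightarrow> 0) at_top" "((\<lambda>x::real. C / (1 + x\<^sup>2)) \<longlongrightarrow> 0) at_bot"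
    using t by (auto intro!: tendsto_divide_0[OF tendsto_const] filterlim_at_top_imp_at_infinity)
  show "(f \<longlongrightarrow> 0) at_top" by (rule Lim_null_comparison[OF _ z(1)]) (simp add: assms)
  show "(f \<longlongrightarrow> 0) at_bot" by (rule Lim_null_comparison[OF _ z(2)]) (simp add: assms)
qed

text \<open>
  \<open>C / (1 + x\<^sup>2) \<plusminus> f\<close> is decreasing on \<open>[1, \<infinity>)\<close> and tends to 0.
\<close>
lemma decay_of_derivative_decay:
  fixes f f' :: "real \<Rightarrow> real"
  assumes der: "\<And>x. (f has_real_derivative f' x) (at x)"
    and bd: "\<And>x. \<bar>f' x\<bar> \<le> C / (1 + x\<^sup>2)\<^sup>2" and lim: "(f \<longlongrightarrow> 0) at_top" and C: "C \<ge> 0"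
    and x: "x \<ge> 1"
  shows "\<bar>f x\<bar> \<le> C / (1 + x\<^sup>2)"
proof -
  have pos: "0 < 1 + y\<^sup>2" for y :: real by (simp add: add_pos_nonneg)
  have nn: "1 + y\<^sup>2 \<noteq> 0" for y :: real using pos[of y] by simp
  have psi: "((\<lambda>y. C / (1 + y\<^sup>2)) has_real_derivative - (2 * y * C / (1 + y\<^sup>2)\<^sup>2)) (at y)" for y
    by (rule derivative_eq_intros refl nn | simp add: nn power2_eq_square)+
  have psi0: "((\<lambda>y. C / (1 + y\<^sup>2)) \<longlongrightarrow> 0) at_top"
    by (rule decay_tendsto_0(1)[of _ C]) (use C pos in \<open>simp add: abs_of_nonneg\<close>)
  have dom: "\<bar>f' y\<bar> \<le> 2 * y * C / (1 + y\<^sup>2)\<^sup>2" if "y \<ge> 1" for y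
  proof -
    have "C * 1 \<le> C * (2 * y)" using that C by (intro mult_left_mono) auto
    then have "C / (1 + y\<^sup>2)\<^sup>2 \<le> 2 * y * C / (1 + y\<^sup>2)\<^sup>2" by (intro divide_right_mono) (auto simp: mult_ac)
    then show ?thesis using bd[of y] by linarith
  qed
  have *: "0 \<le> C / (1 + x\<^sup>2) + s * f x" if "s = 1 \<or> s = -1" for s
  proof -
    define g where "g y = C / (1 + y\<^sup>2) + s * f y" for y
    have "g y \<le> g x" if y: "y \<ge> x" for y
    proof (rule DERIV_nonpos_imp_nonincreasing[OF y])
      fix z assume z: "x \<le> z" "z \<le> y"
      have "(g has_real_derivative - (2 * z * C / (1 + z\<^sup>2)\<^sup>2) + s * f' z) (at z)"
        unfolding g_def by (intro derivative_intros psi DERIV_cmult der)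
      moreover have "- (2 * z * C / (1 + z\<^sup>2)\<^sup>2) + s * f' z \<le> 0"
        using dom[of z] z x \<open>s = 1 \<or> s = -1\<close> by auto
      ultimately show "\<exists>D. (g has_real_derivative D) (at z) \<and> D \<le> 0" by blast
    qed
    then have "\<forall>\<^sub>F y in at_top. g y \<le> g x" by (rule eventually_mono[OF eventually_ge_at_top[of x]])
    moreover have "(g \<longlongrightarrow> 0 + s * 0) at_top" unfolding g_def by (intro tendsto_intros psi0 lim)
    ultimately have "0 + s * 0 \<le> g x" by (intro tendsto_upperbound) auto
    then show ?thesis by (simp add: g_def)
  qed
  show ?thesis using *[of 1] *[of "-1"] by (auto simp: abs_le_iff)
qed

text \<open>
  The vanishing integral of \<open>u\<^sub>1\<close> makes \<open>v\<^sub>0\<close> vanish at both ends; then its derivative \<open>u\<^sub>1\<close> controls its decay.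
\<close>
lemma v0_continuous_integrable:
  assumes s: "schwartz u1" and z: "(LBINT y. u1 y) = 0"
  shows "continuous_on UNIV (v0 u1)" "integrable lborel (v0 u1)"
proof -
  note i = schwartz_integrable(1)[OF s]
  have si: "set_integrable lborel A u1" if "A \<in> sets borel" for A
    unfolding set_integrable_def by (rule integrable_mult_indicator[OF _ i]) (use that in simp)
  have v: "v0 u1 = (\<lambda>x. - (LBINT y:{x..}. u1 y))"
  proof
    fix x
    have "(LBINT y:{x<..}. u1 y) = (LBINT y:{x..}. u1 y)"
      by (rule tail_integral_greaterThan) (simp add: si)
    moreover have "(LBINT y:{..x} \<union> {x<..}. u1 y) = (LBINT y:{..x}. u1 y) + (LBINT y:{x<..}. u1 y)"
      by (rule set_integral_Un) (auto intro: si)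
    moreover have "{..x} \<union> {x<..} = UNIV" by auto
    ultimately show "v0 u1 x = - (LBINT y:{x..}. u1 y)"
      using z unfolding v0_def by (simp add: set_lebesgue_integral_def)
  qed
  have d: "(v0 u1 has_real_derivative u1 x) (at x)" for x
  proof -
    have "((\<lambda>x. LBINT y:{x..}. u1 y) has_vector_derivative - u1 x) (at x)"
      by (rule has_vector_derivative_tail_integral[OF si schwartzD(2)[OF s]]) simp
    then have "((\<lambda>x. - (LBINT y:{x..}. u1 y)) has_vector_derivative - (- u1 x)) (at x)"
      by (rule has_vector_derivative_minus)
    then show ?thesis unfolding v by (simp add: has_real_derivative_iff_has_vector_derivative)
  qed
  show c: "continuous_on UNIV (v0 u1)" using d by (meson DERIV_isCont continuous_at_imp_continuous_on)
  have "((\<lambda>x. - (LBINT y:{x..}. u1 y)) \<longlongrightarrow> - 0) at_top"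
    by (intro tendsto_intros tail_integral_tendsto_0 si) simp
  then have top: "(v0 u1 \<longlongrightarrow> 0) at_top" unfolding v by simp
  have "((\<lambda>x. - (LBINT y:{x..}. u1 y)) \<longlongrightarrow> - (LBINT y. u1 y)) at_bot"
    by (intro tendsto_intros integral_tendsto_at_bot i)
  then have bot: "(v0 u1 \<longlongrightarrow> 0) at_bot" unfolding v z by simp
  obtain C where C: "C \<ge> 0" "\<And>x. \<bar>u1 x\<bar> \<le> C / (1 + x\<^sup>2)\<^sup>2" "\<And>x. \<bar>deriv u1 x\<bar> \<le> C / (1 + x\<^sup>2)\<^sup>2"
    using schwartz_decay[OF s] by blast
  have p: "\<bar>v0 u1 x\<bar> \<le> C / (1 + x\<^sup>2)" if "x \<ge> 1" for x
    by (rule decay_of_derivative_decay[OF d C(2) top C(1) that])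
  have n: "\<bar>v0 u1 (- x)\<bar> \<le> C / (1 + x\<^sup>2)" if "x \<ge> 1" for x
  proof (rule decay_of_derivative_decay[OF _ _ _ C(1) that, where f = "\<lambda>x. v0 u1 (- x)" and f' = "\<lambda>x. - u1 (- x)"])
    show "((\<lambda>x. v0 u1 (- x)) has_real_derivative - u1 (- x)) (at x)" for x
      using DERIV_chain'[OF DERIV_minus[OF DERIV_ident] d, of x] by simp
    show "\<bar>- u1 (- x)\<bar> \<le> C / (1 + x\<^sup>2)\<^sup>2" for x using C(2)[of "-x"] by simp
    show "((\<lambda>x. v0 u1 (- x)) \<longlongrightarrow> 0) at_top" using bot unfolding filterlim_at_bot_mirror .
  qed
  have "compact (v0 u1 ` {-1..1})" by (intro compact_continuous_image continuous_on_subset[OF c]) auto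
  then have "bounded (v0 u1 ` {-1..1})" by (rule compact_imp_bounded)
  then obtain B where "\<forall>y\<in>v0 u1 ` {-1..1}. norm y \<le> B"
    unfolding bounded_iff by blast
  then have B: "\<bar>v0 u1 x\<bar> \<le> B" if "x \<in> {-1..1}" for x using that by auto
  have B0: "B \<ge> 0" using B[of 0] by auto
  have "\<bar>v0 u1 x\<bar> \<le> (C + 2 * B) / (1 + x\<^sup>2)" for x
  proof -
    have pos: "0 < 1 + x\<^sup>2" by (simp add: add_pos_nonneg)
    have le: "C / (1 + x\<^sup>2) \<le> (C + 2 * B) / (1 + x\<^sup>2)" using B0 pos by (intro divide_right_mono) auto
    consider "x \<ge> 1" | "x \<le> -1" | "x \<in> {-1..1}" by fastforce
    then show ?thesis
    proof cases
      case 1 then show ?thesis using p le by force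
    next
      case 2 then show ?thesis using n[of "-x"] le by force
    next
      case 3
      then have "x\<^sup>2 \<le> 1" by (simp add: abs_square_le_1 abs_le_iff)
      then have "B * (1 + x\<^sup>2) \<le> B * 2" using B0 by (intro mult_left_mono) auto
      then have "B \<le> (C + 2 * B) / (1 + x\<^sup>2)" using pos C(1) by (simp add: pos_le_divide_eq)
      then show ?thesis using B[OF 3] by linarith
    qed
  qed
  then show "integrable lborel (v0 u1)" by (rule decay_integrable[OF c])
qed

lemma matrix_inv_eqI:
  fixes A B :: "complex^'n^'n"
  assumes "B ** A = mat 1" shows "matrix_inv A = B"
proof -
  have AB: "A ** B = mat 1" using assms matrix_left_right_inverse by blast
  have "A ** matrix_inv A = mat 1" unfolding matrix_inv_def
    by (rule someI2[of _ B]) (use AB assms in auto)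
  then have "B ** (A ** matrix_inv A) = B" by simp
  then show ?thesis unfolding matrix_mul_assoc assms by simp
qed

text \<open>
  The denominators of Lagrange interpolation at the three nodes \<open>l\<^sub>i(k)\<close>; their reciprocals are the last
  column of the inverse Vandermonde matrix.
\<close>
definition lagrange_denom :: "complex \<Rightarrow> 3 \<Rightarrow> complex" where
  "lagrange_denom k i = (\<Prod>m\<in>UNIV - {i}. lfun i k - lfun m k)"

lemma lagrange_denom_simps:
  "lagrange_denom k 1 = (lfun 1 k - lfun 2 k) * (lfun 1 k - lfun 3 k)"
  "lagrange_denom k 2 = (lfun 2 k - lfun 1 k) * (lfun 2 k - lfun 3 k)"
  "lagrange_denom k 3 = (lfun 3 k - lfun 1 k) * (lfun 3 k - lfun 2 k)"
proof -
  have "UNIV - {1::3} = {2,3}" "UNIV - {2::3} = {1,3}" "UNIV - {3::3} = {1,2}"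
    using UNIV_3 by auto
  then show "lagrange_denom k 1 = (lfun 1 k - lfun 2 k) * (lfun 1 k - lfun 3 k)"
  "lagrange_denom k 2 = (lfun 2 k - lfun 1 k) * (lfun 2 k - lfun 3 k)"
  "lagrange_denom k 3 = (lfun 3 k - lfun 1 k) * (lfun 3 k - lfun 2 k)"
    unfolding lagrange_denom_def by simp_all
qed

lemma Umat_entry:
  assumes "inj (\<lambda>i. lfun i k)"
  shows "Umat u0 u1 x k $ i $ m = 1 / lagrange_denom k i *
    (- of_real (deriv u0 x) / 4 - \<i> * of_real (v0 u1 x) / (4 * of_real (sqrt 3)) - of_real (u0 x) / 2 * lfun m k)"
proof -
  define a b c where abc: "a = lfun 1 k" "b = lfun 2 k" "c = lfun 3 k"
  have ne: "a \<noteq> b" "a \<noteq> c" "b \<noteq> c" "b \<noteq> a" "c \<noteq> a" "c \<noteq> b"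
    using injD[OF assms] distinct_index3 unfolding abc by blast+
  define Q :: "complex^3^3" where "Q = vector [
     vector [b * c / ((a - b) * (a - c)), - (b + c) / ((a - b) * (a - c)), 1 / ((a - b) * (a - c))],
     vector [a * c / ((b - a) * (b - c)), - (a + c) / ((b - a) * (b - c)), 1 / ((b - a) * (b - c))],
     vector [a * b / ((c - a) * (c - b)), - (a + b) / ((c - a) * (c - b)), 1 / ((c - a) * (c - b))]]"
  have Q3: "Q $ i $ 3 = 1 / lagrange_denom k i" for i
    using exhaust_3[of i] by (auto simp: Q_def lagrange_denom_simps abc[symmetric])
  have "Q ** Pmat k = mat 1"
    unfolding Finite_Cartesian_Product.vec_eq_iff forall_3 matrix_matrix_mult_def Pmat_def Finite_Cartesian_Product.mat_def Q_def sum_3 abc[symmetric]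
    using ne by (auto simp: add_divide_distrib[symmetric] diff_divide_distrib[symmetric])
       (simp_all add: field_simps power2_eq_square)
  then have inv: "matrix_inv (Pmat k) = Q" by (rule matrix_inv_eqI)
  have P: "Pmat k $ 1 $ m = 1" "Pmat k $ 2 $ m = lfun m k"
    using exhaust_3[of m] by (auto simp: Pmat_def)
  define A B where AB: "A = - of_real (deriv u0 x) / 4 - \<i> * of_real (v0 u1 x) / (4 * of_real (sqrt 3))" "B = - complex_of_real (u0 x) / 2"
  have "Umat u0 u1 x k $ i $ m = 1 / lagrange_denom k i * A + 1 / lagrange_denom k i * B * lfun m k"
    unfolding Umat_def inv AB[symmetric] by (simp add: matrix_matrix_mult_def sum_3 Q3 P)
  also have "\<dots> = 1 / lagrange_denom k i * (A + B * lfun m k)" by (simp add: distrib_left)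
  finally show ?thesis unfolding AB by simp
qed

section \<open>The reflection coefficients on the unit circle\<close>

lemma omega_cis: "\<omega> = cis (2 * pi / 3)"
  by (simp add: \<omega>_def cis_conv_exp mult_ac)

lemma omega_complex: "\<omega> = Complex (- 1 / 2) (sqrt 3 / 2)"
  by (simp add: omega_cis complex_eq_iff cos_120 sin_120)

lemma omega_facts: "\<omega> ^ 3 = 1" "norm \<omega> = 1" "\<omega> \<noteq> 0" "cnj \<omega> = \<omega>\<^sup>2" "\<omega>\<^sup>2 = Complex (- 1 / 2) (- sqrt 3 / 2)"
proof -
  show n: "norm \<omega> = 1" by (simp add: omega_cis)
  then show "\<omega> \<noteq> 0" by auto
  show "\<omega>\<^sup>2 = Complex (- 1 / 2) (- sqrt 3 / 2)"
    by (simp add: omega_complex power2_eq_square complex_eq_iff)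
  then show "cnj \<omega> = \<omega>\<^sup>2" by (simp add: omega_complex complex_eq_iff)
  show "\<omega> ^ 3 = 1" unfolding omega_cis by (subst Complex.DeMoivre) simp
qed

lemma norm_rot: "norm (rot j k) = norm k"
  by (simp add: rot_def norm_mult norm_power omega_facts)

lemma lfun_circle:
  assumes "norm k = 1"
  shows "lfun j k = \<i> * of_real (Re (rot j k) / sqrt 3)"
proof -
  have "inverse (rot j k) = cnj (rot j k)"
    using complex_div_cnj[of 1 "rot j k"] assms by (simp add: norm_rot inverse_eq_divide)
  then show ?thesis unfolding lfun_def by (simp add: complex_add_cnj)
qed

text \<open>
  Multiplying each component by a factor that does not depend on the integration variable does not change
  the equation, provided that the factor is 1 where \<open>e\<close> does not vanish.
\<close>
lemma weighted_tail_equation: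
  fixes G b :: "real \<Rightarrow> complex^'n"
  assumes "\<And>i x. w i x \<noteq> 0" and "\<And>i x. w i x * e $ i = e $ i"
  shows "(\<forall>x i. set_integrable lborel {x..} (\<lambda>y. w i x * G y $ i) \<and>
            w i x * b x $ i = e $ i - (LBINT y:{x..}. w i x * G y $ i)) \<longleftrightarrow>
         (\<forall>x. set_integrable lborel {x..} G \<and> b x = e - (LBINT y:{x..}. G y))"
proof -
  have si: "set_integrable lborel {x..} (\<lambda>y. w i x * G y $ i) \<longleftrightarrow> set_integrable lborel {x..} (\<lambda>y. G y $ i)" for x i
    using assms(1)[of i x] by simp
  have "(\<forall>i. set_integrable lborel {x..} (\<lambda>y. w i x * G y $ i) \<and>
            w i x * b x $ i = e $ i - (LBINT y:{x..}. w i x * G y $ i)) \<longleftrightarrow>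
         (set_integrable lborel {x..} G \<and> b x = e - (LBINT y:{x..}. G y))" (is "?L \<longleftrightarrow> ?R") for x
  proof (cases "set_integrable lborel {x..} G")
    case True
    have "w i x * b x $ i = e $ i - (LBINT y:{x..}. w i x * G y $ i) \<longleftrightarrow> b x $ i = (e - (LBINT y:{x..}. G y)) $ i" for i
    proof -
      have "e $ i - (LBINT y:{x..}. w i x * G y $ i) = w i x * ((e - (LBINT y:{x..}. G y)) $ i)"
        by (simp add: set_integral_vec_nth[OF True] right_diff_distrib assms(2))
      then show ?thesis using assms(1)[of i x] by simp
    qed
    then show ?thesis using True unfolding si by (auto simp: set_integrable_vec_iff Finite_Cartesian_Product.vec_eq_iff)
  next
    case False
    then show ?thesis unfolding si by (auto simp: set_integrable_vec_iff)
  qed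
  then show ?thesis by blast
qed

locale scattering_circle = imaginary_lax "\<lambda>i. lfun i k" h u0 "deriv u0" "v0 u1" K
  for k :: complex and h :: "3 \<Rightarrow> complex" and u0 u1 :: "real \<Rightarrow> real" and K :: real +
  assumes U: "Umat u0 u1 x k $ i $ m = 1 / h i * q m x"
begin

lemma X_col_iff:
  "is_X_col u0 u1 k j (\<lambda>x. \<chi> i. exp (of_real x * (lfun i k - lfun j k)) * b x $ i) \<longleftrightarrow>
   linear_volterra.sol (AX j) (axis j 1) b"
proof -
  interpret X: linear_volterra "AX j" W by (rule volterra_X)
  define w where "w i x = exp (of_real x * (lfun i k - lfun j k))" for i x
  have int: "exp (of_real (x - y) * (lfun i k - lfun j k)) * (Umat u0 u1 y k *v (\<chi> i. w i y * b y $ i)) $ i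
      = w i x * AX j y (b y) $ i" for x y i
  proof -
    have "exp (of_real (x - y) * (lfun i k - lfun j k)) = w i x * exp (- of_real y * (lfun i k - lfun j k))"
      unfolding w_def by (simp add: exp_add[symmetric] algebra_simps)
    moreover have "(Umat u0 u1 y k *v (\<chi> i. w i y * b y $ i)) $ i = (\<Sum>m\<in>UNIV. 1 / h i * q m y * (w m y * b y $ m))"
      by (simp add: matrix_vector_mult_def U)
    ultimately show ?thesis unfolding AX_def w_def by simp
  qed
  have "is_X_col u0 u1 k j (\<lambda>x. \<chi> i. w i x * b x $ i) \<longleftrightarrow>
    (\<forall>x i. set_integrable lborel {x..} (\<lambda>y. w i x * AX j y (b y) $ i) \<and>
            w i x * b x $ i = axis j 1 $ i - (LBINT y:{x..}. w i x * AX j y (b y) $ i))"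
    unfolding is_X_col_def int by (simp add: axis_def)
  also have "\<dots> \<longleftrightarrow> (\<forall>x. set_integrable lborel {x..} (\<lambda>y. AX j y (b y)) \<and> b x = axis j 1 - (LBINT y:{x..}. AX j y (b y)))"
    by (rule weighted_tail_equation) (auto simp: w_def axis_def)
  finally show ?thesis unfolding w_def X.sol_def .
qed

lemma XA_col_iff:
  "is_XA_col u0 u1 k j (\<lambda>x. \<chi> i. exp (- of_real x * (lfun i k - lfun j k)) * b x $ i) \<longleftrightarrow>
   linear_volterra.sol (AXA j) (axis j 1) b"
proof -
  interpret XA: linear_volterra "AXA j" W by (rule volterra_XA)
  define w where "w i x = exp (- of_real x * (lfun i k - lfun j k))" for i x
  have int: "exp (- of_real (x - y) * (lfun i k - lfun j k)) * (UTmat u0 u1 y k *v (\<chi> i. w i y * b y $ i)) $ i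
      = - (w i x * AXA j y (b y) $ i)" for x y i
  proof -
    have "exp (- of_real (x - y) * (lfun i k - lfun j k)) = w i x * exp (of_real y * (lfun i k - lfun j k))"
      unfolding w_def by (simp add: exp_add[symmetric] algebra_simps)
    moreover have "(UTmat u0 u1 y k *v (\<chi> i. w i y * b y $ i)) $ i = (\<Sum>m\<in>UNIV. 1 / h m * q i y * (w m y * b y $ m))"
      by (simp add: UTmat_def matrix_vector_mult_def Finite_Cartesian_Product.transpose_def U)
    ultimately show ?thesis unfolding AXA_def w_def by simp
  qed
  have "is_XA_col u0 u1 k j (\<lambda>x. \<chi> i. w i x * b x $ i) \<longleftrightarrow>
    (\<forall>x i. set_integrable lborel {x..} (\<lambda>y. w i x * AXA j y (b y) $ i) \<and>
            w i x * b x $ i = axis j 1 $ i - (LBINT y:{x..}. w i x * AXA j y (b y) $ i))"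
  proof -
    have "set_integrable lborel {x..} (\<lambda>y. - f y) = set_integrable lborel {x..} f"
      "(LBINT y:{x..}. - f y) = - (LBINT y:{x..}. f y)" for f :: "real \<Rightarrow> complex" and x
      by (simp_all add: set_integrable_def set_lebesgue_integral_def)
    then show ?thesis
      unfolding is_XA_col_def int by (simp only: axis_def vec_lambda_beta add_uminus_conv_diff)
  qed
  also have "\<dots> \<longleftrightarrow> (\<forall>x. set_integrable lborel {x..} (\<lambda>y. AXA j y (b y)) \<and> b x = axis j 1 - (LBINT y:{x..}. AXA j y (b y)))"
    by (rule weighted_tail_equation) (auto simp: w_def axis_def)
  finally show ?thesis unfolding w_def XA.sol_def .
qed

lemma jostX_eq:
  assumes b: "linear_volterra.sol (AX j) (axis j 1) b"
  shows "jostX u0 u1 x k $ i $ j = exp (of_real x * (lfun i k - lfun j k)) * b x $ i"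
proof -
  interpret X: linear_volterra "AX j" W by (rule volterra_X)
  let ?f = "\<lambda>x. \<chi> i. exp (of_real x * (lfun i k - lfun j k)) * b x $ i"
  have "(THE f. is_X_col u0 u1 k j f) = ?f"
  proof (rule the_equality)
    show "is_X_col u0 u1 k j ?f" unfolding X_col_iff by (rule b)
    fix f assume f: "is_X_col u0 u1 k j f"
    define c where "c x = (\<chi> i. exp (- of_real x * (lfun i k - lfun j k)) * f x $ i)" for x
    have fc: "f = (\<lambda>x. \<chi> i. exp (of_real x * (lfun i k - lfun j k)) * c x $ i)"
      by (rule ext) (simp add: c_def Finite_Cartesian_Product.vec_eq_iff exp_minus)
    then have "X.sol (axis j 1) c" using f X_col_iff[of j c] by simp
    then have "c = b" using X.sol_unique b by blast
    then show "f = ?f" using fc by simp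
  qed
  then show ?thesis unfolding jostX_def by simp
qed

lemma jostXA_eq:
  assumes b: "linear_volterra.sol (AXA j) (axis j 1) b"
  shows "jostXA u0 u1 x k $ i $ j = exp (- of_real x * (lfun i k - lfun j k)) * b x $ i"
proof -
  interpret XA: linear_volterra "AXA j" W by (rule volterra_XA)
  let ?f = "\<lambda>x. \<chi> i. exp (- of_real x * (lfun i k - lfun j k)) * b x $ i"
  have "(THE f. is_XA_col u0 u1 k j f) = ?f"
  proof (rule the_equality)
    show "is_XA_col u0 u1 k j ?f" unfolding XA_col_iff by (rule b)
    fix f assume f: "is_XA_col u0 u1 k j f"
    define c where "c x = (\<chi> i. exp (of_real x * (lfun i k - lfun j k)) * f x $ i)" for x
    have fc: "f = (\<lambda>x. \<chi> i. exp (- of_real x * (lfun i k - lfun j k)) * c x $ i)"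
      by (rule ext) (simp add: c_def Finite_Cartesian_Product.vec_eq_iff exp_minus)
    then have "XA.sol (axis j 1) c" using f XA_col_iff[of j c] by simp
    then have "c = b" using XA.sol_unique b by blast
    then show "f = ?f" using fc by simp
  qed
  then show ?thesis unfolding jostXA_def by simp
qed

text \<open>
  The unitarity relation for the scattering matrix on the unit circle.
\<close>
theorem smatA_eq: "smatA u0 u1 i j k = h i * cnj (smat u0 u1 i j k) / h j"
proof -
  interpret X: linear_volterra "AX j" W by (rule volterra_X)
  obtain b where b: "X.sol (axis j 1) b" using X.sol_exists by blast
  have int: "exp (- of_real x * (lfun i k - lfun j k)) * (Umat u0 u1 x k ** jostX u0 u1 x k) $ i $ j = AX j x (b x) $ i" for x
    by (simp add: matrix_matrix_mult_def U jostX_eq[OF b] AX_def)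
  have intA: "exp (of_real x * (lfun i k - lfun j k)) * (UTmat u0 u1 x k ** jostXA u0 u1 x k) $ i $ j = - AXA j x (conj_dual j b x) $ i" for x
    by (simp add: matrix_matrix_mult_def UTmat_def Finite_Cartesian_Product.transpose_def U jostXA_eq[OF dual_solution[OF b]] AXA_def)
  have ax: "(if i = j then 1 else 0) = (axis j 1 :: complex^3) $ i" by (simp add: axis_def)
  show ?thesis unfolding smat_def smatA_def int intA ax
    using scattering_duality[OF b, of i] by simp
qed

end

lemma scattering_circleI:
  assumes "norm k = 1" "inj (\<lambda>i. lfun i k)" "schwartz u0" "schwartz u1" "(LBINT y. u1 y) = 0"
  shows "\<exists>K. scattering_circle k (lagrange_denom k) u0 u1 K"
proof -
  have im: "cnj (lfun i k) = - lfun i k" for i by (simp add: lfun_circle[OF assms(1)])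
  obtain C where C: "C \<ge> 0" "\<And>x. \<bar>u0 x\<bar> \<le> C / (1 + x\<^sup>2)\<^sup>2" using schwartz_decay[OF assms(3)] by blast
  have C1: "\<bar>u0 x\<bar> \<le> C / (1 + x\<^sup>2)" "\<bar>u0 x\<bar> \<le> C" for x
    using C(2)[of x] decay_weaken[OF C(1), of x] by linarith+
  have ne: "lfun i k \<noteq> lfun j k" if "i \<noteq> j" for i j using injD[OF assms(2)] that by blast
  have "imaginary_lax (\<lambda>i. lfun i k) (lagrange_denom k) u0 (deriv u0) (v0 u1) C"
  proof
    show "cnj (lfun i k) = - lfun i k" for i by (rule im)
    show "lagrange_denom k i \<noteq> 0" for i using exhaust_3[of i] by (auto simp: lagrange_denom_simps ne)
    show "cnj (lagrange_denom k i) = lagrange_denom k i" for i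
      using exhaust_3[of i] by (auto simp: lagrange_denom_simps im) (simp_all add: algebra_simps)
    have a: "1 / ((a - b) * (a - c)) + 1 / ((b - a) * (b - c)) + 1 / ((c - a) * (c - b)) = 0"
      if "a \<noteq> b" "a \<noteq> c" "b \<noteq> c" for a b c :: complex
    proof -
      have "1 / ((b - a) * (b - c)) = - (1 / ((a - b) * (b - c)))" "1 / ((c - a) * (c - b)) = 1 / ((a - c) * (b - c))"
        using that by (simp_all add: divide_simps) (simp add: algebra_simps)
      then show ?thesis using that by (simp add: divide_simps) (simp add: algebra_simps)
    qed
    show "(\<Sum>i\<in>UNIV. 1 / lagrange_denom k i) = 0"
      unfolding sum_3 lagrange_denom_simps by (rule a) (auto simp: ne)
    show "\<bar>u0 x\<bar> \<le> C" for x by (rule C1)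
  qed (use schwartzD[OF assms(3)] schwartz_integrable[OF assms(3)] v0_continuous_integrable[OF assms(4,5)] decay_tendsto_0[OF C1(1)] in auto)
  then have "scattering_circle k (lagrange_denom k) u0 u1 C"
    unfolding scattering_circle_def scattering_circle_axioms_def
    by (simp add: imaginary_lax.q_def[OF \<open>imaginary_lax _ _ _ _ _ _\<close>] Umat_entry[OF assms(2)])
  then show ?thesis by blast
qed

text \<open>
  On the arc from \<open>i\<close> to \<open>\<omega>\<close> the three exponents are ordered, hence distinct.  The order also fixes the sign of the
  ratio of the form coefficients \<open>h\<^sub>1 / h\<^sub>2\<close>.
\<close>
lemma arc_order:
  assumes "pi / 2 \<le> \<phi>" "\<phi> < 2 * pi / 3"
  shows "Re (rot 1 (cis \<phi>)) < Re (rot 3 (cis \<phi>))" "Re (rot 3 (cis \<phi>)) < Re (rot 2 (cis \<phi>))"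
proof -
  have c: "cos \<phi> \<le> 0" using cos_monotone_0_pi_le[of "pi / 2" \<phi>] assms pi_gt_zero by simp
  have c2: "- 1 / 2 < cos \<phi>" using cos_monotone_0_pi[of \<phi> "2 * pi / 3"] assms pi_gt_zero by (simp add: cos_120)
  have s: "0 < sin \<phi>" using assms pi_gt_zero by (intro sin_gt_zero) linarith+
  have "(cos \<phi>)\<^sup>2 < 1 / 4"
    using c c2 abs_square_less_1[of "2 * cos \<phi>"] by (simp add: power_mult_distrib)
  then have "(sqrt 3 * - cos \<phi>)\<^sup>2 < (sin \<phi>)\<^sup>2" using sin_squared_eq[of \<phi>] by (simp add: power_mult_distrib)
  then have "sqrt 3 * - cos \<phi> < sin \<phi>" using s by (rule_tac power2_less_imp_less) auto
  then have "sqrt 3 * (sqrt 3 * - cos \<phi>) < sqrt 3 * sin \<phi>" by (intro mult_strict_left_mono) auto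
  moreover have "sqrt 3 * (sqrt 3 * - cos \<phi>) = - 3 * cos \<phi>" by (simp add: mult.assoc[symmetric])
  ultimately have *: "- 3 * cos \<phi> < sqrt 3 * sin \<phi>" by (simp only:)
  have "0 < sqrt 3 * sin \<phi>" using s by simp
  then show "Re (rot 1 (cis \<phi>)) < Re (rot 3 (cis \<phi>))" "Re (rot 3 (cis \<phi>)) < Re (rot 2 (cis \<phi>))"
    using * c by (simp_all add: rot_simps omega_facts) (simp_all add: omega_complex)
qed

text \<open>
  By the unitarity relation \<open>r\<^sub>2\<close> is \<open>h\<^sub>1 / h\<^sub>2\<close> times the conjugate of \<open>r\<^sub>1\<close>, and this ratio is positive on the arc.
\<close>
lemma reflection_product_nonneg:
  assumes "schwartz u0" "schwartz u1" "(LBINT y. u1 y) = 0"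
    and "pi / 2 \<le> \<phi>" "\<phi> < 2 * pi / 3"
  shows "r1 u0 u1 (cis \<phi>) * r2 u0 u1 (cis \<phi>) \<in> \<real>\<^sub>\<ge>\<^sub>0"
proof -
  define k where "k = cis \<phi>"
  have n: "norm k = 1" by (simp add: k_def)
  define c where "c j = Re (rot j k) / sqrt 3" for j
  have l: "lfun j k = \<i> * of_real (c j)" for j using lfun_circle[OF n] by (simp add: c_def)
  have c: "c 1 < c 3" "c 3 < c 2" using arc_order[OF assms(4,5)] by (auto simp: c_def k_def divide_strict_right_mono)
  have "inj (\<lambda>i. lfun i k)"
  proof (rule injI)
    fix i j :: 3 assume "lfun i k = lfun j k"
    then have "c i = c j" by (simp add: l)
    then show "i = j" using c exhaust_3[of i] exhaust_3[of j] by auto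
  qed
  then obtain K where "scattering_circle k (lagrange_denom k) u0 u1 K"
    using scattering_circleI[OF n _ assms(1-3)] by blast
  then interpret scattering_circle k "lagrange_denom k" u0 u1 K .
  define d where "d = (c 3 - c 1) / (c 2 - c 3)"
  have d: "d \<ge> 0" using c by (simp add: d_def)
  have hh: "lagrange_denom k 1 / lagrange_denom k 2 = of_real d"
  proof -
    have "lagrange_denom k 1 = of_real (- ((c 1 - c 2) * (c 1 - c 3)))" "lagrange_denom k 2 = of_real (- ((c 2 - c 1) * (c 2 - c 3)))"
      unfolding lagrange_denom_simps l by (simp_all add: complex_eq_iff algebra_simps)
    then show ?thesis using c unfolding d_def of_real_divide[symmetric] of_real_eq_iff
      by (simp only: of_real_divide[symmetric] of_real_eq_iff) (simp add: divide_simps, simp add: algebra_simps)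
  qed
  have "r2 u0 u1 k = lagrange_denom k 1 / lagrange_denom k 2 * cnj (r1 u0 u1 k)"
    unfolding r1_def r2_def smatA_eq using h_nz[of 1] by simp
  then have "r1 u0 u1 k * r2 u0 u1 k = of_real d * (r1 u0 u1 k * cnj (r1 u0 u1 k))"
    unfolding hh by simp
  also have "\<dots> = of_real (d * (norm (r1 u0 u1 k))\<^sup>2)" by (simp only: complex_norm_square[symmetric] of_real_mult of_real_power)
  finally show ?thesis unfolding k_def[symmetric] using d by simp
qed

section \<open>Conjugation symmetry of the Delta functions\<close>

text \<open>
  The point \<open>k\<^sub>1\<close> lies on the unit circle, and \<open>\<zeta> > 1\<close> is exactly the condition that its real part exceeds -1/2.
\<close>
lemma k1_point_Arg:
  assumes "\<zeta> > 1"
  shows "pi / 2 < Arg (k1_point \<zeta>)" "Arg (k1_point \<zeta>) < 2 * pi / 3"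
proof -
  define q where "q = sqrt (8 + \<zeta>\<^sup>2)"
  have q2: "q\<^sup>2 = 8 + \<zeta>\<^sup>2" unfolding q_def by (simp add: add_nonneg_nonneg)
  have q0: "q \<ge> 0" unfolding q_def by simp
  have q1: "\<zeta> < q" by (rule power2_less_imp_less[OF _ q0]) (simp add: q2)
  have "q\<^sup>2 < (\<zeta> + 2)\<^sup>2" unfolding q2 using assms by (simp add: power2_eq_square algebra_simps)
  then have q3: "q < \<zeta> + 2" by (rule power2_less_imp_less) (use assms in simp)
  define y2 where "y2 = 4 - \<zeta>\<^sup>2 + \<zeta> * q"
  have "\<zeta> * \<zeta> \<le> \<zeta> * q" using q1 assms by (intro mult_left_mono) auto
  then have y2: "y2 > 0" unfolding y2_def by (simp add: power2_eq_square)
  have re: "Re (k1_point \<zeta>) = (\<zeta> - q) / 4" and im: "Im (k1_point \<zeta>) = sqrt 2 * sqrt y2 / 4"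
    unfolding k1_point_def q_def y2_def by simp_all
  have impos: "Im (k1_point \<zeta>) > 0" unfolding im using y2 by simp
  have "(norm (k1_point \<zeta>))\<^sup>2 = ((\<zeta> - q)\<^sup>2 + 2 * y2) / 16"
    unfolding cmod_power2 re im using y2 by (simp add: power_divide power_mult_distrib add_divide_distrib)
  also have "(\<zeta> - q)\<^sup>2 + 2 * y2 = 16"
    using q2 unfolding y2_def by (simp add: power2_eq_square algebra_simps)
  finally have "(norm (k1_point \<zeta>))\<^sup>2 = 1" by simp
  then have n: "norm (k1_point \<zeta>) = 1" unfolding abs_square_eq_1 by simp
  define A where "A = Arg (k1_point \<zeta>)"
  have A: "0 < A" "A < pi" using impos Arg_lt_pi[of "k1_point \<zeta>"] Arg_le_pi[of "k1_point \<zeta>"] unfolding A_def by auto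
  have "k1_point \<zeta> = cis A" using n rcis_cmod_Arg[of "k1_point \<zeta>"] unfolding A_def rcis_def by simp
  then have cosA: "cos A = (\<zeta> - q) / 4" using re by simp
  have "cos A < cos (pi / 2)" "cos (2 * pi / 3) < cos A" unfolding cosA cos_120 using q1 q3 by auto
  then show "pi / 2 < Arg (k1_point \<zeta>)" "Arg (k1_point \<zeta>) < 2 * pi / 3"
    unfolding A_def[symmetric]
    using A pi_gt_zero cos_mono_less_eq[of A "pi / 2"] cos_mono_less_eq[of "2 * pi / 3" A] by linarith+
qed

text \<open>
  A Lipschitz function is a difference of two increasing functions, and a product with an increasing function
  is integrable by the second mean value theorem.
\<close>
lemma integrable_mult_lipschitz_real:
  fixes f g :: "real \<Rightarrow> real"
  assumes f: "f integrable_on {a..b}" and "a \<le> b"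
    and lip: "\<And>x y. x \<in> {a..b} \<Longrightarrow> y \<in> {a..b} \<Longrightarrow> \<bar>g x - g y\<bar> \<le> L * \<bar>x - y\<bar>" and L: "L \<ge> 0"
  shows "(\<lambda>x. g x * f x) integrable_on {a..b}"
proof -
  have mono: "(\<lambda>x. h x * f x) integrable_on {a..b}" if "\<And>x y. a \<le> x \<Longrightarrow> x \<le> y \<Longrightarrow> y \<le> b \<Longrightarrow> h x \<le> h y" for h
    using second_mean_value_theorem_full[OF f \<open>a \<le> b\<close>, of h] that by (metis integrable_on_def)
  have "(\<lambda>x. (g x + L * x) * f x) integrable_on {a..b}"
  proof (rule mono)
    fix x y assume "a \<le> x" "x \<le> y" "y \<le> b"
    then show "g x + L * x \<le> g y + L * y" using lip[of x y] by (simp add: algebra_simps abs_le_iff)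
  qed
  moreover have "(\<lambda>x. (L * x) * f x) integrable_on {a..b}"
    using L by (intro mono) (auto intro: mult_left_mono)
  ultimately have "(\<lambda>x. (g x + L * x) * f x - (L * x) * f x) integrable_on {a..b}" by (rule integrable_diff)
  then show ?thesis by (simp add: algebra_simps)
qed

lemma integrable_complex_iff:
  fixes f :: "real \<Rightarrow> complex"
  shows "f integrable_on S \<longleftrightarrow> (\<lambda>x. Re (f x)) integrable_on S \<and> (\<lambda>x. Im (f x)) integrable_on S"
proof
  assume f: "f integrable_on S"
  then show "(\<lambda>x. Re (f x)) integrable_on S \<and> (\<lambda>x. Im (f x)) integrable_on S"
    using integrable_linear[OF f bounded_linear_Re] integrable_linear[OF f bounded_linear_Im] by (simp add: o_def)
next
  assume *: "(\<lambda>x. Re (f x)) integrable_on S \<and> (\<lambda>x. Im (f x)) integrable_on S"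
  have "((\<lambda>y. complex_of_real y) \<circ> (\<lambda>x. Re (f x))) integrable_on S"
    by (rule integrable_linear[OF _ bounded_linear_of_real]) (use * in simp)
  moreover have "((\<lambda>y. \<i> * complex_of_real y) \<circ> (\<lambda>x. Im (f x))) integrable_on S"
    by (rule integrable_linear[OF _ bounded_linear_compose[OF bounded_linear_mult_right bounded_linear_of_real]]) (use * in simp)
  ultimately have "(\<lambda>x. of_real (Re (f x)) + \<i> * of_real (Im (f x))) integrable_on S"
    unfolding o_def by (rule integrable_add)
  then show "f integrable_on S" by (simp only: complex_eq[symmetric])
qed

lemma integrable_mult_C1:
  fixes f g :: "real \<Rightarrow> complex"
  assumes f: "f integrable_on {a..b}" and "a \<le> b"
    and g: "\<And>x. x \<in> {a..b} \<Longrightarrow> (g has_vector_derivative g' x) (at x within {a..b})" and g': "continuous_on {a..b} g'"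
  shows "(\<lambda>x. g x * f x) integrable_on {a..b}"
proof -
  have "bounded (g' ` {a..b})" by (intro compact_imp_bounded compact_continuous_image g') simp
  then obtain L where L: "\<forall>z\<in>g' ` {a..b}. norm z \<le> L" unfolding bounded_iff by blast
  have L0: "L \<ge> 0" using L \<open>a \<le> b\<close> by (meson atLeastAtMost_iff image_eqI norm_ge_zero order_refl order_trans)
  have lip: "norm (g x - g y) \<le> L * \<bar>x - y\<bar>" if "x \<in> {a..b}" "y \<in> {a..b}" for x y
  proof -
    have "norm (g x - g y) \<le> L * norm (x - y)"
    proof (rule differentiable_bound[of "{a..b}" g "\<lambda>x h. h *\<^sub>R g' x" L])
      show "(g has_derivative (\<lambda>h. h *\<^sub>R g' x)) (at x within {a..b})" if "x \<in> {a..b}" for x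
        using g[OF that] by (simp add: has_vector_derivative_def)
      show "onorm (\<lambda>h. h *\<^sub>R g' x) \<le> L" if "x \<in> {a..b}" for x
      proof (rule onorm_le)
        have "norm (g' x) \<le> L" using L that by blast
        then show "norm (h *\<^sub>R g' x) \<le> L * norm h" for h :: real
          unfolding norm_scaleR real_norm_def mult.commute[of L] by (intro mult_left_mono) auto
      qed
    qed (use that in auto)
    then show ?thesis by simp
  qed
  have re: "\<bar>Re (g x) - Re (g y)\<bar> \<le> L * \<bar>x - y\<bar>" "\<bar>Im (g x) - Im (g y)\<bar> \<le> L * \<bar>x - y\<bar>"
    if "x \<in> {a..b}" "y \<in> {a..b}" for x y
    using lip[OF that] abs_Re_le_cmod[of "g x - g y"] abs_Im_le_cmod[of "g x - g y"] by auto
  have fr: "(\<lambda>x. Re (f x)) integrable_on {a..b}" "(\<lambda>x. Im (f x)) integrable_on {a..b}"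
    using f integrable_complex_iff[of f] by auto
  note m = integrable_mult_lipschitz_real[OF _ \<open>a \<le> b\<close> _ L0]
  have "(\<lambda>x. Re (g x) * Re (f x) - Im (g x) * Im (f x)) integrable_on {a..b}"
    by (intro integrable_diff m fr re)
  moreover have "(\<lambda>x. Re (g x) * Im (f x) + Im (g x) * Re (f x)) integrable_on {a..b}"
    by (intro integrable_add m fr re)
  ultimately show ?thesis unfolding integrable_complex_iff by simp
qed


text \<open>
  On the unit circle \<open>cnj s = 1 / s\<close>, which carries the Cauchy kernel at \<open>k\<close> to the kernel at the reflected
  point \<open>1 / cnj k\<close> up to a constant.  The density \<open>G\<close> may fail to be integrable.  As the kernels are smooth and have no zeros,
  integrability then fails for all \<open>k\<close> simultaneously, and all contour integrals take their default value 0.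
\<close>
lemma cauchy_arc_cnj:
  fixes G :: "complex \<Rightarrow> complex"
  assumes ab: "a < b" and real: "\<And>t. t \<in> {a..b} \<Longrightarrow> cnj (G (cis t)) = G (cis t)"
  shows "\<exists>c. \<forall>k. k \<noteq> 0 \<and> norm k \<noteq> 1 \<longrightarrow>
     cnj (contour_integral (part_circlepath 0 1 a b) (\<lambda>p. G p / (p - k))) =
     contour_integral (part_circlepath 0 1 a b) (\<lambda>p. G p / (p - 1 / cnj k)) - \<i> * c"
proof -
  let ?\<gamma> = "part_circlepath 0 1 a b"
  define F where "F k t = G (cis t) / (cis t - k) * (\<i> * cis t)" for k t
  have hci: "((\<lambda>p. G p / (p - k)) has_contour_integral I) ?\<gamma> \<longleftrightarrow> (F k has_integral I) {a..b}" for k I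
    unfolding has_contour_integral_part_circlepath_iff[OF ab] F_def by (simp add: mult_ac)
  have ne: "cis t - k \<noteq> 0" if "norm k \<noteq> 1" for t k using that by auto
  have iff: "F k integrable_on {a..b} \<longleftrightarrow> (\<lambda>t. G (cis t)) integrable_on {a..b}" if k: "norm k \<noteq> 1" for k
  proof
    assume i: "F k integrable_on {a..b}"
    have "(\<lambda>t. (- \<i> * (1 - k * cis (- t))) * F k t) integrable_on {a..b}"
    proof (rule integrable_mult_C1[OF i])
      show "((\<lambda>t. - \<i> * (1 - k * cis (- t))) has_vector_derivative - \<i> * (0 - k * (- \<i> * cis (- t)))) (at t within {a..b})" for t
        unfolding cis_conv_exp of_real_minus
        by (rule has_vector_derivative_at_within, rule has_vector_derivative_real_field)
           (auto intro!: derivative_eq_intros)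
    qed (use ab in \<open>auto intro!: continuous_intros\<close>)
    moreover have "(- \<i> * (1 - k * cis (- t))) * F k t = G (cis t)" for t
    proof -
      have "cis (- t) * cis t = 1" by (simp add: cis_mult)
      then have "(1 - k * cis (- t)) * cis t = cis t - k" by (simp add: left_diff_distrib mult.assoc)
      then have "(- \<i> * (1 - k * cis (- t))) * F k t = (- \<i> * \<i>) * (G (cis t) / (cis t - k)) * (cis t - k)"
        unfolding F_def by (metis (no_types, opaque_lifting) mult.assoc mult.left_commute)
      then show ?thesis using ne[OF k] by simp
    qed
    ultimately show "(\<lambda>t. G (cis t)) integrable_on {a..b}" by simp
  next
    assume i: "(\<lambda>t. G (cis t)) integrable_on {a..b}"
    have "(\<lambda>t. (\<i> * cis t / (cis t - k)) * G (cis t)) integrable_on {a..b}"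
    proof (rule integrable_mult_C1[OF i])
      show "((\<lambda>t. \<i> * cis t / (cis t - k)) has_vector_derivative
          ((\<i> * (\<i> * cis t)) * (cis t - k) - (\<i> * cis t) * (\<i> * cis t - 0)) / ((cis t - k) * (cis t - k))) (at t within {a..b})" for t
      proof -
        have e: "((\<lambda>z. exp (\<i> * z)) has_field_derivative \<i> * exp (\<i> * z)) (at z)" for z
          by (auto intro!: derivative_eq_intros)
        have n0: "exp (\<i> * of_real t) - k \<noteq> 0" using ne[OF k, of t] unfolding cis_conv_exp .
        show ?thesis unfolding cis_conv_exp
          by (rule has_vector_derivative_at_within, rule has_vector_derivative_real_field,
              intro DERIV_divide DERIV_cmult DERIV_diff e DERIV_const n0)
      qed
      show "continuous_on {a..b} (\<lambda>t. ((\<i> * (\<i> * cis t)) * (cis t - k) - (\<i> * cis t) * (\<i> * cis t - 0)) / ((cis t - k) * (cis t - k)))"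
        by (intro continuous_intros) (use ne[OF k] in simp)
    qed (use ab in simp)
    then show "F k integrable_on {a..b}" unfolding F_def by (simp add: mult_ac)
  qed
  show ?thesis
  proof (cases "(\<lambda>t. G (cis t)) integrable_on {a..b}")
    case False
    have "contour_integral ?\<gamma> (\<lambda>p. G p / (p - k)) = 0" if "norm k \<noteq> 1" for k
    proof (rule not_integrable_contour_integral)
      have "\<not> F k integrable_on {a..b}" using False iff[OF that] by blast
      then show "\<not> (\<lambda>p. G p / (p - k)) contour_integrable_on ?\<gamma>"
        unfolding contour_integrable_on_def hci integrable_on_def .
    qed
    then show ?thesis by (intro exI[of _ 0]) (auto simp: norm_divide)
  next
    case True
    define c where "c = integral {a..b} (\<lambda>t. G (cis t))"
    have c: "((\<lambda>t. G (cis t)) has_integral c) {a..b}" unfolding c_def using True by (rule integrable_integral)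
    have I: "(F k has_integral contour_integral ?\<gamma> (\<lambda>p. G p / (p - k))) {a..b}" if k: "norm k \<noteq> 1" for k
    proof -
      obtain I where I: "(F k has_integral I) {a..b}" using True iff[OF k] by blast
      then have "((\<lambda>p. G p / (p - k)) has_contour_integral I) ?\<gamma>" using hci by blast
      then have "contour_integral ?\<gamma> (\<lambda>p. G p / (p - k)) = I" by (rule contour_integral_unique)
      then show ?thesis using I by simp
    qed
    \<comment> \<open>the constant comes from \<open>a / (s - a) = s / (s - a) - 1\<close> with \<open>a = 1 / cnj k\<close>\<close>
    have "cnj (contour_integral ?\<gamma> (\<lambda>p. G p / (p - k))) = contour_integral ?\<gamma> (\<lambda>p. G p / (p - 1 / cnj k)) - \<i> * c"
      if k: "k \<noteq> 0" "norm k \<noteq> 1" for k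
    proof -
      have k': "norm (1 / cnj k) \<noteq> 1" using k by (auto simp: norm_divide)
      have "((\<lambda>t. cnj (F k t)) has_integral cnj (contour_integral ?\<gamma> (\<lambda>p. G p / (p - k)))) {a..b}"
        using has_integral_linear[OF I[OF k(2)] bounded_linear_cnj] by (simp add: o_def)
      moreover have "((\<lambda>t. F (1 / cnj k) t - \<i> * G (cis t)) has_integral contour_integral ?\<gamma> (\<lambda>p. G p / (p - 1 / cnj k)) - \<i> * c) {a..b}"
        by (intro has_integral_diff I[OF k'] has_integral_mult_right c)
      moreover have "cnj (F k t) = F (1 / cnj k) t - \<i> * G (cis t)" if t: "t \<in> {a..b}" for t
      proof -
        define s where "s = cis t"
        have s: "s \<noteq> 0" "cnj s = 1 / s" unfolding s_def by (simp_all add: cis_cnj inverse_eq_divide[symmetric] cis_inverse)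
        have n1: "s - 1 / cnj k \<noteq> 0" using ne[OF k'] unfolding s_def .
        have "cnj (s - k) \<noteq> 0" using ne[OF k(2)] unfolding s_def by (simp only: complex_cnj_zero_iff not_False_eq_True)
        then have n2: "1 / s - cnj k \<noteq> 0" using s by simp
        have n3: "1 - cnj k * s \<noteq> 0"
        proof
          assume "1 - cnj k * s = 0"
          then have "1 / s - cnj k = 0" using s(1) by (simp add: field_simps)
          then show False using n2 by simp
        qed
        have "cnj (F k t) = G s * ((- \<i> / s) / (1 / s - cnj k))"
          unfolding F_def s_def[symmetric] using real[OF t] s by (simp add: s_def[symmetric])
        also have "(- \<i> / s) / (1 / s - cnj k) = - \<i> / (1 - cnj k * s)"
          using s n2 n3 by (simp add: divide_simps)
        also have "\<dots> = \<i> * s / (s - 1 / cnj k) - \<i>"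
          using k(1) n1 n3 by (simp add: divide_simps) (simp add: algebra_simps)
        finally show ?thesis unfolding F_def s_def[symmetric] by (simp add: algebra_simps)
      qed
      ultimately show ?thesis by (metis (no_types, lifting) has_integral_cong has_integral_unique)
    qed
    then show ?thesis by blast
  qed
qed

lemma delta_nonzero: "delta_fun u0 u1 \<zeta> k \<noteq> 0"
  by (simp add: delta_fun_def)

lemma Delta_hat33_nonzero: "Delta_hat33 u0 u1 \<zeta> k \<noteq> 0"
  by (simp add: Delta_hat33_def delta_nonzero)

context
  fixes u0 u1 :: "real \<Rightarrow> real" and \<zeta> :: real
  assumes s0: "schwartz u0" and s1: "schwartz u1" and z1: "(LBINT y. u1 y) = 0" and \<zeta>: "\<zeta> > 1"
begin

text \<open>
  The constant in the Cauchy integral becomes a factor \<open>E\<close>, which cancels from the quotients of \<open>\<delta>\<close>-functions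
  in \<open>Delta_hat33\<close>.
\<close>
lemma delta_cnj:
  "\<exists>E. E \<noteq> 0 \<and> (\<forall>k. k \<noteq> 0 \<and> norm k \<noteq> 1 \<longrightarrow> cnj (delta_fun u0 u1 \<zeta> k) = E / delta_fun u0 u1 \<zeta> (1 / cnj k))"
proof -
  define \<beta> where "\<beta> = Arg (k1_point \<zeta>)"
  have \<beta>: "pi / 2 < \<beta>" "\<beta> < 2 * pi / 3" using k1_point_Arg[OF \<zeta>] by (auto simp: \<beta>_def)
  define G where "G p = Ln (1 + r1 u0 u1 p * r2 u0 u1 p)" for p
  have "cnj (G (cis t)) = G (cis t)" if "t \<in> {pi / 2..\<beta>}" for t
  proof -
    have "r1 u0 u1 (cis t) * r2 u0 u1 (cis t) \<in> \<real>\<^sub>\<ge>\<^sub>0"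
      by (rule reflection_product_nonneg[OF s0 s1 z1]) (use that \<beta> in auto)
    then obtain r where r: "r \<ge> 0" "r1 u0 u1 (cis t) * r2 u0 u1 (cis t) = of_real r"
      by (auto simp: nonneg_Reals_def)
    then have "G (cis t) = Ln (of_real (1 + r))" by (simp add: G_def)
    also have "\<dots> = of_real (ln (1 + r))" using r by (subst Ln_of_real) auto
    finally show ?thesis by simp
  qed
  from cauchy_arc_cnj[OF \<beta>(1), of G, OF this] obtain c where c: "\<And>k. k \<noteq> 0 \<and> norm k \<noteq> 1 \<Longrightarrow>
     cnj (contour_integral (part_circlepath 0 1 (pi / 2) \<beta>) (\<lambda>p. G p / (p - k))) =
     contour_integral (part_circlepath 0 1 (pi / 2) \<beta>) (\<lambda>p. G p / (p - 1 / cnj k)) - \<i> * c" by blast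
  define I where "I k = contour_integral (part_circlepath 0 1 (pi / 2) \<beta>) (\<lambda>p. G p / (p - k))" for k
  have d: "delta_fun u0 u1 \<zeta> k = exp (- 1 / (2 * of_real pi * \<i>) * I k)" for k
    unfolding delta_fun_def I_def G_def \<beta>_def ..
  have "cnj (delta_fun u0 u1 \<zeta> k) = exp (- c / (2 * of_real pi)) / delta_fun u0 u1 \<zeta> (1 / cnj k)"
    if k: "k \<noteq> 0" "norm k \<noteq> 1" for k
  proof -
    have "cnj (delta_fun u0 u1 \<zeta> k) = exp (cnj (- 1 / (2 * of_real pi * \<i>)) * cnj (I k))"
      unfolding d by (simp add: exp_cnj)
    also have "\<dots> = exp (1 / (2 * of_real pi * \<i>) * (I (1 / cnj k) - \<i> * c))"
      using c[of k] k by (simp add: I_def)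
    also have "1 / (2 * of_real pi * \<i>) * (I (1 / cnj k) - \<i> * c) = - c / (2 * of_real pi) - (- 1 / (2 * of_real pi * \<i>) * I (1 / cnj k))"
      by (simp add: field_simps)
    finally show ?thesis unfolding d by (simp only: exp_diff)
  qed
  then show ?thesis by (intro exI[of _ "exp (- c / (2 * of_real pi))"]) auto
qed

lemma Delta_hat33_cnj:
  assumes k: "k \<noteq> 0" "norm k \<noteq> 1"
  shows "cnj (Delta_hat33 u0 u1 \<zeta> k) = 1 / Delta_hat33 u0 u1 \<zeta> (cnj k)"
proof -
  let ?d = "delta_fun u0 u1 \<zeta>"
  obtain E where E: "E \<noteq> 0" "\<And>k. k \<noteq> 0 \<Longrightarrow> norm k \<noteq> 1 \<Longrightarrow> cnj (?d k) = E / ?d (1 / cnj k)" using delta_cnj by blast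
  have w: "cnj \<omega> = \<omega>\<^sup>2" "cnj (\<omega>\<^sup>2) = \<omega>"
    by (rule omega_facts(4)) (simp only: omega_facts(4)[symmetric] complex_cnj_cnj)
  have n: "norm (\<omega> * k) \<noteq> 1" "norm (\<omega>\<^sup>2 * k) \<noteq> 1" "norm (1 / (\<omega>\<^sup>2 * k)) \<noteq> 1" "norm (1 / (\<omega> * k)) \<noteq> 1"
    "\<omega> * k \<noteq> 0" "\<omega>\<^sup>2 * k \<noteq> 0" "1 / (\<omega>\<^sup>2 * k) \<noteq> 0" "1 / (\<omega> * k) \<noteq> 0"
    using k omega_facts(2,3) by (auto simp: norm_mult norm_power norm_divide)
  have c: "cnj (?d (\<omega> * k)) = E / ?d (1 / (\<omega>\<^sup>2 * cnj k))" "cnj (?d (\<omega>\<^sup>2 * k)) = E / ?d (1 / (\<omega> * cnj k))"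
    "cnj (?d (1 / (\<omega>\<^sup>2 * k))) = E / ?d (\<omega> * cnj k)" "cnj (?d (1 / (\<omega> * k))) = E / ?d (\<omega>\<^sup>2 * cnj k)"
    using E(2)[OF n(5,1)] E(2)[OF n(6,2)] E(2)[OF n(7,3)] E(2)[OF n(8,4)]
    by (simp_all only: complex_cnj_mult complex_cnj_divide complex_cnj_one w) simp_all
  show ?thesis using E(1) delta_nonzero[of u0 u1 \<zeta>]
    unfolding Delta_hat33_def complex_cnj_mult[of "_ / _"] complex_cnj_divide c
    by (simp add: divide_simps)
qed

lemma Delta_ratio_cnj:
  assumes k: "k \<noteq> 0" "norm k \<noteq> 1"
  shows "cnj (Delta_hat11 u0 u1 \<zeta> k * inverse (Delta_hat33 u0 u1 \<zeta> k)) =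
     Delta_hat33 u0 u1 \<zeta> (cnj k) * inverse (Delta_hat22 u0 u1 \<zeta> (cnj k))"
proof -
  have n: "norm (\<omega> * k) \<noteq> 1" "\<omega> * k \<noteq> 0" using k omega_facts(2,3) by (auto simp: norm_mult)
  show ?thesis
    using Delta_hat33_cnj[OF k] Delta_hat33_cnj[OF n(2,1)] Delta_hat33_nonzero
    by (simp add: Delta_hat11_def Delta_hat22_def omega_facts(4) divide_inverse mult.commute)
qed

lemma Delta_ratio_pos:
  assumes k: "k \<noteq> 0" "norm k \<noteq> 1" "k \<in> \<real>"
  shows "\<exists>r>0. Delta_hat11 u0 u1 \<zeta> k * inverse (Delta_hat22 u0 u1 \<zeta> k) = of_real r"
proof -
  have n: "norm (\<omega> * k) \<noteq> 1" "\<omega> * k \<noteq> 0" using k omega_facts(2,3) by (auto simp: norm_mult)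
  have ck: "cnj k = k" using k(3) Reals_cnj_iff by blast
  have "cnj (Delta_hat11 u0 u1 \<zeta> k) = inverse (Delta_hat22 u0 u1 \<zeta> k)"
    using Delta_hat33_cnj[OF n(2,1)] by (simp add: Delta_hat11_def Delta_hat22_def omega_facts(4) ck inverse_eq_divide)
  then have "Delta_hat11 u0 u1 \<zeta> k * inverse (Delta_hat22 u0 u1 \<zeta> k) = of_real ((norm (Delta_hat11 u0 u1 \<zeta> k))\<^sup>2)"
    by (metis complex_norm_square)
  moreover have "(norm (Delta_hat11 u0 u1 \<zeta> k))\<^sup>2 > 0" using Delta_hat33_nonzero by (simp add: Delta_hat11_def)
  ultimately show ?thesis by blast
qed

end

section \<open>Gram matrices of exponentials and determinants\<close>

lemma exponentials_independent:
  fixes R \<nu> :: "'a \<Rightarrow> complex"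
  assumes "finite S" "inj_on \<nu> S" "\<And>s::real. s > 0 \<Longrightarrow> (\<Sum>b\<in>S. R b * exp (of_real s * \<nu> b)) = 0" "b \<in> S"
  shows "R b = 0"
  using assms
proof (induction S arbitrary: R \<nu> b rule: finite_induct)
  case empty
  then show ?case by simp
next
  case (insert c S)
  have sum: "R c + (\<Sum>b\<in>S. R b * exp (of_real s * (\<nu> b - \<nu> c))) = 0" if "s > 0" for s :: real
  proof -
    have "(R c * exp (of_real s * \<nu> c) + (\<Sum>b\<in>S. R b * exp (of_real s * \<nu> b))) * exp (- of_real s * \<nu> c) = 0"
      using insert.prems(2)[OF that] insert.hyps by simp
    then show ?thesis
      by (simp add: distrib_right sum_distrib_right mult.assoc exp_add[symmetric] right_diff_distrib)
  qed
  \<comment> \<open>differentiating removes the constant term \<open>R c\<close>\<close>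
  have "(\<Sum>b\<in>S. R b * (\<nu> b - \<nu> c) * exp (of_real s * (\<nu> b - \<nu> c))) = 0" if s: "s > 0" for s :: real
  proof -
    let ?f = "\<lambda>s::real. R c + (\<Sum>b\<in>S. R b * exp (of_real s * (\<nu> b - \<nu> c)))"
    have ex: "((\<lambda>s::real. exp (of_real s * \<mu>)) has_vector_derivative \<mu> * exp (of_real s * \<mu>)) (at s)" for \<mu> :: complex
      by (rule has_vector_derivative_real_field) (auto intro!: derivative_eq_intros)
    have "(?f has_vector_derivative 0 + (\<Sum>b\<in>S. R b * ((\<nu> b - \<nu> c) * exp (of_real s * (\<nu> b - \<nu> c))))) (at s)"
      by (intro has_vector_derivative_add has_vector_derivative_const has_vector_derivative_sum has_vector_derivative_mult_right ex)
    moreover have "(?f has_vector_derivative 0) (at s)"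
      by (rule has_vector_derivative_transform_within_open[of "\<lambda>_. 0" _ _ "{0<..}"]) (use s sum in auto)
    ultimately have "0 + (\<Sum>b\<in>S. R b * ((\<nu> b - \<nu> c) * exp (of_real s * (\<nu> b - \<nu> c)))) = 0"
      by (rule vector_derivative_unique_at)
    then show ?thesis by (simp add: mult.assoc)
  qed
  moreover have "inj_on (\<lambda>b. \<nu> b - \<nu> c) S" using insert.prems(1) by (auto simp: inj_on_def)
  ultimately have "R b * (\<nu> b - \<nu> c) = 0" if "b \<in> S" for b
    using insert.IH[of "\<lambda>b. \<nu> b - \<nu> c" "\<lambda>b. R b * (\<nu> b - \<nu> c)" b] that by blast
  moreover have "\<nu> b \<noteq> \<nu> c" if "b \<in> S" for b using insert.prems(1) insert.hyps that by (auto simp: inj_on_def)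
  ultimately have S: "R b = 0" if "b \<in> S" for b using that by fastforce
  then have "R c = 0" using sum[of 1] by simp
  then show ?case using S insert.prems(3) by auto
qed

text \<open>
  The kernel \<open>1 / (cnj \<nu>\<^sub>c + \<nu>\<^sub>b)\<close> is the Gram matrix of the functions \<open>exp(- \<nu>\<^sub>b s)\<close> in \<open>L\<^sup>2(0, \<infinity>)\<close>.  Instead of an
  integral the proof uses the norm \<open>V(s)\<close> of the tail on \<open>[s, \<infinity>)\<close>, whose derivative is \<open>- norm(F(s))\<^sup>2\<close>.
\<close>
lemma cauchy_gram_definite:
  fixes R \<nu> :: "'a \<Rightarrow> complex"
  assumes S: "finite S" "inj_on \<nu> S" and re: "\<And>b. b \<in> S \<Longrightarrow> Re (\<nu> b) > 0"
  defines "H \<equiv> (\<Sum>c\<in>S. \<Sum>b\<in>S. cnj (R c) * R b / (cnj (\<nu> c) + \<nu> b))"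
  shows "Re H \<ge> 0" and "Re H = 0 \<Longrightarrow> b \<in> S \<Longrightarrow> R b = 0"
proof -
  define \<mu> where "\<mu> c b = - (cnj (\<nu> c) + \<nu> b)" for c b
  have \<mu>re: "Re (\<mu> c b) < 0" if "c \<in> S" "b \<in> S" for c b using re[OF that(1)] re[OF that(2)] by (simp add: \<mu>_def)
  define V where "V s = (\<Sum>c\<in>S. \<Sum>b\<in>S. - (cnj (R c) * R b / \<mu> c b) * exp (of_real s * \<mu> c b))" for s :: real
  define F where "F s = (\<Sum>b\<in>S. R b * exp (of_real s * (- \<nu> b)))" for s :: real
  have V0: "V 0 = H" unfolding V_def H_def \<mu>_def
    by (simp only: minus_divide_right minus_minus of_real_0 mult_zero_left exp_zero mult_1_right)
  have ex: "((\<lambda>s::real. exp (of_real s * \<mu>)) has_vector_derivative \<mu> * exp (of_real s * \<mu>)) (at s)" for \<mu> :: complex and s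
    by (rule has_vector_derivative_real_field) (auto intro!: derivative_eq_intros)
  have V': "(V has_vector_derivative - (cnj (F s) * F s)) (at s)" for s
  proof -
    have "(V has_vector_derivative (\<Sum>c\<in>S. \<Sum>b\<in>S. - (cnj (R c) * R b / \<mu> c b) * (\<mu> c b * exp (of_real s * \<mu> c b)))) (at s)"
      unfolding V_def by (intro has_vector_derivative_sum has_vector_derivative_mult_right ex)
    moreover have "(\<Sum>c\<in>S. \<Sum>b\<in>S. - (cnj (R c) * R b / \<mu> c b) * (\<mu> c b * exp (of_real s * \<mu> c b))) =
       (\<Sum>c\<in>S. \<Sum>b\<in>S. - ((cnj (R c) * exp (of_real s * (- cnj (\<nu> c)))) * (R b * exp (of_real s * (- \<nu> b)))))"
    proof (intro sum.cong refl)
      fix c b assume "c \<in> S" "b \<in> S"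
      then have "\<mu> c b \<noteq> 0" using \<mu>re by force
      moreover have "exp (of_real s * \<mu> c b) = exp (of_real s * (- cnj (\<nu> c))) * exp (of_real s * (- \<nu> b))"
        unfolding \<mu>_def by (simp add: exp_add[symmetric] algebra_simps)
      ultimately show "- (cnj (R c) * R b / \<mu> c b) * (\<mu> c b * exp (of_real s * \<mu> c b)) = - ((cnj (R c) * exp (of_real s * (- cnj (\<nu> c)))) * (R b * exp (of_real s * (- \<nu> b))))"
        by simp
    qed
    moreover have "\<dots> = - (cnj (F s) * F s)"
      unfolding F_def cnj_sum sum_negf sum_product by (simp add: exp_cnj)
    ultimately show ?thesis by simp
  qed
  have Vre: "((\<lambda>s. Re (V s)) has_real_derivative - (norm (F s))\<^sup>2) (at s)" for s
  proof -
    have "((\<lambda>s. Re (V s)) has_vector_derivative Re (- (cnj (F s) * F s))) (at s)"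
      by (rule bounded_linear.has_vector_derivative[OF bounded_linear_Re V'])
    moreover have "Re (- (cnj (F s) * F s)) = - (norm (F s))\<^sup>2"
      unfolding cmod_power2 by (simp add: power2_eq_square)
    ultimately show ?thesis by (simp add: has_real_derivative_iff_has_vector_derivative)
  qed
  have dec: "Re (V s) \<ge> Re (V s')" if "s \<le> s'" for s s'
    by (rule DERIV_nonpos_imp_nonincreasing[OF that]) (use Vre in force)
  have "(V \<longlongrightarrow> (\<Sum>c\<in>S. \<Sum>b\<in>S. - (cnj (R c) * R b / \<mu> c b) * 0)) at_top"
    unfolding V_def
  proof (intro tendsto_sum tendsto_mult_left)
    fix c b assume cb: "c \<in> S" "b \<in> S"
    show "((\<lambda>s::real. exp (of_real s * \<mu> c b)) \<longlongrightarrow> 0) at_top"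
    proof (rule tendsto_norm_zero_cancel)
      have "filterlim (\<lambda>s::real. Re (\<mu> c b) * s) at_bot at_top"
        by (rule filterlim_tendsto_neg_mult_at_bot[OF tendsto_const \<mu>re[OF cb] filterlim_ident])
      then have "filterlim (\<lambda>s::real. s * Re (\<mu> c b)) at_bot at_top"
        by (simp add: mult.commute)
      then show "((\<lambda>s::real. norm (exp (of_real s * \<mu> c b))) \<longlongrightarrow> 0) at_top"
        by (simp add: filterlim_compose[OF exp_at_bot])
    qed
  qed
  then have "((\<lambda>s. Re (V s)) \<longlongrightarrow> Re 0) at_top" by (intro tendsto_Re) simp
  then have lim: "((\<lambda>s. Re (V s)) \<longlongrightarrow> 0) at_top" by simp
  have nn: "Re (V s) \<ge> 0" for s
  proof (rule tendsto_upperbound[OF lim])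
    show "\<forall>\<^sub>F s' in at_top. Re (V s') \<le> Re (V s)"
      using eventually_ge_at_top[of s] by eventually_elim (rule dec)
  qed simp
  then show "Re H \<ge> 0" unfolding V0[symmetric] .
  assume z: "Re H = 0" and b: "b \<in> S"
  have z': "Re (V s) = 0" if "s > 0" for s using nn[of s] dec[of 0 s] that z V0 by simp
  have "F s = 0" if s: "s > 0" for s
  proof -
    have "((\<lambda>s. Re (V s)) has_real_derivative 0) (at s)"
      unfolding has_real_derivative_iff_has_vector_derivative
      by (rule has_vector_derivative_transform_within_open[of "\<lambda>_. 0" _ _ "{0<..}"]) (use s z' in auto)
    then have "- (norm (F s))\<^sup>2 = 0" using DERIV_unique[OF Vre] by blast
    then show ?thesis by simp
  qed
  moreover have "inj_on (\<lambda>b. - \<nu> b) S" using S(2) by (auto simp: inj_on_def)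
  ultimately show "R b = 0" using exponentials_independent[OF S(1) _ _ b, of "\<lambda>b. - \<nu> b" R] unfolding F_def by blast
qed

text \<open>
  Working with entry functions instead of matrices keeps the Leibniz formula free of index bounds.
\<close>
definition fdet :: "nat \<Rightarrow> (nat \<Rightarrow> nat \<Rightarrow> complex) \<Rightarrow> complex" where
  "fdet n f = Determinant.det (Matrix.mat n n (\<lambda>(i, j). f i j))"

lemma fdet_leibniz:
  "fdet n f = (\<Sum>p | p permutes {0..<n}. of_int (sign p) * (\<Prod>i = 0..<n. f i (p i)))"
proof -
  have "(\<Prod>i = 0..<n. Matrix.mat n n (\<lambda>(i, j). f i j) $$ (i, p i)) = (\<Prod>i = 0..<n. f i (p i))"
    if "p permutes {0..<n}" for p
    using permutes_in_image[OF that] by (intro prod.cong) auto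
  then show ?thesis unfolding fdet_def by (subst Determinant.det_def'[of _ n]) auto
qed

lemma fdet_cong: "(\<And>i j. i < n \<Longrightarrow> j < n \<Longrightarrow> f i j = g i j) \<Longrightarrow> fdet n f = fdet n g"
  unfolding fdet_def by (intro arg_cong[of _ _ Determinant.det] eq_matI) auto

text \<open>
  \<open>det(I - M C) = det(I - C M)\<close> for a diagonal matrix \<open>C\<close>.  It already holds for each term of the Leibniz formula,
  because a permutation permutes its non-fixed points.
\<close>
lemma fdet_diag_commute:
  "fdet n (\<lambda>a b. (if a = b then 1 else 0) - M a b * C b) = fdet n (\<lambda>a b. (if a = b then 1 else 0) - C a * M a b)"
proof -
  have "(\<Prod>i = 0..<n. (if i = p i then 1 else 0) - M i (p i) * C (p i)) = (\<Prod>i = 0..<n. (if i = p i then 1 else 0) - C i * M i (p i))"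
    if p: "p permutes {0..<n}" for p
  proof -
    define N where "N = {i \<in> {0..<n}. p i \<noteq> i}"
    have N: "N \<subseteq> {0..<n}" unfolding N_def by auto
    have "bij_betw p N N"
    proof (rule bij_betwI')
      fix x y assume "x \<in> N" "y \<in> N"
      then show "(p x = p y) = (x = y)" using permutes_inj[OF p] by (auto dest: injD)
    next
      fix x assume "x \<in> N"
      then show "p x \<in> N" unfolding N_def using permutes_in_image[OF p] permutes_inj[OF p] by (auto dest: injD)
    next
      fix y assume y: "y \<in> N"
      then obtain x where "y = p x" using permutes_surj[OF p] by (metis surjD)
      moreover from this have "x \<in> N" using y permutes_in_image[OF p] unfolding N_def by force
      ultimately show "\<exists>x\<in>N. y = p x" by blast
    qed
    then have C: "(\<Prod>i\<in>N. C (p i)) = (\<Prod>i\<in>N. C i)" by (rule prod.reindex_bij_betw)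
    have "(\<Prod>i\<in>N. (if i = p i then 1 else 0) - M i (p i) * C (p i)) = (\<Prod>i\<in>N. - M i (p i)) * (\<Prod>i\<in>N. C (p i))"
      unfolding prod.distrib[symmetric] by (intro prod.cong) (auto simp: N_def)
    also have "\<dots> = (\<Prod>i\<in>N. (if i = p i then 1 else 0) - C i * M i (p i))"
      unfolding C prod.distrib[symmetric] by (intro prod.cong) (auto simp: N_def)
    finally have 1: "(\<Prod>i\<in>N. (if i = p i then 1 else 0) - M i (p i) * C (p i)) = (\<Prod>i\<in>N. (if i = p i then 1 else 0) - C i * M i (p i))" .
    have 2: "(\<Prod>i\<in>{0..<n} - N. (if i = p i then 1 else 0) - M i (p i) * C (p i)) = (\<Prod>i\<in>{0..<n} - N. (if i = p i then 1 else 0) - C i * M i (p i))"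
      by (intro prod.cong) (auto simp: N_def)
    show ?thesis unfolding prod.subset_diff[OF N finite_atLeastLessThan] 1 2 ..
  qed
  then show ?thesis unfolding fdet_leibniz by (intro sum.cong) auto
qed

lemma fdet_transpose: "fdet n (\<lambda>i j. f j i) = fdet n f"
proof -
  have "Matrix.mat n n (\<lambda>(i, j). f j i) = (Matrix.mat n n (\<lambda>(i, j). f i j))\<^sup>T" by (intro eq_matI) auto
  then show ?thesis unfolding fdet_def by (metis det_transpose mat_carrier)
qed

lemma fdet_permute_rows:
  assumes p: "p permutes {0..<n}"
  shows "fdet n (\<lambda>i j. f (p i) j) = of_int (sign p) * fdet n f"
proof -
  have "Matrix.mat n n (\<lambda>(i, j). f (p i) j) = Matrix.mat n n (\<lambda>(i, j). Matrix.mat n n (\<lambda>(i, j). f i j) $$ (p i, j))"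
    using permutes_in_image[OF p] by (intro eq_matI) auto
  then show ?thesis unfolding fdet_def using Determinant.det_permute_rows[OF mat_carrier p] by metis
qed

lemma fdet_permute:
  assumes p: "p permutes {0..<n}"
  shows "fdet n (\<lambda>i j. f (p i) (p j)) = fdet n f"
proof -
  have "fdet n (\<lambda>i j. f (p i) (p j)) = of_int (sign p) * fdet n (\<lambda>i j. f i (p j))"
    by (rule fdet_permute_rows[OF p, of "\<lambda>i j. f i (p j)"])
  also have "fdet n (\<lambda>i j. f i (p j)) = fdet n (\<lambda>j i. f i (p j))" by (rule fdet_transpose[symmetric])
  also have "\<dots> = of_int (sign p) * fdet n (\<lambda>j i. f i j)" by (rule fdet_permute_rows[OF p, of "\<lambda>j i. f i j"])
  also have "fdet n (\<lambda>j i. f i j) = fdet n f" by (rule fdet_transpose)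
  also have "of_int (sign p) * (of_int (sign p) * fdet n f) = fdet n f"
    by (simp add: mult.assoc[symmetric] of_int_mult[symmetric] del: of_int_mult)
  finally show ?thesis .
qed

lemma cnj_fdet: "cnj (fdet n f) = fdet n (\<lambda>i j. cnj (f i j))"
  unfolding fdet_leibniz by (simp add: cnj_sum cnj_prod)

lemma fdet_zero_kernel:
  assumes "fdet n f = 0"
  shows "\<exists>v. (\<exists>a<n. v a \<noteq> 0) \<and> (\<forall>a<n. (\<Sum>b<n. f a b * v b) = 0)"
proof -
  let ?A = "Matrix.mat n n (\<lambda>(i, j). f i j)"
  obtain v where v: "v \<in> carrier_vec n" "v \<noteq> 0\<^sub>v n" "?A *\<^sub>v v = 0\<^sub>v n"
    using assms unfolding fdet_def by (subst (asm) det_0_iff_vec_prod_zero_field[of _ n]) auto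
  have "(\<Sum>b<n. f a b * vec_index v b) = 0" if a: "a < n" for a
  proof -
    have "vec_index (?A *\<^sub>v v) a = 0" using v(3) a by simp
    then show ?thesis using a v(1) by (simp add: scalar_prod_def lessThan_atLeast0)
  qed
  moreover have "\<exists>a<n. vec_index v a \<noteq> 0"
  proof (rule ccontr)
    assume "\<not> ?thesis"
    then have "v = 0\<^sub>v n" using v(1) by (intro eq_vecI) auto
    then show False using v(2) by simp
  qed
  ultimately show ?thesis by blast
qed

lemma fdet_has_field_derivative:
  assumes der: "\<And>i j. i < n \<Longrightarrow> j < n \<Longrightarrow> ((\<lambda>y. m y i j) has_field_derivative m' i j) (at y)"
  shows "((\<lambda>y. fdet n (m y)) has_field_derivative
    (\<Sum>i<n. \<Sum>j<n. m' i j * cofactor (Matrix.mat n n (\<lambda>(i, j). m y i j)) i j)) (at y)"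
proof -
  let ?A = "Matrix.mat n n (\<lambda>(i, j). m y i j)"
  have "((\<lambda>y. fdet n (m y)) has_field_derivative
     (\<Sum>p | p permutes {0..<n}. of_int (sign p) * (\<Sum>i = 0..<n. m' i (p i) * (\<Prod>r\<in>{0..<n} - {i}. m y r (p r))))) (at y)"
    unfolding fdet_leibniz
    by (intro DERIV_sum DERIV_cmult has_field_derivative_prod der) (auto simp: permutes_in_image)
  moreover have "(\<Sum>p | p permutes {0..<n}. of_int (sign p) * (\<Sum>i = 0..<n. m' i (p i) * (\<Prod>r\<in>{0..<n} - {i}. m y r (p r)))) =
     (\<Sum>i = 0..<n. fdet n (\<lambda>r c. if r = i then m' i c else m y r c))"
  proof -
    have "(\<Prod>r = 0..<n. if r = i then m' i (p r) else m y r (p r)) = m' i (p i) * (\<Prod>r\<in>{0..<n} - {i}. m y r (p r))"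
      if "i \<in> {0..<n}" for i p
      using that by (subst prod.remove[of _ i]) (auto intro!: prod.cong)
    then show ?thesis unfolding fdet_leibniz sum_distrib_left by (subst sum.swap) (auto intro!: sum.cong)
  qed
  moreover have "fdet n (\<lambda>r c. if r = i then m' i c else m y r c) = (\<Sum>j<n. m' i j * cofactor ?A i j)" if i: "i < n" for i
  proof -
    let ?R = "Matrix.mat n n (\<lambda>(r, c). if r = i then m' i c else m y r c)"
    have "fdet n (\<lambda>r c. if r = i then m' i c else m y r c) = (\<Sum>j<n. ?R $$ (i, j) * cofactor ?R i j)"
      unfolding fdet_def by (rule laplace_expansion_row[OF _ i]) simp
    also have "\<dots> = (\<Sum>j<n. m' i j * cofactor ?A i j)"
    proof (intro sum.cong refl)
      fix j assume "j \<in> {..<n}"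
      moreover from this have "mat_delete ?R i j = mat_delete ?A i j"
        unfolding mat_delete_def using i by (intro eq_matI) auto
      ultimately show "?R $$ (i, j) * cofactor ?R i j = m' i j * cofactor ?A i j"
        using i unfolding cofactor_def by simp
    qed
    finally show ?thesis .
  qed
  ultimately show ?thesis by (simp add: lessThan_atLeast0)
qed

text \<open>
  Jacobi's formula for a derivative of rank one.  The contraction of the cofactors with \<open>e\<close> is evaluated by
  Cramer's rule for the system with right-hand side \<open>e\<close>.
\<close>
lemma fdet_rank_one_derivative:
  assumes der: "\<And>i j. i < n \<Longrightarrow> j < n \<Longrightarrow> ((\<lambda>y. m y i j) has_field_derivative - (e i * w j)) (at y)"
    and sol: "\<And>i. i < n \<Longrightarrow> (\<Sum>j<n. m y i j * \<psi> j) = e i"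
  shows "((\<lambda>y. fdet n (m y)) has_field_derivative - (fdet n (m y) * (\<Sum>j<n. w j * \<psi> j))) (at y)"
proof -
  let ?A = "Matrix.mat n n (\<lambda>(i, j). m y i j)"
  have A: "?A \<in> carrier_mat n n" by simp
  have cramer: "(\<Sum>i<n. cofactor ?A i j * e i) = fdet n (m y) * \<psi> j" if j: "j < n" for j
  proof -
    have "(\<Sum>i<n. cofactor ?A i j * e i) = (\<Sum>i<n. \<Sum>k<n. cofactor ?A i j * m y i k * \<psi> k)"
      by (intro sum.cong refl) (simp add: sol[symmetric] sum_distrib_left mult.assoc)
    also have "\<dots> = (\<Sum>k<n. (\<Sum>i<n. cofactor ?A i j * m y i k) * \<psi> k)"
      by (subst sum.swap) (simp add: sum_distrib_right)
    also have "\<dots> = (\<Sum>k<n. (if j = k then fdet n (m y) else 0) * \<psi> k)"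
    proof (intro sum.cong refl)
      fix k assume k: "k \<in> {..<n}"
      have "(adj_mat ?A * ?A) $$ (j, k) = (if j = k then fdet n (m y) else 0)"
        using adj_mat(3)[OF A] j k by (simp add: fdet_def)
      moreover have "(adj_mat ?A * ?A) $$ (j, k) = (\<Sum>i<n. cofactor ?A i j * m y i k)"
        using j k by (simp add: adj_mat_def scalar_prod_def lessThan_atLeast0)
      ultimately show "(\<Sum>i<n. cofactor ?A i j * m y i k) * \<psi> k = (if j = k then fdet n (m y) else 0) * \<psi> k" by simp
    qed
    also have "\<dots> = (\<Sum>k<n. if j = k then fdet n (m y) * \<psi> k else 0)" by (intro sum.cong) auto
    also have "\<dots> = fdet n (m y) * \<psi> j" using j by simp
    finally show ?thesis .
  qed
  have "(\<Sum>i<n. \<Sum>j<n. - (e i * w j) * cofactor ?A i j) = - (\<Sum>j<n. w j * (\<Sum>i<n. cofactor ?A i j * e i))"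
    by (subst sum.swap) (simp add: sum_distrib_left sum_negf mult_ac)
  also have "\<dots> = - (\<Sum>j<n. w j * (fdet n (m y) * \<psi> j))"
    by (simp add: cramer)
  also have "\<dots> = - (fdet n (m y) * (\<Sum>j<n. w j * \<psi> j))"
    by (simp add: sum_distrib_left mult_ac)
  finally show ?thesis using fdet_has_field_derivative[of n m "\<lambda>i j. - (e i * w j)" y, OF der] by simp
qed

section \<open>Positivity of Cauchy-type determinants\<close>

text \<open>
  Data of a Cauchy-like matrix that complex conjugation maps to its transpose, up to the involution \<open>hat\<close> of the
  indices.  For multi-solitons \<open>hat\<close> exchanges the two indices of each breather and fixes the solitons, and
  \<open>S\<close> contains the first index of each breather.
\<close>
locale paired_cauchy =
  fixes n :: nat and hat :: "nat \<Rightarrow> nat" and L L' E E' :: "nat \<Rightarrow> complex" and S :: "nat set"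
  assumes hat_less: "a < n \<Longrightarrow> hat a < n" and hat_hat: "a < n \<Longrightarrow> hat (hat a) = a"
    and L_hat: "a < n \<Longrightarrow> L (hat a) = - cnj (L' a)" and E_hat: "a < n \<Longrightarrow> E (hat a) = cnj (E' a)"
    and L'_inj: "inj_on L' {..<n}"
    and E_nz: "a < n \<Longrightarrow> E a \<noteq> 0"
    and S_sub: "S \<subseteq> {..<n}" and S_neg: "a \<in> S \<Longrightarrow> Re (L' a) < 0" and S_hat: "a \<in> S \<Longrightarrow> hat a \<notin> S"
    and not_S_pos: "a < n \<Longrightarrow> a \<notin> S \<Longrightarrow> Re (L' a) > 0"
begin

definition det_C :: "(nat \<Rightarrow> complex) \<Rightarrow> complex" where
  "det_C C = fdet n (\<lambda>a b. (if a = b then 1 else 0) - E a * E' b / (L a - L' b) * C b)"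

definition admissible :: "(nat \<Rightarrow> complex) \<Rightarrow> bool" where
  "admissible C \<longleftrightarrow> (\<forall>a<n. C (hat a) = cnj (C a)) \<and>
     (\<forall>a<n. a \<notin> S \<longrightarrow> hat a \<in> S \<or> hat a = a \<and> (\<exists>r\<ge>0. C a = of_real r))"

lemma L'_hat: "a < n \<Longrightarrow> L' (hat a) = - cnj (L a)"
  using L_hat[OF hat_less, of a] hat_hat[of a] by simp

lemma E'_hat: "a < n \<Longrightarrow> E' (hat a) = cnj (E a)"
  using E_hat[OF hat_less, of a] hat_hat[of a] by simp

text \<open>
  Conjugation turns \<open>I - M C\<close> into the transpose of \<open>I - C M\<close> with rows and columns permuted by \<open>hat\<close>.
\<close>
lemma det_C_real:
  assumes "admissible C"
  shows "cnj (det_C C) = det_C C"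
proof -
  define M where "M a b = E a * E' b / (L a - L' b)" for a b
  define p where "p a = (if a < n then hat a else a)" for a
  have "bij_betw p {0..<n} {0..<n}"
    by (rule bij_betw_byWitness[where f' = p]) (auto simp: p_def hat_less hat_hat)
  then have p: "p permutes {0..<n}" by (rule bij_imp_permutes) (auto simp: p_def)
  define X where "X a b = (if a = b then 1 else 0) - C a * M a b" for a b
  have "cnj (det_C C) = fdet n (\<lambda>a b. cnj ((if a = b then 1 else 0) - M a b * C b))"
    unfolding det_C_def cnj_fdet M_def ..
  also have "\<dots> = fdet n (\<lambda>a b. X (p b) (p a))"
  proof (rule fdet_cong)
    fix a b assume ab: "a < n" "b < n"
    have "cnj (M a b) = M (hat b) (hat a)"
    proof -
      have "cnj (L a) - cnj (L' b) = L (hat b) - L' (hat a)" using L_hat[OF ab(2)] L'_hat[OF ab(1)] by simp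
      then show ?thesis unfolding M_def using E_hat[OF ab(2)] E'_hat[OF ab(1)] by simp
    qed
    moreover have "cnj (C b) = C (hat b)" using assms ab unfolding admissible_def by simp
    moreover have "hat a = hat b \<longleftrightarrow> a = b" using hat_hat ab by metis
    ultimately show "cnj ((if a = b then 1 else 0) - M a b * C b) = X (p b) (p a)"
      unfolding X_def p_def using ab by auto
  qed
  also have "\<dots> = fdet n (\<lambda>a b. X b a)" by (rule fdet_permute[OF p, of "\<lambda>a b. X b a"])
  also have "\<dots> = fdet n X" by (rule fdet_transpose)
  also have "\<dots> = det_C C" unfolding X_def det_C_def M_def by (rule fdet_diag_commute[symmetric])
  finally show ?thesis .
qed

text \<open>
  Let \<open>\<phi>\<close> be a rescaled kernel vector and \<open>R\<close> its product with the weights, so that \<open>\<phi>\<^sub>a = \<Sum>\<^sub>b R\<^sub>b / (L\<^sub>a - L'\<^sub>b)\<close>.  Row \<open>hat c\<close>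
  has the Cauchy kernel \<open>- 1 / (cnj L'\<^sub>c + L'\<^sub>b)\<close>, which is Hermitian, positive definite on \<open>S\<close> and
  negative definite on the complement \<open>T\<close>.  Pair row \<open>hat c\<close> with \<open>cnj R\<^sub>c\<close>, with a minus sign for \<open>c\<close> outside \<open>S\<close>.  On the
  right the blocks between \<open>S\<close> and \<open>T\<close> then cancel in the real part and two nonnegative forms remain.  On the left
  the contributions of each breather cancel, and those of the solitons are at most 0.  Hence \<open>R = 0\<close>.
\<close>
lemma det_C_nonzero:
  assumes adm: "admissible C"
  shows "det_C C \<noteq> 0"
proof
  assume "det_C C = 0"
  then obtain v where v: "\<exists>a<n. v a \<noteq> 0"
    "\<And>a. a < n \<Longrightarrow> (\<Sum>b<n. ((if a = b then 1 else 0) - E a * E' b / (L a - L' b) * C b) * v b) = 0"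
    unfolding det_C_def using fdet_zero_kernel by blast
  define \<phi> where "\<phi> a = v a / E a" for a
  define e where "e a = E a * E' a * C a" for a
  define R where "R a = e a * \<phi> a" for a
  have e_hat: "e (hat a) = cnj (e a)" if "a < n" for a
    using E_hat[OF that] E'_hat[OF that] adm that unfolding e_def admissible_def by (simp add: mult_ac)
  have \<phi>: "\<phi> a = (\<Sum>b<n. R b / (L a - L' b))" if a: "a < n" for a
  proof -
    have "(\<Sum>b<n. ((if a = b then 1 else 0) - E a * E' b / (L a - L' b) * C b) * v b)
       = (\<Sum>b<n. if a = b then v b else 0) - (\<Sum>b<n. E a * (R b / (L a - L' b)))"
      unfolding sum_subtractf[symmetric]
      by (intro sum.cong refl) (auto simp: R_def e_def \<phi>_def E_nz left_diff_distrib)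
    then have "v a = E a * (\<Sum>b<n. R b / (L a - L' b))"
      using v(2)[OF a] a by (simp add: sum_distrib_left)
    then show ?thesis unfolding \<phi>_def using E_nz[OF a] by simp
  qed
  have \<phi>h: "\<phi> (hat c) = - (\<Sum>b<n. R b / (cnj (L' c) + L' b))" if c: "c < n" for c
  proof -
    have "R b / (L (hat c) - L' b) = - (R b / (cnj (L' c) + L' b))" for b
    proof -
      have "L (hat c) - L' b = - (cnj (L' c) + L' b)" using L_hat[OF c] by simp
      then show ?thesis by (simp only: minus_divide_right)
    qed
    then show ?thesis using \<phi>[OF hat_less[OF c]] by (simp add: sum_negf)
  qed
  define sg :: "nat \<Rightarrow> real" where "sg c = (if c \<in> S then 1 else - 1)" for c
  define f where "f c = sg c * Re (cnj (R c) * \<phi> (hat c))" for c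
  \<comment> \<open>Summing \<open>f\<close> over the orbits of \<open>hat\<close>: a breather contributes 0, a soliton at most 0.\<close>
  have f_le: "f c + f (hat c) \<le> 0" if c: "c < n" for c
  proof -
    have sym: "Re (cnj (R (hat c)) * \<phi> c) = Re (cnj (R c) * \<phi> (hat c))"
    proof -
      have "cnj (R (hat c)) * \<phi> c = cnj (cnj (R c) * \<phi> (hat c))"
        unfolding R_def e_hat[OF c] by (simp add: mult_ac)
      then show ?thesis by simp
    qed
    consider "c \<in> S" "hat c \<notin> S" | "c \<notin> S" "hat c \<in> S" | "c \<notin> S" "hat c = c" "\<exists>r\<ge>0. C c = of_real r"
      using S_hat[of c] adm c unfolding admissible_def by blast
    then show ?thesis
    proof cases
      case 3
      then obtain r where r: "r \<ge> 0" "C c = of_real r" by blast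
      have "E' c = cnj (E c)" using E'_hat[OF c] 3 by simp
      then have e: "e c = of_real ((norm (E c))\<^sup>2 * r)"
        unfolding e_def r of_real_mult complex_norm_square by simp
      have "cnj (R c) * \<phi> c = e c * (\<phi> c * cnj (\<phi> c))"
        unfolding R_def using e by simp
      also have "\<dots> = of_real ((norm (E c))\<^sup>2 * r * (norm (\<phi> c))\<^sup>2)"
        unfolding e by (simp only: complex_norm_square[symmetric] of_real_mult of_real_power)
      finally have "f c = - ((norm (E c))\<^sup>2 * r * (norm (\<phi> c))\<^sup>2)"
        unfolding f_def sg_def using 3 by simp
      then show ?thesis using 3 r by simp
    qed (use sym in \<open>simp_all add: f_def sg_def hat_hat[OF c]\<close>)
  qed
  have bij: "bij_betw hat {..<n} {..<n}"
    by (rule bij_betw_byWitness[where f' = hat]) (auto simp: hat_less hat_hat)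
  have "(\<Sum>c<n. f c + f (hat c)) \<le> 0" by (rule sum_nonpos) (use f_le in simp)
  moreover have "(\<Sum>c<n. f (hat c)) = (\<Sum>c<n. f c)" by (rule sum.reindex_bij_betw[OF bij])
  ultimately have f0: "(\<Sum>c<n. f c) \<le> 0" by (simp add: sum.distrib)
  define T where "T = {..<n} - S"
  have part: "{..<n} = S \<union> T" "S \<inter> T = {}" "finite S" "finite T"
    unfolding T_def using S_sub finite_subset[OF S_sub] by auto
  define h where "h c b = cnj (R c) * R b / (cnj (L' c) + L' b)" for c b
  define HS where "HS = (\<Sum>c\<in>S. \<Sum>b\<in>S. cnj (R c) * R b / (cnj (- L' c) + - L' b))"
  define HT where "HT = (\<Sum>c\<in>T. \<Sum>b\<in>T. cnj (R c) * R b / (cnj (L' c) + L' b))"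
  have "(\<Sum>c<n. f c) = Re HS + Re HT"
  proof -
    have fc: "f c = sg c * Re (- (\<Sum>b\<in>S. h c b) - (\<Sum>b\<in>T. h c b))" if "c < n" for c
    proof -
      have "cnj (R c) * \<phi> (hat c) = - (\<Sum>b<n. h c b)"
        unfolding \<phi>h[OF that] h_def by (simp add: sum_distrib_left)
      also have "(\<Sum>b<n. h c b) = (\<Sum>b\<in>S. h c b) + (\<Sum>b\<in>T. h c b)"
        unfolding part(1) by (rule sum.union_disjoint) (use part in auto)
      finally show ?thesis unfolding f_def by simp
    qed
    have "(\<Sum>c<n. f c) = (\<Sum>c\<in>S. f c) + (\<Sum>c\<in>T. f c)"
      unfolding part(1) by (rule sum.union_disjoint) (use part in auto)
    also have "(\<Sum>c\<in>S. f c) = Re (\<Sum>c\<in>S. - (\<Sum>b\<in>S. h c b) - (\<Sum>b\<in>T. h c b))"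
      unfolding Re_sum by (intro sum.cong refl) (use S_sub in \<open>auto simp: fc sg_def\<close>)
    also have "(\<Sum>c\<in>T. f c) = Re (\<Sum>c\<in>T. (\<Sum>b\<in>S. h c b) + (\<Sum>b\<in>T. h c b))"
      unfolding Re_sum by (intro sum.cong refl) (auto simp: fc sg_def T_def)
    also have "(\<Sum>c\<in>S. - (\<Sum>b\<in>S. h c b) - (\<Sum>b\<in>T. h c b)) = HS - (\<Sum>c\<in>S. \<Sum>b\<in>T. h c b)"
    proof -
      have "- h c b = cnj (R c) * R b / (cnj (- L' c) + - L' b)" for c b
      proof -
        have "cnj (- L' c) + - L' b = - (cnj (L' c) + L' b)" by simp
        then show ?thesis unfolding h_def by (simp only: minus_divide_right)
      qed
      then show ?thesis unfolding HS_def by (simp add: sum_subtractf sum_negf[symmetric])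
    qed
    also have "(\<Sum>c\<in>T. (\<Sum>b\<in>S. h c b) + (\<Sum>b\<in>T. h c b)) = (\<Sum>c\<in>T. \<Sum>b\<in>S. h c b) + HT"
      unfolding HT_def h_def sum.distrib ..
    also have "(\<Sum>c\<in>T. \<Sum>b\<in>S. h c b) = cnj (\<Sum>c\<in>S. \<Sum>b\<in>T. h c b)"
    proof -
      have hc: "h c b = cnj (h b c)" for c b unfolding h_def by (simp add: mult.commute add.commute)
      have "(\<Sum>c\<in>T. \<Sum>b\<in>S. h c b) = (\<Sum>c\<in>T. \<Sum>b\<in>S. cnj (h b c))"
        by (intro sum.cong refl) (rule hc)
      also have "\<dots> = (\<Sum>b\<in>S. \<Sum>c\<in>T. cnj (h b c))" by (rule sum.swap)
      finally show ?thesis unfolding cnj_sum .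
    qed
    finally show ?thesis by simp
  qed
  moreover have S: "Re HS \<ge> 0" "Re HS = 0 \<Longrightarrow> b \<in> S \<Longrightarrow> R b = 0" for b
  proof -
    have i: "inj_on (\<lambda>b. - L' b) S" using inj_on_subset[OF L'_inj S_sub] by (auto simp: inj_on_def)
    have p: "Re (- L' b) > 0" if "b \<in> S" for b using S_neg[OF that] by simp
    show "Re HS \<ge> 0" unfolding HS_def by (rule cauchy_gram_definite(1)[OF part(3) i p])
    show "R b = 0" if "Re HS = 0" "b \<in> S"
      by (rule cauchy_gram_definite(2)[OF part(3) i p that[unfolded HS_def]])
  qed
  moreover have T: "Re HT \<ge> 0" "Re HT = 0 \<Longrightarrow> b \<in> T \<Longrightarrow> R b = 0" for b
  proof -
    have i: "inj_on L' T" by (rule inj_on_subset[OF L'_inj]) (auto simp: T_def)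
    have p: "Re (L' b) > 0" if "b \<in> T" for b using not_S_pos that unfolding T_def by auto
    show "Re HT \<ge> 0" unfolding HT_def by (rule cauchy_gram_definite(1)[OF part(4) i p])
    show "R b = 0" if "Re HT = 0" "b \<in> T"
      by (rule cauchy_gram_definite(2)[OF part(4) i p that[unfolded HT_def]])
  qed
  ultimately have "Re HS = 0" "Re HT = 0" using f0 by linarith+
  then have "R b = 0" if "b < n" for b using S(2) T(2) that part(1) by blast
  then have "\<phi> a = 0" if "a < n" for a using \<phi>[OF that] by simp
  then show False using v(1) E_nz unfolding \<phi>_def by (metis divide_eq_0_iff)
qed

text \<open>
  Scaling the constants by \<open>s \<in> [0, 1]\<close> keeps the determinant real and nonzero and connects it to 1.
\<close>
theorem det_C_pos:
  assumes adm: "admissible C"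
  shows "\<exists>r>0. det_C C = of_real r"
proof -
  define g where "g s = det_C (\<lambda>a. of_real s * C a)" for s :: real
  have adm_s: "admissible (\<lambda>a. of_real s * C a)" if "s \<ge> 0" for s
    unfolding admissible_def
  proof (intro conjI allI impI)
    fix a assume a: "a < n" "a \<notin> S"
    then consider "hat a \<in> S" | r where "hat a = a" "r \<ge> 0" "C a = of_real r" using adm unfolding admissible_def by blast
    then show "hat a \<in> S \<or> hat a = a \<and> (\<exists>r\<ge>0. of_real s * C a = of_real r)"
    proof cases
      case (2 r)
      then show ?thesis using that by (intro disjI2 conjI exI[of _ "s * r"]) auto
    qed simp
  qed (use adm in \<open>simp add: admissible_def\<close>)
  have real: "g s = of_real (Re (g s))" and nz: "g s \<noteq> 0" if "s \<ge> 0" for s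
    using det_C_real[OF adm_s[OF that]] det_C_nonzero[OF adm_s[OF that]] unfolding g_def
    by (auto simp: complex_eq_iff)
  have cont: "continuous_on {0..1} (\<lambda>s. Re (g s))"
    unfolding g_def det_C_def fdet_leibniz by (intro continuous_intros)
  have g0: "g 0 = 1"
    unfolding g_def det_C_def fdet_def using det_one[of n] by (simp add: one_mat_def)
  have "Re (g 1) > 0"
  proof (rule ccontr)
    assume "\<not> ?thesis"
    then obtain s where "0 \<le> s" "s \<le> 1" "Re (g s) = 0"
      using IVT2'[of "\<lambda>s. Re (g s)" 1 0 0] cont g0 by auto
    then show False using real[of s] nz[of s] by simp
  qed
  moreover have "g 1 = det_C C" unfolding g_def by simp
  ultimately show ?thesis using real[of 1] by (intro exI[of _ "Re (g 1)"]) auto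
qed

end

section \<open>Rational functions that are symmetric under inversion\<close>

text \<open>
  Liouville's theorem, with finitely many removable singularities.
\<close>
lemma entire_after_removal_zero:
  assumes S: "finite S" and an: "g analytic_on - S" and lim: "\<And>z. z \<in> S \<Longrightarrow> \<exists>c. g \<midarrow>z\<rightarrow> c"
    and inf: "(g \<longlongrightarrow> 0) at_infinity" and z: "z \<notin> S"
  shows "g z = 0"
proof -
  have op: "open (- S)" using S by (simp add: finite_imp_closed open_Compl)
  have iso: "isolated_singularity_at g z" for z
  proof -
    have "open (- (S - {z}))" by (rule open_Compl, rule finite_imp_closed) (use S in simp)
    then obtain r where r: "r > 0" "ball z r \<subseteq> - (S - {z})" by (rule openE[of _ z]) auto
    then have "g analytic_on ball z r - {z}" by (intro analytic_on_subset[OF an]) auto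
    then show ?thesis using r(1) unfolding isolated_singularity_at_def by blast
  qed
  have "remove_sings g analytic_on {z}" for z
  proof (cases "z \<in> S")
    case True
    then show ?thesis using lim remove_sings_analytic_at[OF iso] by blast
  next
    case False
    then have "g analytic_on {z}" by (intro analytic_on_subset[OF an]) auto
    then show ?thesis by (rule remove_sings_analytic_on)
  qed
  then have "remove_sings g analytic_on UNIV" using analytic_on_analytic_at by blast
  then have hol: "remove_sings g holomorphic_on UNIV" by (rule analytic_imp_holomorphic)
  have eq: "remove_sings g z = g z" if "z \<notin> S" for z
    by (rule remove_sings_at_analytic, rule analytic_on_subset[OF an]) (use that in auto)
  obtain r where "\<forall>z\<in>S. norm z \<le> r" using finite_imp_bounded[OF S] unfolding bounded_iff by blast
  then have "z \<notin> S" if "norm z \<ge> r + 1" for z using that by force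
  then have "\<forall>\<^sub>F z in at_infinity. z \<notin> S" unfolding eventually_at_infinity by blast
  then have "\<forall>\<^sub>F z in at_infinity. g z = remove_sings g z" by eventually_elim (simp add: eq)
  then have "(remove_sings g \<longlongrightarrow> 0) at_infinity" by (rule Lim_transform_eventually[OF inf])
  then have "remove_sings g z = 0" by (rule Liouville_weak[OF hol])
  then show ?thesis using eq[OF z] by simp
qed

text \<open>
  \<open>1 / (l\<^sub>3(k) - l\<^sub>3(p))\<close> in a form that is also correct at \<open>k = 0\<close>, where \<open>l\<^sub>3\<close> has a pole.
\<close>
definition hker :: "complex \<Rightarrow> complex \<Rightarrow> complex" where
  "hker p k = (2 * of_real (sqrt 3) / \<i>) * k / ((k - p) * (k - inverse p))"

text \<open>
  The derivative of \<open>l\<^sub>3\<close>, which converts residues in \<open>k\<close> into residues in \<open>l\<^sub>3(k)\<close>.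
\<close>
definition l3_deriv :: "complex \<Rightarrow> complex" where
  "l3_deriv p = \<i> * (p\<^sup>2 - 1) / (2 * of_real (sqrt 3) * p\<^sup>2)"

lemma l3_deriv_eq:
  assumes "p \<noteq> 0"
  shows "l3_deriv p = (p - inverse p) / (2 * of_real (sqrt 3) / \<i> * p)"
proof -
  have "p\<^sup>2 - 1 = p * (p - inverse p)" using assms by (simp add: power2_eq_square algebra_simps)
  then show ?thesis unfolding l3_deriv_def using assms by (simp add: field_simps power2_eq_square)
qed

lemma lfun3_diff:
  assumes "k \<noteq> 0" "p \<noteq> 0"
  shows "lfun 3 k - lfun 3 p = \<i> * ((k - p) * (k - inverse p)) / (2 * of_real (sqrt 3) * k)"
proof -
  have "complex_of_real (sqrt 3) \<noteq> 0" by simp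
  then show ?thesis unfolding lfun_def rot_simps omega_facts(1) using assms by (simp add: field_simps)
qed

lemma hker_eq:
  assumes "k \<noteq> 0" "p \<noteq> 0"
  shows "hker p k = 1 / (lfun 3 k - lfun 3 p)"
proof -
  have "(2 * complex_of_real (sqrt 3) / \<i>) * k / X = 1 / (\<i> * X / (2 * complex_of_real (sqrt 3) * k))" for X
    using assms by (cases "X = 0") (simp_all add: field_simps)
  then show ?thesis unfolding hker_def lfun3_diff[OF assms] by simp
qed

lemma hker_inverse:
  assumes "k \<noteq> 0" "p \<noteq> 0"
  shows "hker p (inverse k) = hker p k"
proof -
  have "lfun 3 (inverse k) = lfun 3 k" unfolding lfun_def rot_simps omega_facts(1) by (simp add: add.commute)
  then show ?thesis using hker_eq[of k p] hker_eq[of "inverse k" p] assms by simp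
qed

lemma hker_partial_fractions:
  assumes "p \<noteq> 0" "p \<noteq> inverse p" "k \<noteq> p" "k \<noteq> inverse p"
  shows "hker p k = (1 / l3_deriv p) / (k - p) - (2 * of_real (sqrt 3) / \<i>) * inverse p / (p - inverse p) / (k - inverse p)"
proof -
  define q where "q = inverse p"
  have q: "q \<noteq> 0" "p * q = 1" "p - q \<noteq> 0" "k - p \<noteq> 0" "k - q \<noteq> 0" unfolding q_def using assms by auto
  define c where "c = 2 * of_real (sqrt 3) / \<i>"
  have c0: "c \<noteq> 0" unfolding c_def by simp
  have l: "1 / l3_deriv p = c * p / (p - q)"
    unfolding l3_deriv_eq[OF assms(1)] c_def q_def by simp
  have "c * k * (p - q) = c * p * (k - q) - c * q * (k - p)" by (simp add: algebra_simps)
  then have "c * k / ((k - p) * (k - q)) = c * p / (p - q) / (k - p) - c * q / (p - q) / (k - q)"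
    using q by (simp add: divide_simps) (simp add: algebra_simps)
  then show ?thesis unfolding hker_def q_def[symmetric] c_def[symmetric] l by simp
qed

lemma hker_continuous:
  assumes "z \<noteq> p" "z \<noteq> inverse p"
  shows "isCont (hker p) z"
  unfolding hker_def using assms by (intro continuous_intros) auto

lemma hker_analytic:
  assumes "p \<notin> S" "inverse p \<notin> S"
  shows "hker p analytic_on S"
  unfolding hker_def using assms by (intro analytic_intros) auto

lemma hker_at_infinity:
  assumes "p \<noteq> 0" "p \<noteq> inverse p"
  shows "(hker p \<longlongrightarrow> 0) at_infinity" "((\<lambda>k. k * hker p k) \<longlongrightarrow> 2 * of_real (sqrt 3) / \<i>) at_infinity"
proof -
  define q where "q = inverse p"
  define c where "c = 2 * complex_of_real (sqrt 3) / \<i>"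
  define A where "A = 1 / l3_deriv p"
  define B where "B = c * q / (p - q)"
  have q: "p * q = 1" "p - q \<noteq> 0" unfolding q_def using assms by auto
  have AB: "A - B = c"
  proof -
    have "A = c * p / (p - q)" unfolding A_def l3_deriv_eq[OF assms(1)] c_def q_def by simp
    then show ?thesis unfolding B_def using q(2) by (simp add: divide_simps) (simp add: algebra_simps)
  qed
  have ev: "\<forall>\<^sub>F k in at_infinity. k \<noteq> p \<and> k \<noteq> q"
    by (intro eventually_conj eventually_not_equal_at_infinity)
  have h: "hker p k = A / (k - p) - B / (k - q)" if "k \<noteq> p" "k \<noteq> q" for k
    using hker_partial_fractions[OF assms, of k] that unfolding A_def B_def c_def q_def by simp
  have t: "((\<lambda>k. a / (k - b)) \<longlongrightarrow> 0) at_infinity" for a b :: complex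
  proof (rule tendsto_divide_0[OF tendsto_const])
    show "filterlim (\<lambda>k. k - b) at_infinity at_infinity"
      using tendsto_add_filterlim_at_infinity'[OF filterlim_ident tendsto_const, of "-b"] by simp
  qed
  have "((\<lambda>k. A / (k - p) - B / (k - q)) \<longlongrightarrow> 0 - 0) at_infinity" by (intro tendsto_diff t)
  then show "(hker p \<longlongrightarrow> 0) at_infinity"
    by (rule_tac Lim_transform_eventually[where f = "\<lambda>k. A / (k - p) - B / (k - q)"])
       (use ev in \<open>auto simp: h elim!: eventually_mono\<close>)
  have "((\<lambda>k. (A + A * p / (k - p)) - (B + B * q / (k - q))) \<longlongrightarrow> (A + 0) - (B + 0)) at_infinity"
    by (intro tendsto_diff tendsto_add tendsto_const t)
  then have "((\<lambda>k. k * hker p k) \<longlongrightarrow> (A + 0) - (B + 0)) at_infinity"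
  proof (rule Lim_transform_eventually)
    show "\<forall>\<^sub>F k in at_infinity. (A + A * p / (k - p)) - (B + B * q / (k - q)) = k * hker p k"
      using ev
    proof eventually_elim
      case (elim k)
      then have "A + A * p / (k - p) = k * (A / (k - p))" "B + B * q / (k - q) = k * (B / (k - q))"
        by (simp_all add: divide_simps) (simp_all add: algebra_simps)
      then show ?case using h elim by (simp add: right_diff_distrib)
    qed
  qed
  then show "((\<lambda>k. k * hker p k) \<longlongrightarrow> 2 * of_real (sqrt 3) / \<i>) at_infinity"
    using AB unfolding c_def by simp
qed

lemma tendsto_at_inverse:
  fixes f :: "complex \<Rightarrow> complex"
  assumes "(f \<longlongrightarrow> c) (at (inverse z))" "z \<noteq> 0"
  shows "((\<lambda>k. f (inverse k)) \<longlongrightarrow> c) (at z)"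
proof (rule filterlim_compose[OF assms(1)])
  have "(inverse \<longlongrightarrow> inverse z) (at z)" using assms(2) by (intro tendsto_intros)
  moreover have "\<forall>\<^sub>F k in at z. inverse k \<noteq> inverse z"
    using eventually_neq_at_within[of z z UNIV] by (auto elim: eventually_mono)
  ultimately show "filterlim inverse (at (inverse z)) (at z)" by (simp add: filterlim_at)
qed

text \<open>
  Partial fractions in the variable \<open>l\<^sub>3(k)\<close>.  One simple pole of a symmetric function forces another one at
  the inverse point, and \<open>hker (p b)\<close> has both with the matching residues; so only the poles \<open>p b\<close> need attention.
\<close>
lemma inversion_symmetric_rational:
  fixes f :: "complex \<Rightarrow> complex" and p :: "nat \<Rightarrow> complex"
  assumes Z: "finite Z" "0 \<notin> Z" "\<And>z. z \<in> Z \<Longrightarrow> inverse z \<in> Z"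
    and an: "f analytic_on - Z" and sym: "\<And>k. k \<notin> Z \<Longrightarrow> k \<noteq> 0 \<Longrightarrow> f k = f (inverse k)"
    and inf: "(f \<longlongrightarrow> 1) at_infinity"
    and pZ: "\<And>b. b < N \<Longrightarrow> p b \<in> Z" and inj: "inj_on p {..<N}"
    and p_inv: "\<And>b b'. b < N \<Longrightarrow> b' < N \<Longrightarrow> p b \<noteq> inverse (p b')"
    and poles: "\<And>b. b < N \<Longrightarrow> \<exists>l. ((\<lambda>k. f k - c b / (k - p b)) \<longlongrightarrow> l) (at (p b))"
    and reg: "\<And>z. z \<in> Z \<Longrightarrow> z \<in> p ` {..<N} \<or> inverse z \<in> p ` {..<N} \<or> (\<exists>l. (f \<longlongrightarrow> l) (at z))"
  shows "\<And>k. k \<notin> Z \<Longrightarrow> f k = 1 + (\<Sum>b<N. c b * l3_deriv (p b) * hker (p b) k)"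
    and "((\<lambda>k. k * (f k - 1)) \<longlongrightarrow> 2 * of_real (sqrt 3) / \<i> * (\<Sum>b<N. c b * l3_deriv (p b))) at_infinity"
proof -
  define R where "R b = c b * l3_deriv (p b)" for b
  have p0: "p b \<noteq> 0" if "b < N" for b using pZ[OF that] Z(2) by auto
  have pp: "p b \<noteq> inverse (p b)" if "b < N" for b using p_inv[OF that that] .
  define g where "g k = f k - (1 + (\<Sum>b<N. R b * hker (p b) k))" for k
  have g_an: "g analytic_on - Z"
    unfolding g_def using pZ Z(3) by (intro analytic_intros an hker_analytic) auto
  have evZ: "\<forall>\<^sub>F k in at z. k \<notin> Z \<and> k \<noteq> 0" for z
  proof -
    have "finite (insert 0 Z)" using Z(1) by simp
    then have "\<forall>\<^sub>F k in at z. k \<notin> insert 0 Z"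
      using islimpt_finite[of "insert 0 Z" z] by (simp add: islimpt_iff_eventually)
    then show ?thesis by (rule eventually_mono) auto
  qed
  have cont: "(\<lambda>k. \<Sum>b\<in>B. R b * hker (p b) k) \<midarrow>z\<rightarrow> (\<Sum>b\<in>B. R b * hker (p b) z)"
    if "\<And>b. b \<in> B \<Longrightarrow> z \<noteq> p b \<and> z \<noteq> inverse (p b)" for B z
    using that hker_continuous by (intro tendsto_sum tendsto_mult_left) (auto simp: isCont_def)
  have lim_p: "\<exists>l. g \<midarrow>z\<rightarrow> l" if z: "z \<in> p ` {..<N}" for z
  proof -
    obtain b where b: "b < N" "z = p b" using z by auto
    define q where "q = inverse z"
    define D where "D = R b * ((2 * of_real (sqrt 3) / \<i>) * inverse z / (z - inverse z))"
    have zq: "z \<noteq> q" using pp[OF b(1)] b(2) unfolding q_def by simp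
    obtain l where l: "((\<lambda>k. f k - c b / (k - z)) \<longlongrightarrow> l) (at z)" using poles[OF b(1)] b(2) by blast
    have "(\<lambda>k. (f k - c b / (k - z)) - 1 + D / (k - q) - (\<Sum>b'\<in>{..<N} - {b}. R b' * hker (p b') k)) \<midarrow>z\<rightarrow>
        l - 1 + D / (z - q) - (\<Sum>b'\<in>{..<N} - {b}. R b' * hker (p b') z)"
    proof (intro tendsto_diff tendsto_add tendsto_divide tendsto_const tendsto_ident_at l cont)
      show "z - q \<noteq> 0" using zq by simp
      show "z \<noteq> p b' \<and> z \<noteq> inverse (p b')" if "b' \<in> {..<N} - {b}" for b'
        using inj_onD[OF inj, of b b'] p_inv[of b b'] b that by auto
    qed
    moreover have "\<forall>\<^sub>F k in at z. (f k - c b / (k - z)) - 1 + D / (k - q) - (\<Sum>b'\<in>{..<N} - {b}. R b' * hker (p b') k) = g k"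
    proof -
      have "\<forall>\<^sub>F k in at z. k \<noteq> z" by (rule eventually_neq_at_within)
      moreover have "\<forall>\<^sub>F k in at z. k \<noteq> q"
        using zq by (rule_tac tendsto_imp_eventually_ne[OF tendsto_ident_at]) 
      ultimately show ?thesis
      proof eventually_elim
        case (elim k)
        have l3: "l3_deriv z \<noteq> 0"
          unfolding l3_deriv_def using p0[OF b(1)] zq b(2) unfolding q_def
          by (auto simp: power2_eq_square field_simps)
        have "hker z k = (1 / l3_deriv z) / (k - z) - (2 * of_real (sqrt 3) / \<i>) * inverse z / (z - inverse z) / (k - inverse z)"
          by (rule hker_partial_fractions) (use elim zq p0[OF b(1)] b(2) in \<open>auto simp: q_def\<close>)
        then have "R b * hker z k = R b * (1 / l3_deriv z) / (k - z) - D / (k - q)"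
          unfolding D_def q_def by (simp only: right_diff_distrib times_divide_eq_right)
        also have "R b * (1 / l3_deriv z) = c b" unfolding R_def b(2)[symmetric] using l3 by simp
        finally have "R b * hker (p b) k = c b / (k - z) - D / (k - q)" unfolding b(2) .
        moreover have "(\<Sum>b'<N. R b' * hker (p b') k) = R b * hker (p b) k + (\<Sum>b'\<in>{..<N} - {b}. R b' * hker (p b') k)"
          using b(1) by (intro sum.remove) auto
        ultimately show ?case unfolding g_def by simp
      qed
    qed
    ultimately show ?thesis using Lim_transform_eventually by blast
  qed
  have lim: "\<exists>l. g \<midarrow>z\<rightarrow> l" if z: "z \<in> Z" for z
  proof -
    consider "z \<in> p ` {..<N}" | "inverse z \<in> p ` {..<N}"
      | "z \<notin> p ` {..<N}" "inverse z \<notin> p ` {..<N}" "\<exists>l. (f \<longlongrightarrow> l) (at z)" using reg[OF z] by blast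
    then show ?thesis
    proof cases
      case 1
      then show ?thesis by (rule lim_p)
    next
      case 2
      then obtain l where "g \<midarrow>inverse z\<rightarrow> l" using lim_p by blast
      then have "((\<lambda>k. g (inverse k)) \<longlongrightarrow> l) (at z)"
        using z Z(2) by (intro tendsto_at_inverse) auto
      moreover have "\<forall>\<^sub>F k in at z. g (inverse k) = g k"
        using evZ
      proof eventually_elim
        case (elim k)
        then have "hker (p b) (inverse k) = hker (p b) k" if "b < N" for b
          using hker_inverse p0[OF that] by blast
        then show ?case using sym[of k] elim unfolding g_def by simp
      qed
      ultimately show ?thesis using Lim_transform_eventually by blast
    next
      case 3
      then obtain l where l: "(f \<longlongrightarrow> l) (at z)" by blast
      have "g \<midarrow>z\<rightarrow> l - (1 + (\<Sum>b<N. R b * hker (p b) z))"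
        unfolding g_def
      proof (intro tendsto_diff tendsto_add tendsto_const l cont)
        show "z \<noteq> p b \<and> z \<noteq> inverse (p b)" if "b \<in> {..<N}" for b
          using 3(1,2) that by auto
      qed
      then show ?thesis by blast
    qed
  qed
  have "(g \<longlongrightarrow> 1 - (1 + (\<Sum>b<N. R b * 0))) at_infinity"
    unfolding g_def using p0 pp by (intro tendsto_intros inf hker_at_infinity) auto
  then have ginf: "(g \<longlongrightarrow> 0) at_infinity" by simp
  have rep: "f k = 1 + (\<Sum>b<N. R b * hker (p b) k)" if "k \<notin> Z" for k
    using entire_after_removal_zero[OF Z(1) g_an lim ginf that] unfolding g_def by simp
  then show "\<And>k. k \<notin> Z \<Longrightarrow> f k = 1 + (\<Sum>b<N. c b * l3_deriv (p b) * hker (p b) k)"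
    unfolding R_def .
  have "((\<lambda>k. \<Sum>b<N. R b * (k * hker (p b) k)) \<longlongrightarrow> (\<Sum>b<N. R b * (2 * of_real (sqrt 3) / \<i>))) at_infinity"
    using p0 pp by (intro tendsto_sum tendsto_mult_left hker_at_infinity) auto
  moreover have "\<forall>\<^sub>F k in at_infinity. (\<Sum>b<N. R b * (k * hker (p b) k)) = k * (f k - 1)"
  proof -
    obtain r where "\<forall>z\<in>Z. norm z \<le> r" using finite_imp_bounded[OF Z(1)] unfolding bounded_iff by blast
    then have "k \<notin> Z" if "norm k \<ge> r + 1" for k using that by force
    then have "\<forall>\<^sub>F k in at_infinity. k \<notin> Z" unfolding eventually_at_infinity by blast
    then show ?thesis by eventually_elim (simp add: rep sum_distrib_left mult_ac)
  qed
  ultimately have "((\<lambda>k. k * (f k - 1)) \<longlongrightarrow> (\<Sum>b<N. R b * (2 * of_real (sqrt 3) / \<i>))) at_infinity"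
    by (rule Lim_transform_eventually)
  then show "((\<lambda>k. k * (f k - 1)) \<longlongrightarrow> 2 * of_real (sqrt 3) / \<i> * (\<Sum>b<N. c b * l3_deriv (p b))) at_infinity"
    unfolding R_def sum_distrib_right[symmetric] by (simp only: mult.commute)
qed

section \<open>The fundamental domain of the spectral parameter\<close>

text \<open>
  The half-open sector \<open>0 \<le> arg z < pi/6\<close>.
\<close>
definition wedge :: "complex set" where
  "wedge = {z. Re z > 0 \<and> Im z \<ge> 0 \<and> sqrt 3 * Im z < Re z}"

text \<open>
  A region that contains all zeros of \<open>s\<^sub>1\<^sub>1\<close> considered here: the two components of the regular part of
  \<open>D2\<close> together with the admissible real points.
\<close>
definition base_points :: "complex set" where
  "base_points = {k. norm k > 1 \<and> k \<in> wedge} \<union> {k. norm k < 1 \<and> - k \<in> wedge}"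

lemma sector_wedge:
  assumes "k \<in> sector (- pi / 6) (pi / 6)" "Im k > 0"
  shows "k \<in> wedge"
proof -
  obtain r \<phi> where k: "k = of_real r * cis \<phi>" "0 < r" "- pi / 6 < \<phi>" "\<phi> < pi / 6"
    using assms(1) unfolding sector_def by blast
  have s: "sin \<phi> > 0" using assms(2) k by (simp add: zero_less_mult_iff)
  have p: "\<phi> > 0"
  proof (rule ccontr)
    assume "\<not> \<phi> > 0"
    then have "sin (- \<phi>) \<ge> 0" using k pi_gt_zero by (intro sin_ge_zero) linarith+
    then show False using s by simp
  qed
  have c: "cos \<phi> > 0" using k p pi_gt_zero by (intro cos_gt_zero) linarith+
  have "cos (\<phi> + pi / 3) > 0" using k p pi_gt_zero by (intro cos_gt_zero) linarith+
  then have "sqrt 3 * sin \<phi> < cos \<phi>" by (simp add: cos_add cos_60 sin_60 mult.commute)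
  then have "r * (sqrt 3 * sin \<phi>) < r * cos \<phi>" using k(2) by (intro mult_strict_left_mono)
  then show ?thesis unfolding wedge_def k(1) using c s k(2) by (simp add: mult_ac)
qed

lemma sector_wedge':
  assumes "k \<in> sector (5 * pi / 6) (7 * pi / 6)" "Im k < 0"
  shows "- k \<in> wedge"
proof (rule sector_wedge)
  obtain r \<phi> where k: "k = of_real r * cis \<phi>" "0 < r" "5 * pi / 6 < \<phi>" "\<phi> < 7 * pi / 6"
    using assms(1) unfolding sector_def by blast
  have "cis (\<phi> - pi) = - cis \<phi>" by (simp add: complex_eq_iff)
  then have "- k = of_real r * cis (\<phi> - pi)" using k(1) by simp
  then show "- k \<in> sector (- pi / 6) (pi / 6)" unfolding sector_def using k by force
  show "Im (- k) > 0" using assms(2) by simp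
qed

lemma Dreg_base_points:
  assumes "k \<in> Dreg"
  shows "k \<in> base_points" "Im k \<noteq> 0"
  using assms sector_wedge sector_wedge' unfolding Dreg_def D2_def base_points_def by auto

lemma real_base_points:
  assumes "k \<in> complex_of_real ` ({-1<..<0} \<union> {1<..})"
  shows "k \<in> base_points"
  using assms unfolding base_points_def wedge_def by auto

text \<open>
  Cubing removes the rotations by \<open>\<omega>\<close>.  The cubes of all base points and of their conjugates lie in this region,
  and inversion maps it into its complement; this separates the poles from their inverses.
\<close>
definition cube_region :: "complex set" where
  "cube_region = {w. norm w > 1 \<and> Re w > 0} \<union> {w. norm w < 1 \<and> Re w < 0}"

lemma wedge_cube:
  assumes "z \<in> wedge"
  shows "Re (z ^ 3) > 0" "Im (z ^ 3) \<ge> 0" "Im (z ^ 3) = 0 \<longleftrightarrow> Im z = 0"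
proof -
  define x y where xy: "x = Re z" "y = Im z"
  have w: "x > 0" "y \<ge> 0" "sqrt 3 * y < x" using assms unfolding wedge_def xy by auto
  have "(sqrt 3 * y)\<^sup>2 < x\<^sup>2" using w by (intro power_strict_mono) auto
  then have q: "3 * y\<^sup>2 < x\<^sup>2" by (simp add: power_mult_distrib)
  have q': "y\<^sup>2 < 3 * x\<^sup>2" using q zero_le_power2[of x] zero_le_power2[of y] by linarith
  have re: "Re (z ^ 3) = x * (x\<^sup>2 - 3 * y\<^sup>2)" and im: "Im (z ^ 3) = y * (3 * x\<^sup>2 - y\<^sup>2)"
    by (simp_all add: xy power3_eq_cube power2_eq_square algebra_simps)
  show "Re (z ^ 3) > 0" unfolding re using w q by (intro mult_pos_pos) auto
  show "Im (z ^ 3) \<ge> 0" unfolding im using w q' by (intro mult_nonneg_nonneg) auto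
  show "Im (z ^ 3) = 0 \<longleftrightarrow> Im z = 0" unfolding im using q' by (auto simp: xy)
qed

lemma base_cube:
  assumes "k \<in> base_points"
  shows "k ^ 3 \<in> cube_region"
    and "Re (k ^ 3) > 0 \<Longrightarrow> norm k > 1 \<and> k \<in> wedge \<and> Im (k ^ 3) \<ge> 0"
    and "Re (k ^ 3) \<le> 0 \<Longrightarrow> norm k < 1 \<and> - k \<in> wedge \<and> Im (k ^ 3) \<le> 0"
    and "Im (k ^ 3) = 0 \<longleftrightarrow> Im k = 0"
proof -
  consider "norm k > 1" "k \<in> wedge" | "norm k < 1" "- k \<in> wedge" using assms unfolding base_points_def by blast
  then have "k ^ 3 \<in> cube_region \<and> (Re (k ^ 3) > 0 \<longrightarrow> norm k > 1 \<and> k \<in> wedge \<and> Im (k ^ 3) \<ge> 0)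
     \<and> (Re (k ^ 3) \<le> 0 \<longrightarrow> norm k < 1 \<and> - k \<in> wedge \<and> Im (k ^ 3) \<le> 0) \<and> (Im (k ^ 3) = 0 \<longleftrightarrow> Im k = 0)"
  proof cases
    case 1
    then have "norm (k ^ 3) > 1" by (simp add: norm_power)
    then show ?thesis using 1 wedge_cube[OF 1(2)] unfolding cube_region_def by auto
  next
    case 2
    have m: "(- k) ^ 3 = - (k ^ 3)" by simp
    have "norm (k ^ 3) < 1" using 2 by (simp add: norm_power power_less_one_iff)
    then show ?thesis using 2 wedge_cube[OF 2(2)] unfolding cube_region_def m by auto
  qed
  then show "k ^ 3 \<in> cube_region"
    and "Re (k ^ 3) > 0 \<Longrightarrow> norm k > 1 \<and> k \<in> wedge \<and> Im (k ^ 3) \<ge> 0"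
    and "Re (k ^ 3) \<le> 0 \<Longrightarrow> norm k < 1 \<and> - k \<in> wedge \<and> Im (k ^ 3) \<le> 0"
    and "Im (k ^ 3) = 0 \<longleftrightarrow> Im k = 0" by blast+
qed

lemma cube_region_cnj: "w \<in> cube_region \<Longrightarrow> cnj w \<in> cube_region"
  by (auto simp: cube_region_def)

lemma cube_region_inverse:
  assumes "w \<in> cube_region" "w' \<in> cube_region"
  shows "w \<noteq> inverse w'"
proof
  assume w: "w = inverse w'"
  have w0: "w' \<noteq> 0" using assms w unfolding cube_region_def by auto
  have "Re w = Re w' / (norm w')\<^sup>2" unfolding w by (simp add: cmod_power2)
  then have re: "Re w > 0 \<longleftrightarrow> Re w' > 0" using w0 by (simp add: zero_less_divide_iff)
  have n: "norm w * norm w' = 1" unfolding w using w0 by (simp add: norm_mult[symmetric])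
  show False
  proof (cases "Re w > 0")
    case True
    then have "norm w > 1" "norm w' > 1" using assms re unfolding cube_region_def by auto
    then show False using mult_strict_mono'[of 1 "norm w" 1 "norm w'"] n by simp
  next
    case False
    then have "norm w < 1" "norm w' < 1" using assms re unfolding cube_region_def by auto
    then show False using mult_strict_mono'[of "norm w" 1 "norm w'" 1] n by simp
  qed
qed

text \<open>
  Cube roots differ by powers of \<open>\<omega>\<close>, which move the sector off itself.
\<close>
lemma wedge_cube_inj:
  assumes "z \<in> wedge" "z' \<in> wedge" "z ^ 3 = z' ^ 3"
  shows "z = z'"
proof -
  \<comment> \<open>factorisation of \<open>z ^ 3 - z' ^ 3\<close>, checked in coordinates\<close>
  have "(z - z') * ((z - \<omega> * z') * (z - \<omega>\<^sup>2 * z')) = z ^ 3 - z' ^ 3"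
    unfolding omega_facts(5) unfolding omega_complex
    by (simp add: complex_eq_iff power3_eq_cube power2_eq_square algebra_simps)
  then have "z = z' \<or> z = \<omega> * z' \<or> z = \<omega>\<^sup>2 * z'" using assms(3) by simp
  moreover have "z \<noteq> \<omega> * z'"
  proof
    assume "z = \<omega> * z'"
    then have "Re z = - Re z' / 2 - sqrt 3 / 2 * Im z'" by (simp add: omega_complex)
    moreover have "sqrt 3 / 2 * Im z' \<ge> 0" using assms(2) by (simp add: wedge_def)
    ultimately show False using assms(1,2) by (simp add: wedge_def)
  qed
  moreover have "z \<noteq> \<omega>\<^sup>2 * z'"
  proof
    assume "z = \<omega>\<^sup>2 * z'"
    then have "Im z = - sqrt 3 / 2 * Re z' - Im z' / 2" unfolding omega_facts(5) by simp
    moreover have "sqrt 3 / 2 * Re z' > 0" using assms(2) by (simp add: wedge_def)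
    ultimately show False using assms(1,2) by (simp add: wedge_def)
  qed
  ultimately show ?thesis by blast
qed

lemma base_cube_inj:
  assumes "k \<in> base_points" "k' \<in> base_points" "k ^ 3 = k' ^ 3"
  shows "k = k'"
proof (cases "Re (k ^ 3) > 0")
  case True
  then show ?thesis using base_cube(2)[OF assms(1)] base_cube(2)[OF assms(2)] assms(3) wedge_cube_inj by simp
next
  case False
  then have "- k \<in> wedge" "- k' \<in> wedge"
    using base_cube(3)[OF assms(1)] base_cube(3)[OF assms(2)] assms(3) by auto
  then have "- k = - k'" by (rule wedge_cube_inj) (use assms(3) in simp)
  then show ?thesis by simp
qed

text \<open>
  The cubes of base points in the outer component lie in the closed upper half plane, and those in the inner
  component in the lower one, so that such a cube is conjugate to another one only if both are real.
\<close>
lemma base_cube_cnj: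
  assumes "k \<in> base_points" "k' \<in> base_points" "k ^ 3 = cnj (k' ^ 3)"
  shows "Im k = 0" "Im k' = 0"
proof -
  have reE: "Re (k ^ 3) = Re (k' ^ 3)" and imE: "Im (k ^ 3) = - Im (k' ^ 3)"
    unfolding assms(3) by (simp_all del: complex_cnj_power)
  have "Im (k ^ 3) = 0"
  proof (cases "Re (k ^ 3) > 0")
    case True
    then have "Im (k ^ 3) \<ge> 0" "Im (k' ^ 3) \<ge> 0"
      using base_cube(2)[OF assms(1)] base_cube(2)[OF assms(2)] unfolding reE by blast+
    then show ?thesis using imE by linarith
  next
    case False
    then have "Im (k ^ 3) \<le> 0" "Im (k' ^ 3) \<le> 0"
      using base_cube(3)[OF assms(1)] base_cube(3)[OF assms(2)] unfolding reE not_less by blast+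
    then show ?thesis using imE by linarith
  qed
  then show "Im k = 0" "Im k' = 0"
    using base_cube(4)[OF assms(1)] base_cube(4)[OF assms(2)] imE by linarith+
qed

lemma Re_lfun: "Re (lfun j k) = - Im (rot j k) * (1 - 1 / (norm (rot j k))\<^sup>2) / (2 * sqrt 3)"
proof -
  define z where "z = rot j k"
  have "Im (inverse z) = - Im z / (norm z)\<^sup>2" by (simp add: cmod_power2)
  moreover have "Re (lfun j k) = - (Im z + Im (inverse z)) / (2 * sqrt 3)"
    unfolding lfun_def z_def[symmetric] by simp
  ultimately show ?thesis unfolding z_def[symmetric] by (simp add: right_diff_distrib)
qed

lemma norm_weight: "norm z > 1 \<Longrightarrow> 1 - 1 / (norm z)\<^sup>2 > 0" "norm z < 1 \<Longrightarrow> z \<noteq> 0 \<Longrightarrow> 1 - 1 / (norm z)\<^sup>2 < 0"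
  for z :: complex
  by (auto simp: divide_simps power_less_one_iff one_less_power)

lemma base_points_nonzero: "k \<in> base_points \<Longrightarrow> k \<noteq> 0" "k \<in> base_points \<Longrightarrow> norm k \<noteq> 1"
  by (auto simp: base_points_def wedge_def)

lemma Re_lfun3_neg:
  assumes k: "k \<in> base_points" "Im k \<noteq> 0"
  shows "Re (lfun 3 k) < 0"
proof -
  have r: "rot 3 k = k" by (simp add: rot_simps omega_facts)
  consider "norm k > 1" "k \<in> wedge" | "norm k < 1" "- k \<in> wedge" using k(1) unfolding base_points_def by blast
  then have "Im k * (1 - 1 / (norm k)\<^sup>2) > 0"
  proof cases
    case 1
    then show ?thesis using norm_weight(1)[of k] k(2) by (intro mult_pos_pos) (auto simp: wedge_def)
  next
    case 2
    then show ?thesis using norm_weight(2)[of k] k base_points_nonzero by (intro mult_neg_neg) (auto simp: wedge_def)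
  qed
  then show ?thesis unfolding Re_lfun r by (simp add: divide_neg_pos)
qed

lemma Re_lfun2_cnj_pos:
  assumes k: "k \<in> base_points"
  shows "Re (lfun 2 (cnj k)) > 0"
proof -
  define z where "z = rot 2 (cnj k)"
  have im: "Im z = - (sqrt 3 / 2 * Re k - Im k / 2)" unfolding z_def rot_simps omega_facts(5) by simp
  have n: "norm z = norm k" unfolding z_def norm_rot by simp
  have w: "sqrt 3 / 2 * Re y - Im y / 2 > 0" if "y \<in> wedge" for y
  proof -
    have "sqrt 3 * Im y \<ge> 1 * Im y" using that by (intro mult_right_mono) (auto simp: wedge_def)
    then have "Im y < Re y" using that by (simp add: wedge_def)
    moreover have "1 * Re y \<le> sqrt 3 * Re y" using that by (intro mult_right_mono) (auto simp: wedge_def)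
    ultimately show ?thesis by simp
  qed
  consider "norm k > 1" "k \<in> wedge" | "norm k < 1" "- k \<in> wedge" using k(1) unfolding base_points_def by blast
  then have "Im z * (1 - 1 / (norm z)\<^sup>2) < 0"
  proof cases
    case 1
    then show ?thesis using norm_weight(1)[of k] w[of k] im n by (intro mult_neg_pos) auto
  next
    case 2
    then show ?thesis using norm_weight(2)[of k] w[of "- k"] im n base_points_nonzero[OF k] by (intro mult_pos_neg) auto
  qed
  then have "Im z * (1 - 1 / (norm z)\<^sup>2) / (2 * sqrt 3) < 0" by (rule divide_neg_pos) simp
  then show ?thesis unfolding Re_lfun z_def[symmetric] by simp
qed

lemma cnj_lfun: "cnj (lfun 1 k) = - lfun 2 (cnj k)" "cnj (lfun 2 k) = - lfun 1 (cnj k)" "cnj (lfun 3 k) = - lfun 3 (cnj k)"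
  and cnj_zfun: "cnj (zfun 1 k) = - zfun 2 (cnj k)" "cnj (zfun 2 k) = - zfun 1 (cnj k)" "cnj (zfun 3 k) = - zfun 3 (cnj k)"
proof -
  have w: "cnj (\<omega>\<^sup>2) = \<omega>" by (simp only: omega_facts(4)[symmetric] complex_cnj_cnj)
  have r: "cnj (rot 1 k) = rot 2 (cnj k)" "cnj (rot 2 k) = rot 1 (cnj k)" "cnj (rot 3 k) = rot 3 (cnj k)"
    unfolding rot_simps omega_facts(1) complex_cnj_mult w omega_facts(4) by simp_all
  have c: "cnj (lfun j k) = - (\<i> * (cnj (rot j k) + inverse (cnj (rot j k))) / (2 * of_real (sqrt 3)))"
    "cnj (zfun j k) = - (\<i> * ((cnj (rot j k))\<^sup>2 + inverse ((cnj (rot j k))\<^sup>2)) / (4 * of_real (sqrt 3)))" for j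
    unfolding lfun_def zfun_def by simp_all
  show "cnj (lfun 1 k) = - lfun 2 (cnj k)" "cnj (lfun 2 k) = - lfun 1 (cnj k)" "cnj (lfun 3 k) = - lfun 3 (cnj k)"
    "cnj (zfun 1 k) = - zfun 2 (cnj k)" "cnj (zfun 2 k) = - zfun 1 (cnj k)" "cnj (zfun 3 k) = - zfun 3 (cnj k)"
    unfolding c r unfolding lfun_def zfun_def by (rule refl)+
qed

lemma lfun_rotate: "lfun 1 k = lfun 3 (\<omega> * k)" "lfun 2 k = lfun 3 (\<omega>\<^sup>2 * k)"
  unfolding lfun_def rot_simps omega_facts(1) by simp_all

lemma lfun3_eq_iff:
  assumes "k \<noteq> 0" "p \<noteq> 0"
  shows "lfun 3 k = lfun 3 p \<longleftrightarrow> k = p \<or> k = inverse p"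
proof -
  have "\<i> * ((k - p) * (k - inverse p)) / (2 * of_real (sqrt 3) * k) = 0 \<longleftrightarrow> k = p \<or> k = inverse p"
    using assms by simp
  then show ?thesis unfolding lfun3_diff[OF assms, symmetric] by simp
qed

section \<open>The linear system for the column sums\<close>

definition rowsum :: "(complex \<Rightarrow> complex^3^3) \<Rightarrow> 3 \<Rightarrow> complex \<Rightarrow> complex" where
  "rowsum M j k = (\<Sum>i\<in>UNIV. M k $ i $ j)"

lemma rowsum_eq: "(vector [1, 1, 1] v* M k) $ j = rowsum M j k"
  unfolding rowsum_def vector_matrix_mult_def by (simp add: sum_3)

lemma matrix_inv_Acal: "matrix_inv Acal = vector [vector [0, 1, 0], vector [0, 0, 1], vector [1, 0, 0]]"
  by (rule matrix_inv_eqI)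
     (simp add: Acal_def matrix_matrix_mult_def Finite_Cartesian_Product.vec_eq_iff forall_3 sum_3 Finite_Cartesian_Product.mat_def)

lemma rowsum_A:
  assumes "M k = Acal ** M k' ** matrix_inv Acal"
  shows "rowsum M 1 k = rowsum M 3 k'" "rowsum M 2 k = rowsum M 1 k'" "rowsum M 3 k = rowsum M 2 k'"
  unfolding rowsum_def assms matrix_inv_Acal
  by (simp_all add: Acal_def matrix_matrix_mult_def sum_3 add_ac)

lemma rowsum_B:
  assumes "M k = Bcal ** M k' ** Bcal"
  shows "rowsum M 3 k = rowsum M 3 k'"
  unfolding rowsum_def assms
  by (simp add: Bcal_def matrix_matrix_mult_def sum_3 add_ac)

lemma simple_pole_residue:
  assumes "at_most_simple_pole f a"
  shows "\<exists>l. ((\<lambda>k. f k - residue f a / (k - a)) \<longlongrightarrow> l) (at a)"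
proof -
  obtain \<rho> g where g: "g analytic_on {a}" "\<forall>\<^sub>F k in at a. f k = \<rho> / (k - a) + g k"
    using assms unfolding at_most_simple_pole_def by blast
  obtain S where S: "open S" "a \<in> S" "g holomorphic_on S" using g(1) analytic_at by blast
  have "residue f a = residue (\<lambda>k. (\<rho> + g k * (k - a)) / (k - a)) a"
  proof (rule residue_cong)
    show "\<forall>\<^sub>F k in at a. f k = (\<rho> + g k * (k - a)) / (k - a)"
      using g(2) eventually_neq_at_within[of a a UNIV]
      by eventually_elim (simp add: add_divide_distrib)
  qed simp
  also have "\<dots> = \<rho> + g a * (a - a)"
    by (rule residue_simple[OF S(1,2)]) (intro holomorphic_intros S(3))
  finally have res: "residue f a = \<rho>" by simp
  have "isCont g a" using g(1) by (simp add: analytic_at_imp_isCont)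
  then have "(g \<longlongrightarrow> g a) (at a)" by (simp add: isCont_def)
  then have "((\<lambda>k. f k - residue f a / (k - a)) \<longlongrightarrow> g a) (at a)"
    by (rule Lim_transform_eventually) (use g(2) in \<open>auto simp: res elim: eventually_mono\<close>)
  then show ?thesis by blast
qed

text \<open>
  Summing over the rows keeps the form of the residue condition, since its constant is the same in each row.
\<close>
lemma residue_condition_rowsum:
  assumes "residue_condition M a m n c"
  shows "j \<noteq> m \<Longrightarrow> (rowsum M j \<longlongrightarrow> rowsum M j a) (at a)"
    and "\<exists>l. ((\<lambda>k. rowsum M m k - c * rowsum M n a / (k - a)) \<longlongrightarrow> l) (at a)"
proof -
  show "(rowsum M j \<longlongrightarrow> rowsum M j a) (at a)" if "j \<noteq> m"
  proof -
    have "isCont (\<lambda>k. M k $ i $ j) a" for i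
      using assms that unfolding residue_condition_def col_analytic_def by (simp add: analytic_at_imp_isCont)
    then show ?thesis unfolding rowsum_def by (intro tendsto_sum) (simp add: isCont_def)
  qed
  have "\<forall>i. \<exists>l. ((\<lambda>k. M k $ i $ m - c * M a $ i $ n / (k - a)) \<longlongrightarrow> l) (at a)"
  proof
    fix i
    have "at_most_simple_pole (\<lambda>k. M k $ i $ m) a" "residue (\<lambda>k. M k $ i $ m) a = c * M a $ i $ n"
      using assms unfolding residue_condition_def by auto
    then show "\<exists>l. ((\<lambda>k. M k $ i $ m - c * M a $ i $ n / (k - a)) \<longlongrightarrow> l) (at a)"
      using simple_pole_residue[of "\<lambda>k. M k $ i $ m" a] by simp
  qed
  from choice[OF this] obtain l where "\<forall>i. ((\<lambda>k. M k $ i $ m - c * M a $ i $ n / (k - a)) \<longlongrightarrow> l i) (at a)" by blast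
  then have "((\<lambda>k. \<Sum>i\<in>UNIV. M k $ i $ m - c * M a $ i $ n / (k - a)) \<longlongrightarrow> (\<Sum>i\<in>UNIV. l i)) (at a)"
    by (intro tendsto_sum) blast
  then show "\<exists>l. ((\<lambda>k. rowsum M m k - c * rowsum M n a / (k - a)) \<longlongrightarrow> l) (at a)"
    unfolding rowsum_def sum_subtractf sum_divide_distrib[symmetric] sum_distrib_left[symmetric] by blast
qed

lemma tendsto_at_mult:
  fixes g :: "complex \<Rightarrow> complex"
  assumes "(g \<longlongrightarrow> l) (at (w * z))" "w \<noteq> 0"
  shows "((\<lambda>k. g (w * k)) \<longlongrightarrow> l) (at z)"
proof (rule filterlim_compose[OF assms(1)])
  have "((\<lambda>k. w * k) \<longlongrightarrow> w * z) (at z)" by (intro tendsto_intros)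
  moreover have "\<forall>\<^sub>F k in at z. w * k \<noteq> w * z"
    using eventually_neq_at_within[of z z UNIV] assms(2) by (auto elim: eventually_mono)
  ultimately show "filterlim (\<lambda>k. w * k) (at (w * z)) (at z)" by (simp add: filterlim_at)
qed

lemma omega_mult: "\<omega> * (\<omega>\<^sup>2 * k) = k" "\<omega>\<^sup>2 * (\<omega> * k) = k"
proof -
  have "\<omega> * \<omega>\<^sup>2 = 1" "\<omega>\<^sup>2 * \<omega> = 1"
    using omega_facts(1) by (simp_all add: power3_eq_cube power2_eq_square mult.assoc)
  then show "\<omega> * (\<omega>\<^sup>2 * k) = k" "\<omega>\<^sup>2 * (\<omega> * k) = k" by (simp_all add: mult.assoc[symmetric])
qed

lemma inverse_omega_mult:
  "inverse (\<omega> * z) = \<omega>\<^sup>2 * inverse z" "inverse (\<omega>\<^sup>2 * z) = \<omega> * inverse z"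
proof -
  have "inverse \<omega> = \<omega>\<^sup>2" by (rule inverse_unique) (use omega_mult(1)[of 1] in simp)
  moreover have "inverse (\<omega>\<^sup>2) = \<omega>" by (rule inverse_unique) (use omega_mult(2)[of 1] in simp)
  ultimately show "inverse (\<omega> * z) = \<omega>\<^sup>2 * inverse z" "inverse (\<omega>\<^sup>2 * z) = \<omega> * inverse z"
    by simp_all
qed

definition rotation_orbit :: "complex set \<Rightarrow> complex set" where
  "rotation_orbit Q = Q \<union> (\<lambda>k. \<omega> * k) ` Q \<union> (\<lambda>k. \<omega>\<^sup>2 * k) ` Q"

lemma rotation_orbit_closed:
  assumes "z \<in> rotation_orbit Q"
  shows "\<omega> * z \<in> rotation_orbit Q" "\<omega>\<^sup>2 * z \<in> rotation_orbit Q"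
proof -
  have w: "\<omega> * (\<omega> * k) = \<omega>\<^sup>2 * k" "\<omega>\<^sup>2 * (\<omega>\<^sup>2 * k) = \<omega> * k" for k
    using omega_mult(1)[of "\<omega> * k"] by (simp_all add: power2_eq_square mult_ac)
  consider "z \<in> Q" | k where "k \<in> Q" "z = \<omega> * k" | k where "k \<in> Q" "z = \<omega>\<^sup>2 * k"
    using assms unfolding rotation_orbit_def by blast
  then have "\<omega> * z \<in> rotation_orbit Q \<and> \<omega>\<^sup>2 * z \<in> rotation_orbit Q"
  proof cases
    case 1
    then show ?thesis unfolding rotation_orbit_def by blast
  next
    case (2 k)
    then show ?thesis unfolding 2(2) w(1) omega_mult(2) rotation_orbit_def by blast
  next
    case (3 k)
    then show ?thesis unfolding 3(2) w(2) omega_mult(1) rotation_orbit_def by blast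
  qed
  then show "\<omega> * z \<in> rotation_orbit Q" "\<omega>\<^sup>2 * z \<in> rotation_orbit Q" by blast+
qed

locale soliton_points =
  fixes lams mus :: "complex list"
  assumes lams_distinct: "distinct lams" and mus_distinct: "distinct mus"
    and lams_base: "set lams \<subseteq> base_points" and lams_Im: "\<And>k. k \<in> set lams \<Longrightarrow> Im k \<noteq> 0"
    and mus_base: "set mus \<subseteq> base_points" and mus_Im: "\<And>k. k \<in> set mus \<Longrightarrow> Im k = 0"
begin

definition nb :: nat where "nb = length lams"
definition N :: nat where "N = 2 * nb + length mus"

text \<open>
  All families indexed by the \<open>N\<close> poles are defined in three pieces: the points \<open>\<nu>\<close> of \<open>lams\<close>, their
  conjugates, and the real points of \<open>mus\<close>.
\<close>
definition piece :: "(complex \<Rightarrow> 'a) \<Rightarrow> (complex \<Rightarrow> 'a) \<Rightarrow> (complex \<Rightarrow> 'a) \<Rightarrow> nat \<Rightarrow> 'a" where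
  "piece f g h b = (if b < nb then f (lams ! b) else if b < 2 * nb then g (lams ! (b - nb)) else h (mus ! (b - 2 * nb)))"

lemma piece_simps [simp]:
  "b < nb \<Longrightarrow> piece f g h b = f (lams ! b)"
  "nb \<le> b \<Longrightarrow> b < 2 * nb \<Longrightarrow> piece f g h b = g (lams ! (b - nb))"
  "2 * nb \<le> b \<Longrightarrow> piece f g h b = h (mus ! (b - 2 * nb))"
  by (auto simp: piece_def)

lemma index_cases:
  assumes "b < N"
  obtains (first) "b < nb" "lams ! b \<in> set lams"
  | (second) "nb \<le> b" "b < 2 * nb" "lams ! (b - nb) \<in> set lams"
  | (third) "2 * nb \<le> b" "mus ! (b - 2 * nb) \<in> set mus"
proof -
  consider "b < nb" | "nb \<le> b" "b < 2 * nb" | "2 * nb \<le> b" by linarith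
  then show thesis
  proof cases
    case 1
    then show thesis by (intro first) (auto simp: nb_def)
  next
    case 2
    then show thesis by (intro second) (auto simp: nb_def)
  next
    case 3
    then show thesis using assms by (intro third) (auto simp: nb_def N_def)
  qed
qed

text \<open>
  \<open>q\<close> is the point at which the residue condition is posed, \<open>p\<close> the rotated point at which it gives a pole of the
  third column sum \<open>f\<close>, and \<open>a\<close> the rotated point at which its right-hand side evaluates \<open>f\<close>.
\<close>
definition q :: "nat \<Rightarrow> complex" where "q = piece (\<lambda>k. k) cnj (\<lambda>k. k)"
definition p :: "nat \<Rightarrow> complex" where "p = piece (\<lambda>k. k) (\<lambda>k. \<omega>\<^sup>2 * cnj k) (\<lambda>k. \<omega>\<^sup>2 * k)"
definition a :: "nat \<Rightarrow> complex" where "a = piece (\<lambda>k. \<omega> * k) cnj (\<lambda>k. \<omega> * k)"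

lemma p_a_cube: "p b ^ 3 = q b ^ 3" "a b ^ 3 = q b ^ 3"
proof -
  have "(\<omega>\<^sup>2) ^ 3 = 1" using omega_facts(1) by (metis power_commutes power_mult power_one mult.commute)
  then show "p b ^ 3 = q b ^ 3" "a b ^ 3 = q b ^ 3"
    by (simp_all add: p_def q_def a_def piece_def power_mult_distrib omega_facts(1))
qed

lemma q_cube: "b < N \<Longrightarrow> q b ^ 3 \<in> cube_region"
  by (erule index_cases)
     (use lams_base mus_base base_cube(1) cube_region_cnj in
        \<open>auto simp: q_def simp flip: complex_cnj_power\<close>)

text \<open>
  Everything about coincidences among poles and evaluation points reduces to this: the cubes of the points
  \<open>q\<close> are distinct, as the cubes of distinct base points are distinct and the nonreal ones are never conjugate.
\<close>
lemma q_cube_inj: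
  assumes b: "b < N" and b': "b' < N" and eq: "q b ^ 3 = q b' ^ 3"
  shows "b = b'"
proof -
  have LL: "lams ! i = lams ! j \<Longrightarrow> i = j" if "i < nb" "j < nb" for i j
    using lams_distinct that unfolding nb_def by (simp add: nth_eq_iff_index_eq)
  have MM: "mus ! i = mus ! j \<Longrightarrow> i = j" if "i < length mus" "j < length mus" for i j
    using mus_distinct that by (simp add: nth_eq_iff_index_eq)
  have inj: "k = k'" if "k \<in> base_points" "k' \<in> base_points" "k ^ 3 = k' ^ 3" for k k'
    by (rule base_cube_inj[OF that])
  have Lb: "k \<in> base_points" "Im k \<noteq> 0" if "k \<in> set lams" for k using lams_base lams_Im that by auto
  have Mb: "k \<in> base_points" "Im k = 0" "cnj k = k" if "k \<in> set mus" for k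
    using mus_base mus_Im that by (auto simp: complex_eq_iff)
  from b show ?thesis
  proof (cases rule: index_cases)
    case first
    from b' show ?thesis
    proof (cases rule: index_cases)
      case first': first
      have "lams ! b = lams ! b'" by (rule inj[OF Lb(1)[OF first(2)] Lb(1)[OF first'(2)]]) (use eq in \<open>simp add: q_def first first'\<close>)
      then show ?thesis using LL first first' by blast
    next
      case second
      then have "(lams ! b) ^ 3 = cnj ((lams ! (b' - nb)) ^ 3)" using eq by (simp add: q_def first)
      then show ?thesis using base_cube_cnj(1) Lb first second by blast
    next
      case third
      have "lams ! b = mus ! (b' - 2 * nb)"
        by (rule inj[OF Lb(1)[OF first(2)] Mb(1)[OF third(2)]]) (use eq in \<open>simp add: q_def first third\<close>)
      then show ?thesis using Lb Mb first third by metis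
    qed
  next
    case second
    from b' show ?thesis
    proof (cases rule: index_cases)
      case first
      then have "(lams ! b') ^ 3 = cnj ((lams ! (b - nb)) ^ 3)" using eq by (simp add: q_def second)
      then show ?thesis using base_cube_cnj(1) Lb first second by blast
    next
      case second': second
      have "cnj ((lams ! (b - nb)) ^ 3) = cnj ((lams ! (b' - nb)) ^ 3)" using eq by (simp add: q_def second second')
      then have "lams ! (b - nb) = lams ! (b' - nb)" by (intro inj[OF Lb(1)[OF second(3)] Lb(1)[OF second'(3)]]) (simp only: complex_cnj_cancel_iff)
      then have "b - nb = b' - nb" using LL second second' by simp
      then show ?thesis using second second' by linarith
    next
      case third
      then have "(mus ! (b' - 2 * nb)) ^ 3 = cnj ((lams ! (b - nb)) ^ 3)" using eq by (simp add: q_def second)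
      then show ?thesis using base_cube_cnj(2) Lb Mb second third by blast
    qed
  next
    case third
    from b' show ?thesis
    proof (cases rule: index_cases)
      case first
      have "lams ! b' = mus ! (b - 2 * nb)"
        by (rule inj[OF Lb(1)[OF first(2)] Mb(1)[OF third(2)]]) (use eq in \<open>simp add: q_def first third\<close>)
      then show ?thesis using Lb Mb first third by metis
    next
      case second
      then have "(mus ! (b - 2 * nb)) ^ 3 = cnj ((lams ! (b' - nb)) ^ 3)" using eq by (simp add: q_def third)
      then show ?thesis using base_cube_cnj(2) Lb Mb second third by blast
    next
      case third': third
      have "mus ! (b - 2 * nb) = mus ! (b' - 2 * nb)" by (rule inj[OF Mb(1)[OF third(2)] Mb(1)[OF third'(2)]]) (use eq in \<open>simp add: q_def third third'\<close>)
      then have "b - 2 * nb = b' - 2 * nb" using MM b b' third third' unfolding N_def by simp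
      then show ?thesis using third third' by linarith
    qed
  qed
qed

lemma q_nonzero: "b < N \<Longrightarrow> q b \<noteq> 0"
  using q_cube[of b] by (auto simp: cube_region_def)

lemma p_nonzero: "b < N \<Longrightarrow> p b \<noteq> 0" and a_nonzero: "b < N \<Longrightarrow> a b \<noteq> 0"
  using q_cube[of b] p_a_cube[of b] by (auto simp: cube_region_def)

lemma p_inj: "inj_on p {..<N}"
proof (rule inj_onI)
  fix b b' assume "b \<in> {..<N}" "b' \<in> {..<N}" "p b = p b'"
  then show "b = b'" using q_cube_inj[of b b'] p_a_cube(1)[of b] p_a_cube(1)[of b'] by simp
qed

lemma not_inverse: "b < N \<Longrightarrow> b' < N \<Longrightarrow> p b \<noteq> inverse (p b')" "b < N \<Longrightarrow> b' < N \<Longrightarrow> a b \<noteq> inverse (p b')"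
proof -
  have *: "x \<noteq> inverse y" if "x ^ 3 \<in> cube_region" "y ^ 3 \<in> cube_region" for x y :: complex
    using cube_region_inverse[OF that] by (auto simp: power_inverse)
  show "b < N \<Longrightarrow> b' < N \<Longrightarrow> p b \<noteq> inverse (p b')" "b < N \<Longrightarrow> b' < N \<Longrightarrow> a b \<noteq> inverse (p b')"
    by (rule *; simp only: p_a_cube q_cube)+
qed

lemma omega_neq: "z \<noteq> 0 \<Longrightarrow> \<omega> * z \<noteq> z" "z \<noteq> 0 \<Longrightarrow> \<omega>\<^sup>2 * z \<noteq> z" "z \<noteq> 0 \<Longrightarrow> \<omega> * z \<noteq> \<omega>\<^sup>2 * z"
proof -
  have "\<omega> \<noteq> 1" "\<omega>\<^sup>2 \<noteq> 1" "\<omega> \<noteq> \<omega>\<^sup>2" unfolding omega_facts(5) unfolding omega_complex by (auto simp: complex_eq_iff)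
  then show "z \<noteq> 0 \<Longrightarrow> \<omega> * z \<noteq> z" "z \<noteq> 0 \<Longrightarrow> \<omega>\<^sup>2 * z \<noteq> z" "z \<noteq> 0 \<Longrightarrow> \<omega> * z \<noteq> \<omega>\<^sup>2 * z"
    by (simp_all add: mult_cancel_right)
qed

lemma a_neq_p:
  assumes "b < N" "b' < N"
  shows "a b \<noteq> p b'"
proof
  assume eq: "a b = p b'"
  then have "b = b'" using q_cube_inj[OF assms] p_a_cube(2)[of b] p_a_cube(1)[of b'] by simp
  then have "a b = p b" using eq by simp
  moreover have "a b \<noteq> p b"
    using assms(1) q_nonzero[OF assms(1)] omega_neq
    by (cases rule: index_cases) (auto simp: a_def p_def q_def dest!: not_sym)
  ultimately show False by blast
qed

definition L :: "nat \<Rightarrow> complex" where "L = piece (lfun 1) (\<lambda>k. lfun 3 (cnj k)) (lfun 1)"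
definition L' :: "nat \<Rightarrow> complex" where "L' = piece (lfun 3) (\<lambda>k. lfun 2 (cnj k)) (lfun 2)"

lemma L_eq: "L b = lfun 3 (a b)" and L'_eq: "L' b = lfun 3 (p b)"
  by (simp_all add: L_def L'_def a_def p_def piece_def lfun_rotate)

lemma hker_eq_L: "b < N \<Longrightarrow> b' < N \<Longrightarrow> hker (p b') (a b) = 1 / (L b - L' b')"
  unfolding L_eq L'_eq by (rule hker_eq[OF a_nonzero p_nonzero])

lemma L_neq: "b < N \<Longrightarrow> b' < N \<Longrightarrow> L b \<noteq> L' b'"
  unfolding L_eq L'_eq using lfun3_eq_iff[OF a_nonzero p_nonzero] a_neq_p not_inverse(2) by blast

lemma L'_inj: "inj_on L' {..<N}"
proof (rule inj_onI)
  fix b b' assume "b \<in> {..<N}" "b' \<in> {..<N}" "L' b = L' b'"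
  then show "b = b'" unfolding L'_eq using lfun3_eq_iff[OF p_nonzero p_nonzero, of b b'] not_inverse(1)[of b b'] inj_onD[OF p_inj] by auto
qed

definition base :: "complex set" where "base = set lams \<union> cnj ` set lams \<union> set mus"

text \<open>
  The Riemann-Hilbert problem reduced to a linear system.  The symmetries transport the behaviour of the
  three column sums at a point \<open>q\<close> to the behaviour of \<open>f\<close> at \<open>q\<close>, \<open>\<omega> q\<close> and \<open>\<omega>\<^sup>2 q\<close>.
\<close>
theorem row_sum_system:
  fixes M :: "complex \<Rightarrow> complex^3^3" and cl dl cm :: "complex \<Rightarrow> complex"
  assumes Z_def: "Z = rotation_orbit base \<union> inverse ` rotation_orbit base"
    and an: "\<And>i j. (\<lambda>k. M k $ i $ j) analytic_on - Z"
    and A: "\<And>k. k \<notin> Z \<Longrightarrow> M k = Acal ** M (\<omega> * k) ** matrix_inv Acal"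
    and B: "\<And>k. k \<notin> Z \<Longrightarrow> k \<noteq> 0 \<Longrightarrow> M k = Bcal ** M (inverse k) ** Bcal"
    and inf: "(rowsum M 3 \<longlongrightarrow> 1) at_infinity"
    and resl: "\<And>k. k \<in> set lams \<Longrightarrow> residue_condition M k 3 1 (cl k)"
    and resd: "\<And>k. k \<in> set lams \<Longrightarrow> residue_condition M (cnj k) 2 3 (dl k)"
    and resm: "\<And>k. k \<in> set mus \<Longrightarrow> residue_condition M k 2 1 (cm k)"
  defines "R \<equiv> piece (\<lambda>k. l3_deriv k * cl k) (\<lambda>k. l3_deriv (\<omega>\<^sup>2 * cnj k) * (\<omega>\<^sup>2 * dl k)) (\<lambda>k. l3_deriv (\<omega>\<^sup>2 * k) * (\<omega>\<^sup>2 * cm k))"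
  shows "\<exists>v. (\<forall>b<N. v b = 1 + (\<Sum>b'<N. R b' * v b' / (L b - L' b'))) \<and>
    ((\<lambda>k. k * (rowsum M 3 k - 1)) \<longlongrightarrow> 2 * of_real (sqrt 3) / \<i> * (\<Sum>b<N. R b * v b)) at_infinity"
proof -
  let ?f = "rowsum M 3"
  have base0: "0 \<notin> base" using lams_base mus_base base_points_nonzero(1) unfolding base_def by auto
  have orb0: "0 \<notin> rotation_orbit base" using base0 omega_facts(3) unfolding rotation_orbit_def by auto
  have Z0: "0 \<notin> Z" using orb0 unfolding Z_def by auto
  have Zfin: "finite Z" unfolding Z_def rotation_orbit_def base_def by simp
  have Zinv: "inverse z \<in> Z" if "z \<in> Z" for z using that unfolding Z_def by auto
  have Zrot: "\<omega> * z \<in> Z" "\<omega>\<^sup>2 * z \<in> Z" if zZ: "z \<in> Z" for z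
  proof -
    have "\<omega> * z \<in> Z \<and> \<omega>\<^sup>2 * z \<in> Z"
    proof (cases "z \<in> rotation_orbit base")
      case True
      then show ?thesis using rotation_orbit_closed[of z base] unfolding Z_def by blast
    next
      case False
      then obtain y where y: "y \<in> rotation_orbit base" "z = inverse y" using zZ unfolding Z_def by blast
      have "\<omega> * z = inverse (\<omega>\<^sup>2 * y)" "\<omega>\<^sup>2 * z = inverse (\<omega> * y)" unfolding inverse_omega_mult y(2) by (rule refl)+
      then show ?thesis using rotation_orbit_closed[OF y(1)] unfolding Z_def by blast
    qed
    then show "\<omega> * z \<in> Z" "\<omega>\<^sup>2 * z \<in> Z" by blast+
  qed
  have Zrot': "\<omega>\<^sup>2 * k \<notin> Z" "\<omega> * k \<notin> Z" if "k \<notin> Z" for k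
    using Zrot[of "\<omega>\<^sup>2 * k"] Zrot[of "\<omega> * k"] that by (auto simp: omega_mult)
  have f2: "?f k = rowsum M 2 (\<omega> * k)" if "k \<notin> Z" for k
    using rowsum_A(3)[of M k "\<omega> * k"] A[OF that] by blast
  have f1: "?f k = rowsum M 1 (\<omega>\<^sup>2 * k)" if "k \<notin> Z" for k
    using rowsum_A(1)[of M "\<omega>\<^sup>2 * k" "\<omega> * (\<omega>\<^sup>2 * k)"] A[OF Zrot'(1)[OF that]] by (simp add: omega_mult)
  have sym: "?f k = ?f (inverse k)" if "k \<notin> Z" "k \<noteq> 0" for k
    using rowsum_B[of M k "inverse k"] B[OF that] by blast
  have evZ: "\<forall>\<^sub>F k in at z. k \<notin> Z \<and> k \<noteq> 0" for z
  proof -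
    have "\<forall>\<^sub>F k in at z. k \<notin> insert 0 Z"
      using islimpt_finite[of "insert 0 Z" z] Zfin by (simp add: islimpt_iff_eventually)
    then show ?thesis by (rule eventually_mono) auto
  qed
  have lim1: "(?f \<longlongrightarrow> l) (at (\<omega> * z))" if "(rowsum M 1 \<longlongrightarrow> l) (at z)" for z l
  proof -
    have "((\<lambda>k. rowsum M 1 (\<omega>\<^sup>2 * k)) \<longlongrightarrow> l) (at (\<omega> * z))"
      by (rule tendsto_at_mult) (use that omega_facts(3) in \<open>simp_all add: omega_mult\<close>)
    then show ?thesis
      by (rule Lim_transform_eventually) (rule eventually_mono[OF evZ], simp add: f1)
  qed
  have lim2: "(?f \<longlongrightarrow> l) (at (\<omega>\<^sup>2 * z))" if "(rowsum M 2 \<longlongrightarrow> l) (at z)" for z l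
  proof -
    have "((\<lambda>k. rowsum M 2 (\<omega> * k)) \<longlongrightarrow> l) (at (\<omega>\<^sup>2 * z))"
      by (rule tendsto_at_mult) (use that omega_facts(3) in \<open>simp_all add: omega_mult\<close>)
    then show ?thesis
      by (rule Lim_transform_eventually) (rule eventually_mono[OF evZ], simp add: f2)
  qed
  have pole2: "\<exists>l. ((\<lambda>k. ?f k - \<omega>\<^sup>2 * \<rho> / (k - \<omega>\<^sup>2 * z)) \<longlongrightarrow> l) (at (\<omega>\<^sup>2 * z))"
    if ex: "\<exists>l. ((\<lambda>k. rowsum M 2 k - \<rho> / (k - z)) \<longlongrightarrow> l) (at z)" for z \<rho>
  proof -
    obtain l where "((\<lambda>k. rowsum M 2 k - \<rho> / (k - z)) \<longlongrightarrow> l) (at z)" using ex by blast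
    then have "((\<lambda>k. rowsum M 2 (\<omega> * k) - \<rho> / (\<omega> * k - z)) \<longlongrightarrow> l) (at (\<omega>\<^sup>2 * z))"
      by (intro tendsto_at_mult[where g = "\<lambda>k. rowsum M 2 k - \<rho> / (k - z)"]) (simp_all add: omega_mult omega_facts(3))
    moreover have "\<rho> / (\<omega> * k - z) = \<omega>\<^sup>2 * \<rho> / (k - \<omega>\<^sup>2 * z)" for k
    proof -
      have "\<omega>\<^sup>2 * (\<omega> * k - z) = k - \<omega>\<^sup>2 * z" by (simp add: right_diff_distrib omega_mult)
      moreover have "\<omega>\<^sup>2 * \<rho> / (\<omega>\<^sup>2 * (\<omega> * k - z)) = \<rho> / (\<omega> * k - z)" using omega_facts(3) by simp
      ultimately show ?thesis by simp
    qed
    ultimately have "((\<lambda>k. rowsum M 2 (\<omega> * k) - \<omega>\<^sup>2 * \<rho> / (k - \<omega>\<^sup>2 * z)) \<longlongrightarrow> l) (at (\<omega>\<^sup>2 * z))" by simp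
    then have "((\<lambda>k. ?f k - \<omega>\<^sup>2 * \<rho> / (k - \<omega>\<^sup>2 * z)) \<longlongrightarrow> l) (at (\<omega>\<^sup>2 * z))"
      by (rule Lim_transform_eventually) (rule eventually_mono[OF evZ], simp add: f2)
    then show ?thesis by blast
  qed
  note rl = residue_condition_rowsum[OF resl]
  note rd = residue_condition_rowsum[OF resd]
  note rm = residue_condition_rowsum[OF resm]
  define v where "v = piece (rowsum M 1) (\<lambda>k. rowsum M 3 (cnj k)) (rowsum M 1)"
  define \<rho> where "\<rho> = piece (\<lambda>k. cl k * rowsum M 1 k) (\<lambda>k. \<omega>\<^sup>2 * (dl k * rowsum M 3 (cnj k))) (\<lambda>k. \<omega>\<^sup>2 * (cm k * rowsum M 1 k))"
  have R\<rho>: "\<rho> b * l3_deriv (p b) = R b * v b" for b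
    by (simp add: \<rho>_def R_def v_def p_def piece_def mult_ac)
  have val: "(?f \<longlongrightarrow> v b) (at (a b))" if "b < N" for b
    using that
  proof (cases rule: index_cases)
    case first
    then show ?thesis using lim1[OF rl(1), of "lams ! b"] by (simp add: v_def a_def)
  next
    case second
    then show ?thesis using rd(1)[of "lams ! (b - nb)" 3] by (simp add: v_def a_def)
  next
    case third
    then show ?thesis using lim1[OF rm(1), of "mus ! (b - 2 * nb)"] by (simp add: v_def a_def)
  qed
  have poles: "\<exists>l. ((\<lambda>k. ?f k - \<rho> b / (k - p b)) \<longlongrightarrow> l) (at (p b))" if "b < N" for b
    using that
  proof (cases rule: index_cases)
    case first
    then show ?thesis using rl(2)[of "lams ! b"] by (simp add: \<rho>_def p_def)
  next
    case second
    then show ?thesis using pole2[OF rd(2), of "lams ! (b - nb)"] by (simp add: \<rho>_def p_def)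
  next
    case third
    then show ?thesis using pole2[OF rm(2), of "mus ! (b - 2 * nb)"] by (simp add: \<rho>_def p_def)
  qed
  have pim: "k \<in> p ` {..<N}" "\<omega>\<^sup>2 * cnj k \<in> p ` {..<N}" if kl: "k \<in> set lams" for k
  proof -
    obtain i where i: "i < nb" "lams ! i = k" using kl unfolding nb_def in_set_conv_nth by blast
    then have "p i = k" "p (nb + i) = \<omega>\<^sup>2 * cnj k" "i < N" "nb + i < N" by (simp_all add: p_def piece_def N_def)
    then show "k \<in> p ` {..<N}" "\<omega>\<^sup>2 * cnj k \<in> p ` {..<N}" by (metis imageI lessThan_iff)+
  qed
  have pim': "\<omega>\<^sup>2 * k \<in> p ` {..<N}" if km: "k \<in> set mus" for k
  proof -
    obtain i where i: "i < length mus" "mus ! i = k" using km unfolding in_set_conv_nth by blast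
    then have "p (2 * nb + i) = \<omega>\<^sup>2 * k" "2 * nb + i < N" by (simp_all add: p_def piece_def N_def)
    then show ?thesis by (metis imageI lessThan_iff)
  qed
  have reg0: "z \<in> p ` {..<N} \<or> (\<exists>l. (?f \<longlongrightarrow> l) (at z))" if z: "z \<in> rotation_orbit base" for z
  proof -
    consider k where "k \<in> set lams" "z = k \<or> z = \<omega> * k \<or> z = \<omega>\<^sup>2 * k"
      | k where "k \<in> set lams" "z = cnj k \<or> z = \<omega> * cnj k \<or> z = \<omega>\<^sup>2 * cnj k"
      | k where "k \<in> set mus" "z = k \<or> z = \<omega> * k \<or> z = \<omega>\<^sup>2 * k"
      using z unfolding rotation_orbit_def base_def by blast
    then show ?thesis
    proof cases
      case (1 k)
      then show ?thesis using pim lim1[OF rl(1), of k] lim2[OF rl(1), of k] by auto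
    next
      case (2 k)
      then show ?thesis using pim lim1[OF rd(1), of k] rd(1)[of k 3] by auto
    next
      case (3 k)
      then show ?thesis using pim' lim1[OF rm(1), of k] rm(1)[of k 3] by auto
    qed
  qed
  have reg: "z \<in> p ` {..<N} \<or> inverse z \<in> p ` {..<N} \<or> (\<exists>l. (?f \<longlongrightarrow> l) (at z))" if z: "z \<in> Z" for z
  proof (cases "z \<in> rotation_orbit base")
    case True
    then show ?thesis using reg0 by blast
  next
    case False
    then have iz: "inverse z \<in> rotation_orbit base" using z unfolding Z_def by auto
    then consider "inverse z \<in> p ` {..<N}" | l where "(?f \<longlongrightarrow> l) (at (inverse z))" using reg0 by blast
    then show ?thesis
    proof cases
      case (2 l)
      have "z \<noteq> 0" using z Z0 by blast
      then have "((\<lambda>k. ?f (inverse k)) \<longlongrightarrow> l) (at z)" by (rule tendsto_at_inverse[OF 2])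
      then have "(?f \<longlongrightarrow> l) (at z)"
        by (rule Lim_transform_eventually) (rule eventually_mono[OF evZ], simp add: sym[symmetric])
      then show ?thesis by blast
    qed blast
  qed
  have pZ: "p b \<in> Z" if "b < N" for b
    using that by (cases rule: index_cases) (auto simp: p_def Z_def rotation_orbit_def base_def)
  have f_an: "?f analytic_on - Z" unfolding rowsum_def by (intro analytic_intros an)
  note rep = inversion_symmetric_rational[OF Zfin Z0 Zinv f_an sym inf pZ p_inj not_inverse(1) poles reg]
  have "v b = 1 + (\<Sum>b'<N. R b' * v b' / (L b - L' b'))" if b: "b < N" for b
  proof -
    have cont: "((\<lambda>k. 1 + (\<Sum>b'<N. \<rho> b' * l3_deriv (p b') * hker (p b') k)) \<longlongrightarrow>
        1 + (\<Sum>b'<N. \<rho> b' * l3_deriv (p b') * hker (p b') (a b))) (at (a b))"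
      using hker_continuous[of "a b"] a_neq_p[OF b] not_inverse(2)[OF b]
      by (intro tendsto_add tendsto_const tendsto_sum tendsto_mult_left) (auto simp: isCont_def)
    have "(?f \<longlongrightarrow> 1 + (\<Sum>b'<N. \<rho> b' * l3_deriv (p b') * hker (p b') (a b))) (at (a b))"
      by (rule Lim_transform_eventually[OF cont]) (rule eventually_mono[OF evZ], simp add: rep(1))
    then have "v b = 1 + (\<Sum>b'<N. \<rho> b' * l3_deriv (p b') * hker (p b') (a b))"
      using tendsto_unique[OF _ val[OF b]] by simp
    also have "(\<Sum>b'<N. \<rho> b' * l3_deriv (p b') * hker (p b') (a b)) = (\<Sum>b'<N. R b' * v b' / (L b - L' b'))"
      by (intro sum.cong refl) (simp add: hker_eq_L[OF b] R\<rho>)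
    finally show ?thesis .
  qed
  moreover have "((\<lambda>k. k * (?f k - 1)) \<longlongrightarrow> 2 * of_real (sqrt 3) / \<i> * (\<Sum>b<N. R b * v b)) at_infinity"
    using rep(2) unfolding R\<rho> .
  ultimately show ?thesis by blast
qed

end

section \<open>The tau function\<close>

context soliton_points
begin

definition Zf :: "nat \<Rightarrow> complex" where "Zf = piece (zfun 1) (\<lambda>k. zfun 3 (cnj k)) (zfun 1)"
definition Zf' :: "nat \<Rightarrow> complex" where "Zf' = piece (zfun 3) (\<lambda>k. zfun 2 (cnj k)) (zfun 2)"

text \<open>
  Conjugation exchanges the two halves of the data of a breather.
\<close>
definition hat :: "nat \<Rightarrow> nat" where
  "hat b = (if b < nb then b + nb else if b < 2 * nb then b - nb else b)"

lemma hat_L: "b < N \<Longrightarrow> L (hat b) = - cnj (L' b)" and hat_Z: "b < N \<Longrightarrow> Zf (hat b) = - cnj (Zf' b)"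
proof -
  have mu: "cnj k = k" if "k \<in> set mus" for k using mus_Im[OF that] by (simp add: complex_eq_iff)
  assume b: "b < N"
  then have "L (hat b) = - cnj (L' b) \<and> Zf (hat b) = - cnj (Zf' b)"
  proof (cases rule: index_cases)
    case first
    then show ?thesis by (simp add: hat_def L_def L'_def Zf_def Zf'_def cnj_lfun cnj_zfun)
  next
    case second
    then have "b - nb < nb" "\<not> b < nb" by auto
    then show ?thesis using second by (simp add: hat_def L_def L'_def Zf_def Zf'_def cnj_lfun cnj_zfun)
  next
    case third
    then have "\<not> b < nb" "\<not> b < 2 * nb" by auto
    then show ?thesis using third mu[OF third(2)] by (simp add: hat_def L_def L'_def Zf_def Zf'_def cnj_lfun cnj_zfun)
  qed
  then show "L (hat b) = - cnj (L' b)" "Zf (hat b) = - cnj (Zf' b)" by auto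
qed

lemma paired_cauchy_phases:
  fixes y t :: real
  shows "paired_cauchy N hat L L' (\<lambda>b. exp (of_real y * L b + of_real t * Zf b))
    (\<lambda>b. exp (- (of_real y * L' b) - of_real t * Zf' b)) {..<nb}"
proof
  fix b assume b: "b < N"
  show "hat b < N" "hat (hat b) = b" using b by (auto simp: hat_def N_def)
  show "L (hat b) = - cnj (L' b)" by (rule hat_L[OF b])
  show "exp (of_real y * L (hat b) + of_real t * Zf (hat b)) = cnj (exp (- (of_real y * L' b) - of_real t * Zf' b))"
    by (simp add: hat_L[OF b] hat_Z[OF b] exp_cnj)
  show "exp (of_real y * L b + of_real t * Zf b) \<noteq> 0" by simp
next
  show "inj_on L' {..<N}" by (rule L'_inj)
  show "{..<nb} \<subseteq> {..<N}" by (auto simp: N_def)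
next
  fix b assume b: "b \<in> {..<nb}"
  then have k: "lams ! b \<in> set lams" by (simp add: nb_def)
  show "Re (L' b) < 0" using b Re_lfun3_neg[OF _ lams_Im[OF k]] lams_base k by (auto simp: L'_def)
  show "hat b \<notin> {..<nb}" using b by (simp add: hat_def)
next
  fix b assume "b < N" "b \<notin> {..<nb}"
  then show "Re (L' b) > 0"
  proof (cases rule: index_cases)
    case second
    then show ?thesis using Re_lfun2_cnj_pos[of "lams ! (b - nb)"] lams_base by (auto simp: L'_def)
  next
    case third
    then have "cnj (mus ! (b - 2 * nb)) = mus ! (b - 2 * nb)" using mus_Im by (simp add: complex_eq_iff)
    then show ?thesis using Re_lfun2_cnj_pos[of "mus ! (b - 2 * nb)"] mus_base third by (auto simp: L'_def)
  qed auto
qed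

definition entry :: "(nat \<Rightarrow> complex) \<Rightarrow> real \<Rightarrow> complex \<Rightarrow> nat \<Rightarrow> nat \<Rightarrow> complex" where
  "entry C t z i j = (if i = j then 1 else 0) - C j * exp (z * (L i - L' j) + of_real t * (Zf i - Zf' j)) / (L i - L' j)"

text \<open>
  The determinant \<open>det(I - B)\<close> as a function of a complex space variable.  It is holomorphic in this variable, which
  settles the differentiability of its logarithmic derivative.
\<close>
definition tau :: "(nat \<Rightarrow> complex) \<Rightarrow> real \<Rightarrow> complex \<Rightarrow> complex" where
  "tau C t z = fdet N (entry C t z)"

lemma tau_pos:
  fixes y t :: real
  assumes C1: "\<And>k. k \<in> set lams \<Longrightarrow> c2 k = cnj (c1 k)"
    and C2: "\<And>k. k \<in> set mus \<Longrightarrow> \<exists>r\<ge>0. c3 k = of_real r"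
  shows "\<exists>r>0. tau (piece c1 c2 c3) t (of_real y) = of_real r"
proof -
  interpret P: paired_cauchy N hat L L' "\<lambda>b. exp (of_real y * L b + of_real t * Zf b)"
    "\<lambda>b. exp (- (of_real y * L' b) - of_real t * Zf' b)" "{..<nb}" by (rule paired_cauchy_phases)
  have "P.admissible (piece c1 c2 c3)"
    unfolding P.admissible_def
  proof (intro conjI allI impI)
    fix b assume b: "b < N"
    then show "piece c1 c2 c3 (hat b) = cnj (piece c1 c2 c3 b)"
    proof (cases rule: index_cases)
      case first
      then show ?thesis using C1 by (simp add: hat_def)
    next
      case second
      then have "b - nb < nb" "\<not> b < nb" by auto
      then show ?thesis using second C1 by (simp add: hat_def)
    next
      case third
      then have h: "hat b = b" by (auto simp: hat_def)
      obtain r where "c3 (mus ! (b - 2 * nb)) = of_real r" using C2[OF third(2)] by blast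
      then show ?thesis using third(1) unfolding h by simp
    qed
  next
    fix b assume b: "b < N" "b \<notin> {..<nb}"
    from b(1) show "hat b \<in> {..<nb} \<or> hat b = b \<and> (\<exists>r\<ge>0. piece c1 c2 c3 b = of_real r)"
    proof (cases rule: index_cases)
      case third
      then show ?thesis using C2[OF third(2)] by (auto simp: hat_def)
    qed (use b in \<open>auto simp: hat_def\<close>)
  qed
  then have "\<exists>r>0. P.det_C (piece c1 c2 c3) = of_real r" by (rule P.det_C_pos)
  moreover have "P.det_C (piece c1 c2 c3) = tau (piece c1 c2 c3) t (of_real y)"
    unfolding P.det_C_def tau_def
  proof (rule fdet_cong)
    fix i b
    have "exp (of_real y * (L i - L' b) + of_real t * (Zf i - Zf' b)) =
       exp (of_real y * L i + of_real t * Zf i) * exp (- (of_real y * L' b) - of_real t * Zf' b)"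
      by (simp add: exp_add[symmetric] algebra_simps)
    then show "(if i = b then 1 else 0) - exp (of_real y * L i + of_real t * Zf i) * exp (- (of_real y * L' b) - of_real t * Zf' b) / (L i - L' b) * piece c1 c2 c3 b
       = entry (piece c1 c2 c3) t (of_real y) i b"
      unfolding entry_def by simp
  qed
  ultimately show ?thesis by simp
qed

lemma entry_deriv:
  assumes "i < N" "j < N"
  shows "((\<lambda>z. entry C t z i j) has_field_derivative
    - (exp (z * L i + of_real t * Zf i) * (C j * exp (- (z * L' j) - of_real t * Zf' j)))) (at z)"
proof -
  have ne: "L i - L' j \<noteq> 0" using L_neq[OF assms] by simp
  have "((\<lambda>z. entry C t z i j) has_field_derivative
     0 - C j * (exp (z * (L i - L' j) + of_real t * (Zf i - Zf' j)) * ((L i - L' j) + 0)) / (L i - L' j)) (at z)"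
    unfolding entry_def
    by (rule DERIV_diff[OF DERIV_const] DERIV_cdivide DERIV_cmult DERIV_chain'[OF _ DERIV_exp, THEN DERIV_cong] derivative_eq_intros refl | simp)+
  moreover have "0 - C j * (exp (z * (L i - L' j) + of_real t * (Zf i - Zf' j)) * ((L i - L' j) + 0)) / (L i - L' j) =
     - (exp (z * L i + of_real t * Zf i) * (C j * exp (- (z * L' j) - of_real t * Zf' j)))"
  proof -
    have "exp (z * (L i - L' j) + of_real t * (Zf i - Zf' j)) = exp (z * L i + of_real t * Zf i) * exp (- (z * L' j) - of_real t * Zf' j)"
      by (simp add: exp_add[symmetric] algebra_simps)
    then show ?thesis using ne by simp
  qed
  ultimately show ?thesis by simp
qed

lemma tau_holomorphic: "tau C t holomorphic_on UNIV"
proof -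
  have "tau C t field_differentiable at z" for z
    unfolding tau_def field_differentiable_def
    by (rule exI, rule fdet_has_field_derivative, rule entry_deriv)
  then show ?thesis by (simp add: holomorphic_on_def field_differentiable_at_within)
qed

lemma tau_log_derivative:
  assumes v: "\<And>b. b < N \<Longrightarrow> v b = 1 + (\<Sum>b'<N. R b' * v b' / (L b - L' b'))"
    and R: "\<And>b. b < N \<Longrightarrow> R b = C b * exp (z * (L b - L' b) + of_real t * (Zf b - Zf' b))"
  shows "deriv (tau C t) z = - (tau C t z * (\<Sum>b<N. R b * v b))"
proof -
  define e where "e b = exp (z * L b + of_real t * Zf b)" for b
  define w where "w b = C b * exp (- (z * L' b) - of_real t * Zf' b)" for b
  have split: "exp (z * (L i - L' b) + of_real t * (Zf i - Zf' b)) = e i * exp (- (z * L' b) - of_real t * Zf' b)" for i b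
    unfolding e_def by (simp add: exp_add[symmetric] algebra_simps)
  have Rw: "R b = w b * e b" if "b < N" for b unfolding R[OF that] split w_def by simp
  have "((\<lambda>z. fdet N (entry C t z)) has_field_derivative - (fdet N (entry C t z) * (\<Sum>j<N. w j * (e j * v j)))) (at z)"
  proof (rule fdet_rank_one_derivative)
    show "((\<lambda>z. entry C t z i j) has_field_derivative - (e i * w j)) (at z)" if "i < N" "j < N" for i j
      unfolding e_def w_def by (rule entry_deriv[OF that])
    show "(\<Sum>j<N. entry C t z i j * (e j * v j)) = e i" if i: "i < N" for i
    proof -
      have "(\<Sum>j<N. entry C t z i j * (e j * v j)) = (\<Sum>j<N. (if i = j then e j * v j else 0) - e i * (R j * v j / (L i - L' j)))"
        by (intro sum.cong refl) (auto simp: entry_def split Rw w_def left_diff_distrib)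
      also have "\<dots> = e i * v i - e i * (\<Sum>j<N. R j * v j / (L i - L' j))"
        using i by (simp add: sum_subtractf sum_distrib_left)
      also have "\<dots> = e i" using v[OF i] by (simp add: right_diff_distrib[symmetric])
      finally show ?thesis .
    qed
  qed
  then have "deriv (tau C t) z = - (tau C t z * (\<Sum>j<N. w j * (e j * v j)))"
    unfolding tau_def by (rule DERIV_imp_deriv)
  also have "(\<Sum>j<N. w j * (e j * v j)) = (\<Sum>b<N. R b * v b)" by (intro sum.cong refl) (simp add: Rw)
  finally show ?thesis .
qed

lemma log_det_tau:
  "log_det (map (\<lambda>k. (k, cl k)) lams) (map (\<lambda>k. (k, cm k)) mus) y t =
    Ln (tau (piece (\<lambda>k. ctilde_breather (k, cl k)) (\<lambda>k. cnj (ctilde_breather (k, cl k))) (\<lambda>k. ctilde_soliton (k, cm k))) t (of_real y))"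
proof -
  define C where "C = piece (\<lambda>k. ctilde_breather (k, cl k)) (\<lambda>k. cnj (ctilde_breather (k, cl k))) (\<lambda>k. ctilde_soliton (k, cm k))"
  let ?d = "soliton_data (map (\<lambda>k. (k, cl k)) lams) (map (\<lambda>k. (k, cm k)) mus)"
  have len: "length ?d = N" unfolding soliton_data_def N_def nb_def by simp
  have d: "?d ! b = (L b, Zf b, L' b, Zf' b, C b)" if "b < N" for b
    using that
  proof (cases rule: index_cases)
    case first
    then have "b < length lams" by (simp add: nb_def)
    then show ?thesis using first(1)
      by (simp add: soliton_data_def nth_append Let_def L_def L'_def Zf_def Zf'_def C_def)
  next
    case second
    then have "\<not> b < length lams" "b - length lams < length lams" by (auto simp: nb_def)
    then show ?thesis using second(1,2)
      by (simp add: soliton_data_def nth_append Let_def L_def L'_def Zf_def Zf'_def C_def) (simp add: nb_def)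
  next
    case third
    then have "\<not> b < length lams" "\<not> b - length lams < length lams" "b - length lams - length lams < length mus"
      using that by (auto simp: nb_def N_def)
    moreover have "b - length lams - length lams = b - 2 * nb" by (simp add: nb_def)
    ultimately show ?thesis using third(1)
      by (simp add: soliton_data_def nth_append Let_def L_def L'_def Zf_def Zf'_def C_def)
  qed
  have dim: "dim_row (soliton_matrix (map (\<lambda>k. (k, cl k)) lams) (map (\<lambda>k. (k, cm k)) mus) y t) = N"
    unfolding soliton_matrix_def Let_def len by simp
  have "1\<^sub>m N - soliton_matrix (map (\<lambda>k. (k, cl k)) lams) (map (\<lambda>k. (k, cm k)) mus) y t =
     Matrix.mat N N (\<lambda>(i, j). entry C t (of_real y) i j)"
    unfolding soliton_matrix_def Let_def len
    by (intro eq_matI) (auto simp: d entry_def)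
  then show ?thesis
    unfolding log_det_def Let_def dim tau_def fdet_def C_def[symmetric] by simp
qed

end

section \<open>The multi-soliton formula\<close>

lemma rowsum_tendsto_1:
  assumes "\<And>i j. (\<lambda>k. M k $ i $ j - (Finite_Cartesian_Product.mat 1 :: complex^3^3) $ i $ j) \<in> O[at_infinity](\<lambda>k. inverse k)"
  shows "(rowsum M 3 \<longlongrightarrow> 1) at_infinity"
proof -
  have "((\<lambda>k. M k $ i $ 3 - (Finite_Cartesian_Product.mat 1 :: complex^3^3) $ i $ 3) \<longlongrightarrow> 0) at_infinity" for i
  proof -
    obtain c where ev: "\<forall>\<^sub>F k in at_infinity. norm (M k $ i $ 3 - (Finite_Cartesian_Product.mat 1 :: complex^3^3) $ i $ 3) \<le> c * norm (inverse k)"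
      using assms[of i 3] by (elim landau_o.bigE) blast
    have lim: "((\<lambda>k::complex. c * norm (inverse k)) \<longlongrightarrow> c * norm (0::complex)) at_infinity"
      by (intro tendsto_mult_left tendsto_norm tendsto_inverse_0)
    show ?thesis by (rule Lim_null_comparison[OF ev]) (use lim in simp)
  qed
  then have "((\<lambda>k. \<Sum>i\<in>UNIV. (M k $ i $ 3 - (Finite_Cartesian_Product.mat 1 :: complex^3^3) $ i $ 3) + (Finite_Cartesian_Product.mat 1 :: complex^3^3) $ i $ 3) \<longlongrightarrow>
     (\<Sum>i\<in>UNIV. 0 + (Finite_Cartesian_Product.mat 1 :: complex^3^3) $ i $ 3)) at_infinity"
    by (intro tendsto_sum tendsto_add tendsto_const)
  moreover have "(\<Sum>i\<in>UNIV. (Finite_Cartesian_Product.mat 1 :: complex^3^3) $ i $ 3) = 1"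
    by (simp add: sum_3 Finite_Cartesian_Product.mat_def)
  ultimately show ?thesis by (simp add: rowsum_def[abs_def])
qed

lemma Zhat_orbits:
  assumes "Zset u0 u1 = P \<union> Q" "\<And>k. k \<in> Q \<Longrightarrow> cnj k = k"
  defines "B \<equiv> P \<union> cnj ` P \<union> Q"
  shows "Zhat u0 u1 = rotation_orbit B \<union> inverse ` rotation_orbit B"
proof -
  have B: "k \<in> B \<longleftrightarrow> (\<exists>k0\<in>Zset u0 u1. k = k0 \<or> k = cnj k0)" for k
    unfolding assms(1) B_def using assms(2) by fastforce
  have "z \<in> Zhat u0 u1 \<longleftrightarrow> (\<exists>k\<in>B. \<exists>j\<in>{0, 1, 2::nat}. z = \<omega> ^ j * k \<or> z = \<omega> ^ j * inverse k)" for z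
  proof -
    have bex: "(\<exists>k\<in>B. R k) \<longleftrightarrow> (\<exists>k0\<in>Zset u0 u1. R k0 \<or> R (cnj k0))" for R using B by blast
    show ?thesis unfolding Zhat_def bex by blast
  qed
  also have "(\<exists>k\<in>B. \<exists>j\<in>{0, 1, 2::nat}. z = \<omega> ^ j * k \<or> z = \<omega> ^ j * inverse k) \<longleftrightarrow>
     (\<exists>k\<in>B. (z = k \<or> z = \<omega> * k \<or> z = \<omega>\<^sup>2 * k) \<or> (z = inverse k \<or> z = \<omega> * inverse k \<or> z = \<omega>\<^sup>2 * inverse k))" for z
    by (intro bex_cong refl) auto
  also have "\<dots> z \<longleftrightarrow> z \<in> rotation_orbit B \<union> inverse ` rotation_orbit B" for z
    unfolding rotation_orbit_def image_Un image_image inverse_omega_mult by blast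
  finally show ?thesis by blast
qed

text \<open>
  The factor \<open>\<omega>\<^sup>2\<close> in the second part comes from the rotation of the pole from \<open>cnj k\<close> to \<open>\<omega>\<^sup>2 cnj k\<close>.  The factor that relates the residue constants at \<open>k\<close>
  and at \<open>cnj k\<close> is such that the weights in the variable \<open>l\<^sub>3\<close> are complex conjugates.
\<close>
lemma breather_weight:
  fixes k D D' c :: complex
  assumes "k \<noteq> 0" "(cnj k)\<^sup>2 \<noteq> \<omega>\<^sup>2"
  shows "l3_deriv k * (c * E / D) = ctilde_breather (k, c / D) * E"
    and "cnj D = D' \<Longrightarrow> l3_deriv (\<omega>\<^sup>2 * cnj k) * (\<omega>\<^sup>2 * (((cnj k)\<^sup>2 - 1) / (\<omega>\<^sup>2 * (\<omega>\<^sup>2 - (cnj k)\<^sup>2)) * cnj c * E / D'))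
       = cnj (ctilde_breather (k, c / D)) * E"
proof -
  show "l3_deriv k * (c * E / D) = ctilde_breather (k, c / D) * E"
    unfolding l3_deriv_def ctilde_breather_def by simp
  assume D: "cnj D = D'"
  define z where "z = cnj k"
  define s where "s = complex_of_real (sqrt 3)"
  have z0: "z \<noteq> 0" "z\<^sup>2 \<noteq> \<omega>\<^sup>2" using assms by (auto simp: z_def)
  have w: "(\<omega>\<^sup>2 * z)\<^sup>2 = \<omega> * z\<^sup>2"
    using omega_facts(1) by (simp add: power2_eq_square power3_eq_cube mult_ac)
  have l: "l3_deriv (\<omega>\<^sup>2 * z) * \<omega>\<^sup>2 = \<omega>\<^sup>2 * (\<i> * (z\<^sup>2 - \<omega>\<^sup>2) / (2 * s * z\<^sup>2))"
  proof -
    have "(\<omega> * z\<^sup>2 - 1) = \<omega> * (z\<^sup>2 - \<omega>\<^sup>2)" using omega_facts(1) by (simp add: right_diff_distrib power2_eq_square power3_eq_cube mult.assoc)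
    then show ?thesis unfolding l3_deriv_def w s_def[symmetric] using omega_facts(3) z0 by (simp add: mult_ac)
  qed
  have "l3_deriv (\<omega>\<^sup>2 * z) * (\<omega>\<^sup>2 * ((z\<^sup>2 - 1) / (\<omega>\<^sup>2 * (\<omega>\<^sup>2 - z\<^sup>2)) * cnj c * E / D')) =
     (l3_deriv (\<omega>\<^sup>2 * z) * \<omega>\<^sup>2) * ((z\<^sup>2 - 1) / (\<omega>\<^sup>2 * (\<omega>\<^sup>2 - z\<^sup>2))) * cnj c * E / D'"
    by (simp add: mult_ac)
  also have "(l3_deriv (\<omega>\<^sup>2 * z) * \<omega>\<^sup>2) * ((z\<^sup>2 - 1) / (\<omega>\<^sup>2 * (\<omega>\<^sup>2 - z\<^sup>2))) = - (\<i> * (z\<^sup>2 - 1) / (2 * s * z\<^sup>2))"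
  proof -
    define X where "X = z\<^sup>2 - \<omega>\<^sup>2"
    have X: "X \<noteq> 0" "\<omega>\<^sup>2 - z\<^sup>2 = - X" using z0 by (auto simp: X_def)
    have "\<omega>\<^sup>2 * (\<i> * X / (2 * s * z\<^sup>2)) * ((z\<^sup>2 - 1) / (\<omega>\<^sup>2 * - X)) = - (\<i> * (z\<^sup>2 - 1) / (2 * s * z\<^sup>2))"
      using X(1) omega_facts(3) z0(1) by (simp add: s_def field_simps)
    then show ?thesis unfolding l X(2) unfolding X_def .
  qed
  also have "- (\<i> * (z\<^sup>2 - 1) / (2 * s * z\<^sup>2)) * cnj c * E / D' = cnj (ctilde_breather (k, c / D)) * E"
    unfolding ctilde_breather_def z_def s_def by (simp add: D)
  finally show "l3_deriv (\<omega>\<^sup>2 * cnj k) * (\<omega>\<^sup>2 * (((cnj k)\<^sup>2 - 1) / (\<omega>\<^sup>2 * (\<omega>\<^sup>2 - (cnj k)\<^sup>2)) * cnj c * E / D'))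
       = cnj (ctilde_breather (k, c / D)) * E" unfolding z_def .
qed

lemma soliton_weight:
  assumes "k \<noteq> 0"
  shows "l3_deriv (\<omega>\<^sup>2 * k) * (\<omega>\<^sup>2 * (c * E / D)) = ctilde_soliton (k, c / D) * E"
proof -
  have w: "(\<omega>\<^sup>2 * k)\<^sup>2 = \<omega> * k\<^sup>2"
    using omega_facts(1) by (simp add: power2_eq_square power3_eq_cube mult_ac)
  have "(\<omega> * k\<^sup>2 - 1) = \<omega> * (k\<^sup>2 - \<omega>\<^sup>2)" using omega_facts(1) by (simp add: right_diff_distrib power2_eq_square power3_eq_cube mult.assoc)
  then show ?thesis unfolding l3_deriv_def w ctilde_soliton_def using omega_facts(3) by (simp add: mult_ac)
qed

theorem theorem2p3:
  fixes u0 u1 :: "real \<Rightarrow> real" and I :: "real set"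
    and lams mus :: "complex list"
    and Msol :: "real \<Rightarrow> real \<Rightarrow> real \<Rightarrow> complex \<Rightarrow> complex^3^3"
    and x t :: real
  assumes "schwartz u0" and "schwartz u1" and "(LBINT y. u1 y) = 0"
    and "assm_solitons u0 u1" and "assm_generic u0 u1" and "assm_r1 u0 u1"
    and "compact I" and "I \<subseteq> {1<..}"
    and "distinct lams" and "set lams = Zset u0 u1 \<inter> Dreg"
    and "distinct mus" and "set mus = Zset u0 u1 \<inter> \<real>"
    and "x / t \<in> I"
    and "\<forall>\<^sub>F y in nhds x. solves_RHP_sol u0 u1 (x / t) y t (Msol (x / t) y t)"
  shows "u_sol Msol x t =
    u_s x t
      (map (\<lambda>a. (a, res_const u0 u1 a /
              (Delta_hat11 u0 u1 (x / t) a * inverse (Delta_hat33 u0 u1 (x / t) a)))) lams)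
      (map (\<lambda>a. (a, res_const u0 u1 a /
              (Delta_hat11 u0 u1 (x / t) a * inverse (Delta_hat22 u0 u1 (x / t) a)))) mus)"
proof -
  define \<zeta> where "\<zeta> = x / t"
  have \<zeta>: "\<zeta> > 1" using assms(8,13) unfolding \<zeta>_def by auto
  define Z where "Z = Zset u0 u1"
  have Zsub: "Z \<subseteq> Dreg \<union> complex_of_real ` ({-1<..<0} \<union> {1<..})"
    using assms(4) unfolding assm_solitons_def Z_def by blast
  have ImR: "k \<in> \<real> \<longleftrightarrow> Im k = 0" for k by (simp add: complex_is_Real_iff)
  have mus: "k \<in> base_points \<and> Im k = 0" if "k \<in> set mus" for k
  proof -
    have k: "k \<in> Z" "Im k = 0" using that assms(12) ImR unfolding Z_def by auto
    then have "k \<in> complex_of_real ` ({-1<..<0} \<union> {1<..})" using Zsub Dreg_base_points(2) by blast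
    then show ?thesis using real_base_points k by blast
  qed
  interpret soliton_points lams mus
  proof
    show "set lams \<subseteq> base_points" using assms(10) Dreg_base_points(1) by blast
    show "Im k \<noteq> 0" if "k \<in> set lams" for k using that assms(10) Dreg_base_points(2) by blast
    show "set mus \<subseteq> base_points" using mus by blast
    show "Im k = 0" if "k \<in> set mus" for k using that mus by blast
  qed (rule assms(9), rule assms(11))
  have lamsZ: "k \<in> Z - \<real>" if "k \<in> set lams" for k
    using that assms(10) lams_Im[OF that] ImR unfolding Z_def by auto
  have musZ: "k \<in> Z \<inter> \<real>" if "k \<in> set mus" for k using that assms(12) unfolding Z_def by blast
  have Zsplit: "Z = set lams \<union> set mus"
    using Zsub assms(10,12) unfolding Z_def by auto
  have cnj_mu: "cnj k = k" if "k \<in> set mus" for k using mus_Im[OF that] by (simp add: complex_eq_iff)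
  have Zh: "Zhat u0 u1 = rotation_orbit base \<union> inverse ` rotation_orbit base"
    unfolding base_def by (rule Zhat_orbits[OF Zsplit[unfolded Z_def] cnj_mu])
  have base_nz: "k \<noteq> 0" "norm k \<noteq> 1" if "k \<in> set lams \<union> set mus" for k
    using that lams_base mus_base base_points_nonzero by blast+
  define c where "c = res_const u0 u1"
  define Dl where "Dl k = Delta_hat11 u0 u1 \<zeta> k * inverse (Delta_hat33 u0 u1 \<zeta> k)" for k
  define Dd where "Dd k = Delta_hat33 u0 u1 \<zeta> (cnj k) * inverse (Delta_hat22 u0 u1 \<zeta> (cnj k))" for k
  define Dm where "Dm k = Delta_hat11 u0 u1 \<zeta> k * inverse (Delta_hat22 u0 u1 \<zeta> k)" for k
  have Dl_cnj: "cnj (Dl k) = Dd k" if "k \<in> set lams" for k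
    unfolding Dl_def Dd_def by (rule Delta_ratio_cnj[OF assms(1-3) \<zeta>]) (use base_nz that in auto)
  define cb where "cb k = ctilde_breather (k, c k / Dl k)" for k
  define cs where "cs k = ctilde_soliton (k, c k / Dm k)" for k
  define C where "C = piece cb (\<lambda>k. cnj (cb k)) cs"
  have cs_pos: "\<exists>r\<ge>0. cs k = of_real r" if k: "k \<in> set mus" for k
  proof -
    have "\<i> * (\<omega>\<^sup>2 * k\<^sup>2 - \<omega>) * c k \<in> \<real>\<^sub>\<ge>\<^sub>0"
      using assms(4) musZ[OF k] unfolding assm_solitons_def c_def Z_def by blast
    then obtain r where r: "r \<ge> 0" "\<i> * (\<omega>\<^sup>2 * k\<^sup>2 - \<omega>) * c k = of_real r" by (auto simp: nonneg_Reals_def)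
    have "k \<in> \<real>" using musZ[OF k] by blast
    then obtain \<mu> where \<mu>: "k = of_real \<mu>" by (auto simp: Reals_def)
    have \<mu>0: "\<mu> \<noteq> 0" using base_nz(1)[of k] k \<mu> by auto
    obtain d where d: "d > 0" "Dm k = of_real d"
      using Delta_ratio_pos[OF assms(1-3) \<zeta> base_nz(1) base_nz(2) \<open>k \<in> \<real>\<close>] k unfolding Dm_def by blast
    have "(k\<^sup>2 - \<omega>\<^sup>2) * \<omega>\<^sup>2 = \<omega>\<^sup>2 * k\<^sup>2 - \<omega>"
    proof -
      have "\<omega>\<^sup>2 * \<omega>\<^sup>2 = \<omega>" using omega_mult(2)[of \<omega>] by (simp add: power2_eq_square)
      then show ?thesis by (simp only: left_diff_distrib) (simp only: mult.commute)
    qed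
    moreover have "cs k = (\<i> * ((k\<^sup>2 - \<omega>\<^sup>2) * \<omega>\<^sup>2) * c k) / (2 * of_real (sqrt 3) * k\<^sup>2 * Dm k)"
      unfolding cs_def ctilde_soliton_def by (simp add: mult.assoc)
    ultimately have "cs k = (\<i> * (\<omega>\<^sup>2 * k\<^sup>2 - \<omega>) * c k) / (2 * of_real (sqrt 3) * k\<^sup>2 * Dm k)"
      by simp
    also have "\<dots> = of_real (r / (2 * sqrt 3 * \<mu>\<^sup>2 * d))" unfolding r(2) d(2) by (simp add: \<mu>)
    finally show ?thesis using r(1) d(1) \<mu>0 by (intro exI[of _ "r / (2 * sqrt 3 * \<mu>\<^sup>2 * d)"]) auto
  qed
  define \<tau> where "\<tau> = tau C t"
  have \<tau>_pos: "\<exists>r>0. \<tau> (of_real y) = of_real r" for y :: real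
    unfolding \<tau>_def C_def by (rule tau_pos) (use cs_pos in auto)
  have \<tau>_hol: "\<tau> holomorphic_on UNIV" unfolding \<tau>_def by (rule tau_holomorphic)
  define Q where "Q z = deriv \<tau> z / \<tau> z" for z
  have dQ: "Q field_differentiable at (of_real y)" for y :: real
  proof -
    have "\<tau> (of_real y) \<noteq> 0" using \<tau>_pos[of y] by auto
    moreover have "deriv \<tau> holomorphic_on UNIV" by (rule holomorphic_deriv[OF \<tau>_hol]) simp
    ultimately show ?thesis
      unfolding Q_def using \<tau>_hol
      by (intro field_differentiable_divide holomorphic_on_imp_differentiable_at[of _ UNIV]) auto
  qed
  have vQ: "((\<lambda>y. Q (of_real y)) has_vector_derivative deriv Q (of_real x)) (at x)"
    using dQ[of x] by (intro has_vector_derivative_real_field) (simp add: DERIV_deriv_iff_field_differentiable)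
  \<comment> \<open>the limit is the logarithmic derivative of the determinant wherever a solution exists\<close>
  have sys: "Lim at_infinity (\<lambda>k. k * ((vector [1, 1, 1] v* Msol \<zeta> y t k) $ 3 - 1)) =
      - (2 * of_real (sqrt 3) / \<i>) * Q (of_real y)"
    if sol: "solves_RHP_sol u0 u1 \<zeta> y t (Msol \<zeta> y t)" for y
  proof -
    define M where "M = Msol \<zeta> y t"
    define e13 where "e13 k = exp (- theta_phase 3 1 y t k)" for k
    define e32 where "e32 k = exp (theta_phase 3 2 y t (cnj k))" for k
    define e12 where "e12 k = exp (- theta_phase 2 1 y t k)" for k
    have s: "solves_RHP_sol u0 u1 \<zeta> y t M" using sol unfolding M_def .
    define R where "R = piece (\<lambda>k. l3_deriv k * (c k * e13 k / Dl k))
         (\<lambda>k. l3_deriv (\<omega>\<^sup>2 * cnj k) * (\<omega>\<^sup>2 * (res_const_conj u0 u1 k * e32 k / Dd k)))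
         (\<lambda>k. l3_deriv (\<omega>\<^sup>2 * k) * (\<omega>\<^sup>2 * (c k * e12 k / Dm k)))"
    have "\<exists>v. (\<forall>b<N. v b = 1 + (\<Sum>b'<N. R b' * v b' / (L b - L' b'))) \<and>
      ((\<lambda>k. k * (rowsum M 3 k - 1)) \<longlongrightarrow> 2 * of_real (sqrt 3) / \<i> * (\<Sum>b<N. R b * v b)) at_infinity"
    unfolding R_def
    proof (rule row_sum_system[OF Zh])
      show "(\<lambda>k. M k $ i $ j) analytic_on - Zhat u0 u1" for i j using s unfolding solves_RHP_sol_def by blast
      show "M k = Acal ** M (\<omega> * k) ** matrix_inv Acal" if "k \<notin> Zhat u0 u1" for k
        using s that unfolding solves_RHP_sol_def by blast
      show "M k = Bcal ** M (inverse k) ** Bcal" if "k \<notin> Zhat u0 u1" "k \<noteq> 0" for k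
        using s that unfolding solves_RHP_sol_def by blast
      show "(rowsum M 3 \<longlongrightarrow> 1) at_infinity"
        by (rule rowsum_tendsto_1) (use s in \<open>unfold solves_RHP_sol_def, blast\<close>)
      show "residue_condition M k 3 1 (c k * e13 k / Dl k)" if "k \<in> set lams" for k
        using s lamsZ[OF that] unfolding solves_RHP_sol_def c_def e13_def Dl_def Z_def by blast
      show "residue_condition M (cnj k) 2 3 (res_const_conj u0 u1 k * e32 k / Dd k)" if "k \<in> set lams" for k
        using s lamsZ[OF that] unfolding solves_RHP_sol_def e32_def Dd_def Z_def by blast
      show "residue_condition M k 2 1 (c k * e12 k / Dm k)" if "k \<in> set mus" for k
        using s musZ[OF that] unfolding solves_RHP_sol_def c_def e12_def Dm_def Z_def by blast
    qed
    then obtain v where v: "\<And>b. b < N \<Longrightarrow> v b = 1 + (\<Sum>b'<N. R b' * v b' / (L b - L' b'))"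
      and lim: "((\<lambda>k. k * (rowsum M 3 k - 1)) \<longlongrightarrow> 2 * of_real (sqrt 3) / \<i> * (\<Sum>b<N. R b * v b)) at_infinity" by blast
    have R: "R b = C b * exp (of_real y * (L b - L' b) + of_real t * (Zf b - Zf' b))" if "b < N" for b
      using that
    proof (cases rule: index_cases)
      case first
      then have nz: "lams ! b \<noteq> 0" using base_nz(1) by blast
      have "e13 (lams ! b) = exp (of_real y * (L b - L' b) + of_real t * (Zf b - Zf' b))"
        using first(1) unfolding e13_def theta_phase_def L_def L'_def Zf_def Zf'_def by (simp add: algebra_simps)
      then show ?thesis using first(1) unfolding C_def R_def by (simp add: l3_deriv_def cb_def ctilde_breather_def mult_ac)
    next
      case second
      define k where "k = lams ! (b - nb)"
      have k: "k \<in> set lams" using second unfolding k_def by blast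
      then have nz: "k \<noteq> 0" using base_nz(1) by blast
      have "cnj k ^ 2 \<noteq> \<omega>\<^sup>2"
      proof
        assume "(cnj k)\<^sup>2 = \<omega>\<^sup>2"
        then have "norm ((cnj k)\<^sup>2) = 1" using omega_facts(2) by (simp only: norm_power power_one)
        then have "norm k = 1" by (simp add: norm_power abs_square_eq_1 power2_eq_1_iff) 
        then show False using base_nz(2) k by blast
      qed
      from breather_weight(2)[OF nz this Dl_cnj[OF k], of "c k" "e32 k"]
      have W: "l3_deriv (\<omega>\<^sup>2 * cnj k) * (\<omega>\<^sup>2 * (res_const_conj u0 u1 k * e32 k / Dd k)) = cnj (cb k) * e32 k"
        unfolding res_const_conj_def cb_def c_def .
      have E: "e32 k = exp (of_real y * (L b - L' b) + of_real t * (Zf b - Zf' b))"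
        using second(1,2) unfolding e32_def theta_phase_def L_def L'_def Zf_def Zf'_def k_def by (simp add: algebra_simps)
      show ?thesis unfolding C_def R_def piece_simps(2)[OF second(1,2)] k_def[symmetric] E by (rule W[unfolded E])
    next
      case third
      define k where "k = mus ! (b - 2 * nb)"
      have k: "k \<in> set mus" using third unfolding k_def by blast
      then have nz: "k \<noteq> 0" using base_nz(1) by blast
      have "e12 k = exp (of_real y * (L b - L' b) + of_real t * (Zf b - Zf' b))"
        using third(1) unfolding e12_def theta_phase_def L_def L'_def Zf_def Zf'_def k_def by (simp add: algebra_simps)
      then show ?thesis using third(1) soliton_weight[OF nz, of "c k" "e12 k" "Dm k"] unfolding C_def R_def cs_def
        by (simp add: k_def[symmetric])
    qed
    have "deriv \<tau> (of_real y) = - (\<tau> (of_real y) * (\<Sum>b<N. R b * v b))"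
      unfolding \<tau>_def by (rule tau_log_derivative[OF v R])
    then have "(\<Sum>b<N. R b * v b) = - Q (of_real y)"
      unfolding Q_def using \<tau>_pos[of y] by auto
    then have "((\<lambda>k. k * ((vector [1, 1, 1] v* M k) $ 3 - 1)) \<longlongrightarrow> - (2 * of_real (sqrt 3) / \<i>) * Q (of_real y)) at_infinity"
      using lim unfolding rowsum_eq by simp
    then show ?thesis unfolding M_def by (rule tendsto_Lim[OF trivial_limit_at_infinity])
  qed
  have "((\<lambda>y. Lim at_infinity (\<lambda>k. k * ((vector [1, 1, 1] v* Msol \<zeta> y t k) $ 3 - 1))) has_vector_derivative
      - (2 * of_real (sqrt 3) / \<i>) * deriv Q (of_real x)) (at x)"
  proof -
    obtain S where S: "open S" "x \<in> S" "\<And>y. y \<in> S \<Longrightarrow> solves_RHP_sol u0 u1 \<zeta> y t (Msol \<zeta> y t)"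
      using assms(14) unfolding eventually_nhds \<zeta>_def by blast
    show ?thesis
      by (rule has_vector_derivative_transform_within_open[OF has_vector_derivative_mult_right[OF vQ] S(1,2)])
         (simp only: sys[OF S(3)])
  qed
  then have lhs: "u_sol Msol x t = 6 * deriv Q (of_real x)"
    unfolding u_sol_def \<zeta>_def[symmetric] by (simp add: vector_derivative_at) (simp add: mult.assoc[symmetric] flip: of_real_mult)
  define ll where "ll = map (\<lambda>k. (k, c k / Dl k)) lams"
  define mm where "mm = map (\<lambda>k. (k, c k / Dm k)) mus"
  have ld: "log_det ll mm y t = Ln (\<tau> (of_real y))" for y
    unfolding ll_def mm_def \<tau>_def C_def cb_def cs_def by (rule log_det_tau)
  have "((\<lambda>y. log_det ll mm y t) has_vector_derivative Q (of_real y)) (at y)" for y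
  proof -
    obtain r where r: "r > 0" "\<tau> (of_real y) = of_real r" using \<tau>_pos by blast
    \<comment> \<open>positivity keeps the principal logarithm differentiable\<close>
    then have np: "\<tau> (of_real y) \<notin> \<real>\<^sub>\<le>\<^sub>0" by (auto simp: nonpos_Reals_def)
    have "(\<tau> has_field_derivative deriv \<tau> (of_real y)) (at (of_real y))"
      using \<tau>_hol by (simp add: DERIV_deriv_iff_field_differentiable holomorphic_on_imp_differentiable_at[of _ UNIV])
    then have "((\<lambda>z. Ln (\<tau> z)) has_field_derivative inverse (\<tau> (of_real y)) * deriv \<tau> (of_real y)) (at (of_real y))"
      by (rule DERIV_chain2[where f = Ln and g = \<tau>, OF has_field_derivative_Ln[OF np]])
    then have "((\<lambda>z. Ln (\<tau> z)) has_field_derivative Q (of_real y)) (at (of_real y))"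
      unfolding Q_def by (simp add: divide_inverse mult.commute)
    then show ?thesis unfolding ld by (rule has_vector_derivative_real_field)
  qed
  then have "(\<lambda>y. vector_derivative (\<lambda>y'. log_det ll mm y' t) (at y)) = (\<lambda>y. Q (of_real y))"
    by (intro ext vector_derivative_at)
  then have rhs: "u_s x t ll mm = 6 * deriv Q (of_real x)"
    unfolding u_s_def using vector_derivative_at[OF vQ] by simp
  show ?thesis
    using lhs rhs unfolding ll_def mm_def c_def Dl_def Dm_def \<zeta>_def by simp
qed

end
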